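(* Let $d \ge 3$ be an integer. There exists a constant $c_d \in (0,\infty)$ depending only on $d$ such that for all $p \in \mathbb{C}[z_1,\ldots,z_d]$, $$\|p\|_{\mathrm{SA}} \le c_d \left( |p(0)| + \int_{0}^1 \|(R p)_r\|_\infty \Big( \log\Big(\frac{1}{1-r} \Big) \Big)^{d - 3} \, dr \right).$$
   Context: The Schur--Agler norm of a polynomial $p\in\mathbb{C}[z_1,\dots,z_d]$ is $\|p\|_{\mathrm{SA}} = \sup \|p(T)\|$, where the supremum is over all $d$-tuples $T=(T_1,\dots,T_d)$ of commuting contractions (operators of norm at most $1$) on a complex Hilbert space. For a holomorphic function $f$ on the polydisc $\mathbb{D}^d$ (with $\mathbb{D}$ the open unit disc), the radial derivative is $(Rf)(z) = \sum_{j=1}^d z_j \frac{\partial f}{\partial z_j}(z)$; for $0\le r\le 1$ we write $f_r(z) = f(rz)$; and $\|f\|_\infty=\sup_{z\in\mathbb{D}^d}|f(z)|$. *)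

theory Defs
  imports
    "HOL-Analysis.Analysis"
    "HOL-Algebra.Module"
    "HOL-Library.Poly_Mapping"
begin

section \<open>Complex Hilbert spaces with explicit carrier\<close>

text \<open>
  The multiplicative fields inherited from \<^type>\<open>module_ext\<close> are not used.
  The inner product is linear in its first argument.
\<close>

definition complex_ring :: "complex ring"
  where "complex_ring = \<lparr>carrier = UNIV, mult = (*), one = 1, zero = 0, add = (+)\<rparr>"

lemma cring_complex_ring: "cring complex_ring"
proof (rule cringI)
  show "abelian_group complex_ring"
    by (rule abelian_groupI)
      (auto simp: complex_ring_def algebra_simps intro: exI[of _ "- x" for x] left_minus)
  show "comm_monoid complex_ring"
    by (rule comm_monoidI) (auto simp: complex_ring_def algebra_simps)
qed (simp add: complex_ring_def algebra_simps)

record 'h cinner_space = "(complex, 'h) module" +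
  cinner :: "'h \<Rightarrow> 'h \<Rightarrow> complex"

definition hnorm :: "('h, 'z) cinner_space_scheme \<Rightarrow> 'h \<Rightarrow> real"
  where "hnorm H x = sqrt (Re (cinner H x x))"

locale complex_hilbert_space = module complex_ring H
  for H :: "('h, 'z) cinner_space_scheme" (structure) +
  assumes cinner_add_left:
      "\<lbrakk>x \<in> carrier H; y \<in> carrier H; z \<in> carrier H\<rbrakk>
        \<Longrightarrow> cinner H (x \<oplus> y) z = cinner H x z + cinner H y z"
    and cinner_smult_left:
      "\<lbrakk>x \<in> carrier H; y \<in> carrier H\<rbrakk> \<Longrightarrow> cinner H (a \<odot> x) y = a * cinner H x y"
    and cinner_commute:
      "\<lbrakk>x \<in> carrier H; y \<in> carrier H\<rbrakk> \<Longrightarrow> cinner H y x = cnj (cinner H x y)"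
    and cinner_pos:
      "\<lbrakk>x \<in> carrier H; x \<noteq> \<zero>\<rbrakk> \<Longrightarrow> Re (cinner H x x) > 0"
    and complete:
      "\<lbrakk>\<And>n :: nat. \<xi> n \<in> carrier H;
        \<And>e :: real. e > 0 \<Longrightarrow> \<exists>N. \<forall>m\<ge>N. \<forall>n\<ge>N. hnorm H (\<xi> m \<ominus> \<xi> n) < e\<rbrakk>
        \<Longrightarrow> \<exists>x\<in>carrier H. (\<lambda>n. hnorm H (\<xi> n \<ominus> x)) \<longlonglongrightarrow> 0"


section \<open>Operators, commuting contractions and polynomials in them\<close>

definition linear_op :: "('h, 'z) cinner_space_scheme \<Rightarrow> ('h \<Rightarrow> 'h) \<Rightarrow> bool"
  where "linear_op H A \<longleftrightarrow>
    A \<in> carrier H \<rightarrow> carrier H \<and>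
    (\<forall>x\<in>carrier H. \<forall>y\<in>carrier H. A (x \<oplus>\<^bsub>H\<^esub> y) = A x \<oplus>\<^bsub>H\<^esub> A y) \<and>
    (\<forall>a. \<forall>x\<in>carrier H. A (a \<odot>\<^bsub>H\<^esub> x) = a \<odot>\<^bsub>H\<^esub> A x)"

text \<open>Values in \<^typ>\<open>ennreal\<close>, so the supremum is meaningful for unbounded operators too.\<close>

definition op_norm :: "('h, 'z) cinner_space_scheme \<Rightarrow> ('h \<Rightarrow> 'h) \<Rightarrow> ennreal"
  where "op_norm H A = (SUP x\<in>{x \<in> carrier H. hnorm H x \<le> 1}. ennreal (hnorm H (A x)))"

definition commuting_contractions ::
    "nat \<Rightarrow> ('h, 'z) cinner_space_scheme \<Rightarrow> (nat \<Rightarrow> 'h \<Rightarrow> 'h) \<Rightarrow> bool"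
  where "commuting_contractions d H T \<longleftrightarrow>
    (\<forall>i<d. linear_op H (T i) \<and> op_norm H (T i) \<le> 1) \<and>
    (\<forall>i<d. \<forall>j<d. \<forall>x\<in>carrier H. T i (T j x) = T j (T i x))"

text \<open>
  A polynomial is an element of the monoid algebra of finitely supported exponent vectors;
  the indeterminates $z_1, \dots, z_d$ of the mathematics are numbered \<open>0, \<dots>, d - 1\<close>.
\<close>

type_synonym mpoly = "(nat \<Rightarrow>\<^sub>0 nat) \<Rightarrow>\<^sub>0 complex"

definition mpoly_vars :: "mpoly \<Rightarrow> nat set"
  where "mpoly_vars p = (\<Union>m\<in>Poly_Mapping.keys p. Poly_Mapping.keys m)"

definition mpoly_eval :: "mpoly \<Rightarrow> (nat \<Rightarrow> complex) \<Rightarrow> complex"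
  where "mpoly_eval p z = (\<Sum>m\<in>Poly_Mapping.keys p. Poly_Mapping.lookup p m * (\<Prod>i\<in>Poly_Mapping.keys m. z i ^ Poly_Mapping.lookup m i))"

text \<open>The product $T_0^{m_0} \cdots T_{d-1}^{m_{d-1}}$.\<close>

definition monom_op :: "nat \<Rightarrow> (nat \<Rightarrow> 'h \<Rightarrow> 'h) \<Rightarrow> (nat \<Rightarrow>\<^sub>0 nat) \<Rightarrow> 'h \<Rightarrow> 'h"
  where "monom_op d T m = foldr (\<lambda>i A. (T i ^^ Poly_Mapping.lookup m i) \<circ> A) [0..<d] id"

definition poly_op ::
    "nat \<Rightarrow> ('h, 'z) cinner_space_scheme \<Rightarrow> (nat \<Rightarrow> 'h \<Rightarrow> 'h) \<Rightarrow> mpoly \<Rightarrow> 'h \<Rightarrow> 'h"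
  where "poly_op d H T p x = (\<Oplus>\<^bsub>H\<^esub>m\<in>Poly_Mapping.keys p. Poly_Mapping.lookup p m \<odot>\<^bsub>H\<^esub> monom_op d T m x)"

text \<open>
  HOL cannot quantify over all types inside a term, so the Hilbert spaces range over those whose
  carrier is a set of complex sequences. This loses nothing: the lemma
  \<open>op_norm_le_schur_agler_norm\<close> below shows that the supremum dominates the norm of \<open>p(T)\<close>
  for commuting contractions on a Hilbert space over an arbitrary type.
\<close>

definition schur_agler_norm :: "nat \<Rightarrow> mpoly \<Rightarrow> ennreal"
  where "schur_agler_norm d p =
    (SUP (H, T) \<in> {(H :: (nat \<Rightarrow> complex) cinner_space, T).
        complex_hilbert_space H \<and> commuting_contractions d H T}.
      op_norm H (poly_op d H T p))"


section \<open>Functions on the polydisc\<close>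

text \<open>Only the first \<open>d\<close> coordinates of a point \<open>z\<close> matter.\<close>

definition polydisc :: "nat \<Rightarrow> (nat \<Rightarrow> complex) set"
  where "polydisc d = ({..<d} \<rightarrow> ball 0 1)"

definition radial_deriv ::
    "nat \<Rightarrow> ((nat \<Rightarrow> complex) \<Rightarrow> complex) \<Rightarrow> (nat \<Rightarrow> complex) \<Rightarrow> complex"
  where "radial_deriv d f z = (\<Sum>j<d. z j * deriv (\<lambda>w. f (z(j := w))) (z j))"

definition dilate ::
    "((nat \<Rightarrow> complex) \<Rightarrow> complex) \<Rightarrow> real \<Rightarrow> (nat \<Rightarrow> complex) \<Rightarrow> complex"
  where "dilate f r z = f (\<lambda>j. of_real r * z j)"

definition polydisc_norm :: "nat \<Rightarrow> ((nat \<Rightarrow> complex) \<Rightarrow> complex) \<Rightarrow> ennreal"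
  where "polydisc_norm d f = (SUP z\<in>polydisc d. ennreal (cmod (f z)))"


section \<open>Independence of the Schur-Agler norm from the underlying type\<close>

lemma linear_opD:
  assumes "linear_op H A"
  shows "x \<in> carrier H \<Longrightarrow> A x \<in> carrier H"
    and "x \<in> carrier H \<Longrightarrow> y \<in> carrier H \<Longrightarrow> A (x \<oplus>\<^bsub>H\<^esub> y) = A x \<oplus>\<^bsub>H\<^esub> A y"
    and "x \<in> carrier H \<Longrightarrow> A (a \<odot>\<^bsub>H\<^esub> x) = a \<odot>\<^bsub>H\<^esub> A x"
  using assms by (auto simp: linear_op_def)

lemma linear_op_comp:
  assumes "linear_op H A" "linear_op H B"
  shows "linear_op H (A \<circ> B)"
  using assms by (simp add: linear_op_def Pi_iff)

context complex_hilbert_space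
begin

lemma sc [simp]:
  "carrier complex_ring = UNIV"
  "x \<oplus>\<^bsub>complex_ring\<^esub> y = x + y"
  "x \<otimes>\<^bsub>complex_ring\<^esub> y = x * y"
  "\<zero>\<^bsub>complex_ring\<^esub> = 0"
  "\<one>\<^bsub>complex_ring\<^esub> = 1"
  by (simp_all add: complex_ring_def)

lemma smult_closed' [simp]: "x \<in> carrier H \<Longrightarrow> a \<odot> x \<in> carrier H"
  using smult_closed by simp

lemma smult_algebra:
  assumes "x \<in> carrier H" "y \<in> carrier H"
  shows "(a + b) \<odot> x = a \<odot> x \<oplus> b \<odot> x" "a \<odot> (x \<oplus> y) = a \<odot> x \<oplus> a \<odot> y"
    "(a * b) \<odot> x = a \<odot> (b \<odot> x)" "1 \<odot> x = x"
  using smult_l_distr[of a b x] smult_r_distr[of a x y] smult_assoc1[of a b x] smult_one[of x] assms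
  by simp_all

lemma smult_zero_left [simp]: "x \<in> carrier H \<Longrightarrow> 0 \<odot> x = \<zero>"
  using smult_l_null by simp

lemma linear_op_zero: "linear_op H A \<Longrightarrow> A \<zero> = \<zero>"
proof -
  assume A: "linear_op H A"
  have 1: "A \<zero> \<in> carrier H"
    by (rule funcset_mem[where A = "carrier H"]) (use A in \<open>simp_all only: linear_op_def M.zero_closed\<close>)
  have 2: "\<forall>a. \<forall>x\<in>carrier H. A (a \<odot> x) = a \<odot> A x"
    using A unfolding linear_op_def by (elim conjE)
  have "A (0 \<odot> \<zero>) = 0 \<odot> A \<zero>"
    by (rule 2[rule_format, OF M.zero_closed])
  then show ?thesis using 1 by (simp only: smult_zero_left M.zero_closed)
qed

lemma cinner_zero_left [simp]: "y \<in> carrier H \<Longrightarrow> cinner H \<zero> y = 0"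
  using cinner_add_left[of \<zero> \<zero> y] by simp

lemma cinner_uminus_left:
  "x \<in> carrier H \<Longrightarrow> y \<in> carrier H \<Longrightarrow> cinner H (\<ominus> x) y = - cinner H x y"
  using cinner_add_left[of x "\<ominus> x" y] by (simp add: M.r_neg add_eq_0_iff)

lemma cinner_diff_left:
  "x \<in> carrier H \<Longrightarrow> z \<in> carrier H \<Longrightarrow> y \<in> carrier H \<Longrightarrow>
    cinner H (x \<ominus> z) y = cinner H x y - cinner H z y"
  by (simp add: a_minus_def cinner_add_left cinner_uminus_left)

lemma cinner_diff_right:
  "x \<in> carrier H \<Longrightarrow> z \<in> carrier H \<Longrightarrow> y \<in> carrier H \<Longrightarrow>
    cinner H y (x \<ominus> z) = cinner H y x - cinner H y z"
  using cinner_commute[of "x \<ominus> z" y] cinner_commute[of x y] cinner_commute[of z y]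
  by (simp add: cinner_diff_left)

lemma cinner_smult_right:
  "x \<in> carrier H \<Longrightarrow> y \<in> carrier H \<Longrightarrow> cinner H y (a \<odot> x) = cnj a * cinner H y x"
  using cinner_commute[of "a \<odot> x" y] cinner_commute[of x y]
  by (simp add: cinner_smult_left)

lemma cinner_nonneg: "x \<in> carrier H \<Longrightarrow> 0 \<le> Re (cinner H x x)"
  using cinner_pos[of x] by (cases "x = \<zero>") auto

lemma cinner_self: "x \<in> carrier H \<Longrightarrow> cinner H x x = of_real ((hnorm H x)\<^sup>2)"
  using cinner_commute[of x x] cinner_nonneg[of x]
  by (auto simp: hnorm_def complex_eq_iff)

lemma hnorm_nonneg [simp]: "x \<in> carrier H \<Longrightarrow> 0 \<le> hnorm H x"
  by (simp add: hnorm_def cinner_nonneg)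

lemma hnorm_pos: "x \<in> carrier H \<Longrightarrow> x \<noteq> \<zero> \<Longrightarrow> 0 < hnorm H x"
  by (simp add: hnorm_def cinner_pos)

lemma hnorm_zero [simp]: "hnorm H \<zero> = 0"
  by (simp add: hnorm_def)

lemma hnorm_smult: "x \<in> carrier H \<Longrightarrow> hnorm H (a \<odot> x) = cmod a * hnorm H x"
proof -
  assume x: "x \<in> carrier H"
  have "cinner H (a \<odot> x) (a \<odot> x) = (a * cnj a) * cinner H x x"
    using x by (simp add: cinner_smult_left cinner_smult_right)
  also have "\<dots> = of_real ((cmod a * hnorm H x)\<^sup>2)"
    unfolding complex_norm_square[symmetric] cinner_self[OF x]
    by (simp add: power_mult_distrib)
  finally have "hnorm H (a \<odot> x) = sqrt ((cmod a * hnorm H x)\<^sup>2)"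
    unfolding hnorm_def[of H "a \<odot> x"] by (simp only: Re_complex_of_real)
  also have "\<dots> = cmod a * hnorm H x"
    using x by (simp add: abs_mult)
  finally show ?thesis .
qed

lemma cauchy_schwarz:
  assumes x: "x \<in> carrier H" and y: "y \<in> carrier H"
  shows "cmod (cinner H x y) \<le> hnorm H x * hnorm H y"
proof (cases "y = \<zero>")
  case True
  then show ?thesis using x cinner_commute[of \<zero> x] by simp
next
  case False
  define b where "b = (hnorm H y)\<^sup>2"
  have b: "b > 0" using hnorm_pos[OF y False] by (simp add: b_def)
  define c where "c = cinner H x y"
  define u where "u = of_real b \<odot> x \<ominus> c \<odot> y"
  have u: "u \<in> carrier H" using x y by (simp add: u_def)
  have yx: "cinner H y x = cnj c"
    using cinner_commute[OF x y] by (simp only: c_def)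
  have xu: "cinner H x u = of_real b * of_real ((hnorm H x)\<^sup>2) - cnj c * c"
    using x y by (simp only: u_def cinner_diff_right smult_closed' cinner_smult_right
        cinner_self c_def complex_cnj_complex_of_real)
  have yu: "cinner H y u = 0"
    using x y by (simp only: u_def cinner_diff_right smult_closed' cinner_smult_right
        cinner_self yx complex_cnj_complex_of_real b_def[symmetric]) (simp add: mult.commute)
  have "cinner H u u = of_real b * cinner H x u - c * cinner H y u"
  proof -
    have "cinner H (of_real b \<odot> x \<ominus> c \<odot> y) u = of_real b * cinner H x u - c * cinner H y u"
      using x y u by (simp only: cinner_diff_left smult_closed' cinner_smult_left)
    then show ?thesis by (simp only: u_def)
  qed
  also have "\<dots> = of_real (b * (b * (hnorm H x)\<^sup>2 - (cmod c)\<^sup>2))"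
    using complex_norm_square[of c] by (simp add: xu yu mult.commute)
  finally have "0 \<le> b * (b * (hnorm H x)\<^sup>2 - (cmod c)\<^sup>2)"
    using cinner_nonneg[OF u] by (simp only: Re_complex_of_real)
  then have "(cmod c)\<^sup>2 \<le> (hnorm H x * hnorm H y)\<^sup>2"
    using b by (simp add: zero_le_mult_iff power_mult_distrib mult.commute flip: b_def)
  then show ?thesis
    unfolding c_def by (rule power2_le_imp_le) (use x y in simp)
qed

lemma cinner_tendsto:
  assumes \<xi>: "\<And>n. \<xi> n \<in> carrier H" and z: "z \<in> carrier H" and y: "y \<in> carrier H"
    and lim: "(\<lambda>n. hnorm H (\<xi> n \<ominus> z)) \<longlonglongrightarrow> 0"
  shows "(\<lambda>n. cinner H (\<xi> n) y) \<longlonglongrightarrow> cinner H z y"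
proof -
  have "(\<lambda>n. cinner H (\<xi> n) y - cinner H z y) \<longlonglongrightarrow> 0"
  proof (rule Lim_null_comparison)
    show "(\<lambda>n. hnorm H (\<xi> n \<ominus> z) * hnorm H y) \<longlonglongrightarrow> 0"
      by (rule tendsto_mult_left_zero[OF lim])
    show "\<forall>\<^sub>F n in sequentially.
        cmod (cinner H (\<xi> n) y - cinner H z y) \<le> hnorm H (\<xi> n \<ominus> z) * hnorm H y"
      unfolding cinner_diff_left[OF \<xi> z y, symmetric]
      by (intro always_eventually allI cauchy_schwarz) (use \<xi> z y in auto)
  qed
  then show ?thesis by (rule LIM_zero_cancel)
qed

lemma linear_op_diff:
  assumes "linear_op H A" "x \<in> carrier H" "y \<in> carrier H"
  shows "A (x \<ominus> y) = A x \<ominus> A y"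
proof -
  have A: "A x \<in> carrier H" "A y \<in> carrier H" "A (x \<ominus> y) \<in> carrier H"
    using assms by (auto simp: linear_op_def)
  have "A (x \<ominus> y) \<oplus> A y = A ((x \<ominus> y) \<oplus> y)"
    using assms by (simp add: linear_op_def)
  also have "(x \<ominus> y) \<oplus> y = x"
    using assms by (simp add: a_minus_def M.a_assoc M.l_neg)
  finally have "A x = A (x \<ominus> y) \<oplus> A y" ..
  then show ?thesis
    using A by (simp add: a_minus_def M.a_assoc M.r_neg)
qed

lemma contraction_le:
  assumes A: "linear_op H A" "op_norm H A \<le> 1" and x: "x \<in> carrier H"
  shows "hnorm H (A x) \<le> hnorm H x"
proof (cases "x = \<zero>")
  case True
  then show ?thesis using A by (simp add: linear_op_zero)
next
  case False
  define n where "n = hnorm H x"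
  have n: "n > 0" using hnorm_pos[OF x False] by (simp add: n_def)
  define u where "u = complex_of_real (1 / n) \<odot> x"
  have u: "u \<in> carrier H" "hnorm H u = 1"
    using x n by (simp_all add: u_def hnorm_smult del: of_real_divide) (simp add: n_def)
  have "ennreal (hnorm H (A u)) \<le> op_norm H A"
    unfolding op_norm_def by (intro SUP_upper) (use u in auto)
  also have "\<dots> \<le> 1" by fact
  finally have "hnorm H (A u) \<le> 1" by simp
  moreover have "A u = complex_of_real (1 / n) \<odot> A x" "A x \<in> carrier H"
    using A x by (auto simp: linear_op_def u_def)
  ultimately have "1 / n * hnorm H (A x) \<le> 1"
    using n by (simp add: hnorm_smult del: of_real_divide)
  then show ?thesis using n by (simp add: n_def field_simps)
qed

text \<open>A closed subspace \<open>K\<close>, copied along an injection into another type.\<close>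

definition copy :: "'h set \<Rightarrow> ('h \<Rightarrow> 'k) \<Rightarrow> 'k cinner_space" where
  "copy K \<phi> = (let \<psi> = inv_into K \<phi> in
     \<lparr>carrier = \<phi> ` K, mult = (\<lambda>_ _. \<phi> \<zero>), one = \<phi> \<zero>,
      zero = \<phi> \<zero>, add = (\<lambda>u v. \<phi> (\<psi> u \<oplus> \<psi> v)),
      smult = (\<lambda>a u. \<phi> (a \<odot> \<psi> u)),
      cinner = (\<lambda>u v. cinner H (\<psi> u) (\<psi> v))\<rparr>)"

definition closed_subspace :: "'h set \<Rightarrow> bool" where
  "closed_subspace K \<longleftrightarrow> K \<subseteq> carrier H \<and> \<zero> \<in> K \<and>
     (\<forall>x\<in>K. \<forall>y\<in>K. x \<oplus> y \<in> K) \<and> (\<forall>a. \<forall>x\<in>K. a \<odot> x \<in> K) \<and>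
     (\<forall>\<xi> x. (\<forall>n::nat. \<xi> n \<in> K) \<and> x \<in> carrier H \<and> (\<lambda>n. hnorm H (\<xi> n \<ominus> x)) \<longlonglongrightarrow> 0 \<longrightarrow> x \<in> K)"

lemma closed_subspaceI:
  assumes "K \<subseteq> carrier H" "\<zero> \<in> K" "\<And>x y. x \<in> K \<Longrightarrow> y \<in> K \<Longrightarrow> x \<oplus> y \<in> K"
    and "\<And>a x. x \<in> K \<Longrightarrow> a \<odot> x \<in> K"
    and "\<And>\<xi> x. \<lbrakk>\<And>n::nat. \<xi> n \<in> K; x \<in> carrier H; (\<lambda>n. hnorm H (\<xi> n \<ominus> x)) \<longlonglongrightarrow> 0\<rbrakk> \<Longrightarrow> x \<in> K"
  shows "closed_subspace K"
  unfolding closed_subspace_def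
proof (intro conjI ballI allI impI)
  fix \<xi> :: "nat \<Rightarrow> 'h" and x
  assume "(\<forall>n. \<xi> n \<in> K) \<and> x \<in> carrier H \<and> (\<lambda>n. hnorm H (\<xi> n \<ominus> x)) \<longlonglongrightarrow> 0"
  then show "x \<in> K" by (elim conjE) (rule assms(5), auto)
qed (fact assms | assumption | rule assms)+

lemma closed_subspaceD:
  assumes "closed_subspace K"
  shows "x \<in> K \<Longrightarrow> x \<in> carrier H" "\<zero> \<in> K" "x \<in> K \<Longrightarrow> y \<in> K \<Longrightarrow> x \<oplus> y \<in> K"
    and "x \<in> K \<Longrightarrow> a \<odot> x \<in> K"
    and "\<lbrakk>\<And>n::nat. \<xi> n \<in> K; z \<in> carrier H; (\<lambda>n. hnorm H (\<xi> n \<ominus> z)) \<longlonglongrightarrow> 0\<rbrakk> \<Longrightarrow> z \<in> K"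
  using assms unfolding closed_subspace_def by blast+

lemma uminus_eq_smult: "x \<in> carrier H \<Longrightarrow> \<ominus> x = (-1) \<odot> x"
proof -
  assume x: "x \<in> carrier H"
  have "x \<oplus> (-1) \<odot> x = (1 + (-1)) \<odot> x"
    using smult_l_distr[of 1 "-1" x] smult_one[of x] x by simp
  also have "\<dots> = \<zero>" using smult_l_null[OF x] by simp
  finally show ?thesis using x by (metis M.minus_equality M.a_comm smult_closed')
qed

lemma copy_hilbert:
  assumes K: "closed_subspace K" and inj: "inj_on \<phi> K"
  shows "complex_hilbert_space (copy K \<phi>)"
    and "\<And>x. x \<in> K \<Longrightarrow> hnorm (copy K \<phi>) (\<phi> x) = hnorm H x"
proof -
  let ?C = "copy K \<phi>"
  have sub: "\<And>x. x \<in> K \<Longrightarrow> x \<in> carrier H"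
    and K0: "\<zero> \<in> K" and Kadd: "\<And>x y. x \<in> K \<Longrightarrow> y \<in> K \<Longrightarrow> x \<oplus> y \<in> K"
    and Ksm: "\<And>a x. x \<in> K \<Longrightarrow> a \<odot> x \<in> K"
    and Kcl: "\<And>\<xi> x. (\<And>n::nat. \<xi> n \<in> K) \<Longrightarrow> x \<in> carrier H \<Longrightarrow>
      (\<lambda>n. hnorm H (\<xi> n \<ominus> x)) \<longlonglongrightarrow> 0 \<Longrightarrow> x \<in> K"
    using K unfolding closed_subspace_def by blast+
  have Kun: "\<And>x. x \<in> K \<Longrightarrow> \<ominus> x \<in> K" using Ksm uminus_eq_smult sub by simp
  have Kdi: "\<And>x y. x \<in> K \<Longrightarrow> y \<in> K \<Longrightarrow> x \<ominus> y \<in> K"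
    by (simp add: a_minus_def Kadd Kun)
  have iv [simp]: "\<And>x. x \<in> K \<Longrightarrow> inv_into K \<phi> (\<phi> x) = x" using inj by simp
  have C [simp]: "carrier ?C = \<phi> ` K" "\<zero>\<^bsub>?C\<^esub> = \<phi> \<zero>"
    by (simp_all add: copy_def Let_def)
  have Cadd [simp]: "\<phi> x \<oplus>\<^bsub>?C\<^esub> \<phi> y = \<phi> (x \<oplus> y)" if "x \<in> K" "y \<in> K" for x y
    using that by (simp add: copy_def Let_def)
  have Csm [simp]: "a \<odot>\<^bsub>?C\<^esub> \<phi> x = \<phi> (a \<odot> x)" if "x \<in> K" for a x
    using that by (simp add: copy_def Let_def)
  have Cin [simp]: "cinner ?C (\<phi> x) (\<phi> y) = cinner H x y" if "x \<in> K" "y \<in> K" for x y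
    using that by (simp add: copy_def Let_def)
  show Chn: "\<And>x. x \<in> K \<Longrightarrow> hnorm (copy K \<phi>) (\<phi> x) = hnorm H x"
    by (simp add: hnorm_def)
  have G: "abelian_group ?C"
  proof (rule abelian_groupI)
    fix u v assume "u \<in> carrier ?C" "v \<in> carrier ?C"
    then obtain x y where "x \<in> K" "u = \<phi> x" "y \<in> K" "v = \<phi> y" by auto
    then show "u \<oplus>\<^bsub>?C\<^esub> v = v \<oplus>\<^bsub>?C\<^esub> u"
      by (simp add: M.a_comm sub)
  next
    fix u assume "u \<in> carrier ?C"
    then obtain x where x: "x \<in> K" "u = \<phi> x" by auto
    have "\<phi> (\<ominus> x) \<oplus>\<^bsub>?C\<^esub> u = \<zero>\<^bsub>?C\<^esub>" using x Kun sub by (simp add: M.l_neg)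
    then show "\<exists>y\<in>carrier ?C. y \<oplus>\<^bsub>?C\<^esub> u = \<zero>\<^bsub>?C\<^esub>" using Kun x by auto
  qed (auto simp: K0 Kadd sub M.a_assoc)
  interpret C: abelian_group ?C by (rule G)
  have Cun [simp]: "\<ominus>\<^bsub>?C\<^esub> \<phi> x = \<phi> (\<ominus> x)" if "x \<in> K" for x
    by (rule C.minus_equality) (use that Kun sub in \<open>auto simp: M.l_neg\<close>)
  have Cdi [simp]: "\<phi> x \<ominus>\<^bsub>?C\<^esub> \<phi> y = \<phi> (x \<ominus> y)" if "x \<in> K" "y \<in> K" for x y
    unfolding a_minus_def Cun[OF that(2)] by (rule Cadd) (use that Kun in blast)+
  have M: "module complex_ring ?C"
  proof (rule moduleI[OF R.is_cring G])
    fix a b :: complex and u v assume "u \<in> carrier ?C" "v \<in> carrier ?C"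
    then obtain x y where [simp]: "x \<in> K" "u = \<phi> x" "y \<in> K" "v = \<phi> y" by auto
    note alg = smult_algebra[OF sub sub, of x y]
    show "a \<odot>\<^bsub>?C\<^esub> (u \<oplus>\<^bsub>?C\<^esub> v) = a \<odot>\<^bsub>?C\<^esub> u \<oplus>\<^bsub>?C\<^esub> a \<odot>\<^bsub>?C\<^esub> v"
      by (simp add: alg Kadd Ksm)
  next
    fix a b :: complex and u assume "u \<in> carrier ?C"
    then obtain x where [simp]: "x \<in> K" "u = \<phi> x" by auto
    note alg = smult_algebra[OF sub sub, of x x]
    show "(a \<oplus>\<^bsub>complex_ring\<^esub> b) \<odot>\<^bsub>?C\<^esub> u = a \<odot>\<^bsub>?C\<^esub> u \<oplus>\<^bsub>?C\<^esub> b \<odot>\<^bsub>?C\<^esub> u"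
      and "(a \<otimes>\<^bsub>complex_ring\<^esub> b) \<odot>\<^bsub>?C\<^esub> u = a \<odot>\<^bsub>?C\<^esub> (b \<odot>\<^bsub>?C\<^esub> u)"
      and "\<one>\<^bsub>complex_ring\<^esub> \<odot>\<^bsub>?C\<^esub> u = u"
      by (simp_all add: alg Kadd Ksm)
  qed (auto simp: Ksm)
  show "complex_hilbert_space ?C"
  proof (intro complex_hilbert_space.intro[OF M] complex_hilbert_space_axioms.intro)
    fix u v w assume "u \<in> carrier ?C" "v \<in> carrier ?C" "w \<in> carrier ?C"
    then show "cinner ?C (u \<oplus>\<^bsub>?C\<^esub> v) w = cinner ?C u w + cinner ?C v w"
      by (auto simp: Kadd sub cinner_add_left)
  next
    fix u v a assume "u \<in> carrier ?C" "v \<in> carrier ?C"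
    then show "cinner ?C (a \<odot>\<^bsub>?C\<^esub> u) v = a * cinner ?C u v"
      by (auto simp: Ksm sub cinner_smult_left)
  next
    fix u v assume "u \<in> carrier ?C" "v \<in> carrier ?C"
    then obtain x y where xy: "x \<in> K" "u = \<phi> x" "y \<in> K" "v = \<phi> y" by auto
    show "cinner ?C v u = cnj (cinner ?C u v)"
      unfolding xy Cin[OF xy(1,3)] Cin[OF xy(3,1)]
      by (rule cinner_commute[OF sub[OF xy(1)] sub[OF xy(3)]])
  next
    fix u assume "u \<in> carrier ?C" "u \<noteq> \<zero>\<^bsub>?C\<^esub>"
    then show "0 < Re (cinner ?C u u)"
      by (auto intro!: cinner_pos sub)
  next
    fix \<xi> :: "nat \<Rightarrow> _"
    assume \<xi>: "\<And>n. \<xi> n \<in> carrier ?C"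
      and cau: "\<And>e::real. e > 0 \<Longrightarrow> \<exists>N. \<forall>m\<ge>N. \<forall>n\<ge>N. hnorm ?C (\<xi> m \<ominus>\<^bsub>?C\<^esub> \<xi> n) < e"
    have "\<forall>n. \<exists>y\<in>K. \<xi> n = \<phi> y" using \<xi> by auto
    then obtain Y where Y: "\<And>n. Y n \<in> K" "\<And>n. \<xi> n = \<phi> (Y n)" by metis
    have "\<exists>x\<in>carrier H. (\<lambda>n. hnorm H (Y n \<ominus> x)) \<longlonglongrightarrow> 0"
    proof (rule complete)
      show "Y n \<in> carrier H" for n using Y sub by auto
      show "\<exists>N. \<forall>m\<ge>N. \<forall>n\<ge>N. hnorm H (Y m \<ominus> Y n) < e" if "e > 0" for e :: real
        using cau[OF that] by (simp add: Y Kdi Chn)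
    qed
    then obtain x where x: "x \<in> carrier H" "(\<lambda>n. hnorm H (Y n \<ominus> x)) \<longlonglongrightarrow> 0" by blast
    have "x \<in> K" using Kcl[of Y, OF Y(1) x] .
    moreover have "(\<lambda>n. hnorm ?C (\<xi> n \<ominus>\<^bsub>?C\<^esub> \<phi> x)) \<longlonglongrightarrow> 0"
      using x \<open>x \<in> K\<close> by (simp add: Y Kdi Chn)
    ultimately show "\<exists>x\<in>carrier ?C. (\<lambda>n. hnorm ?C (\<xi> n \<ominus>\<^bsub>?C\<^esub> x)) \<longlonglongrightarrow> 0" by auto
  qed
qed

end

lemma monom_op_in:
  assumes T: "\<And>i y. i < d \<Longrightarrow> y \<in> K \<Longrightarrow> T i y \<in> K" and x: "x \<in> K"
  shows "monom_op d T m x \<in> K"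
proof -
  have pw: "(T i ^^ n) y \<in> K" if "i < d" "y \<in> K" for i n y
    using that by (induction n) (auto intro: T)
  have "foldr (\<lambda>i A. (T i ^^ Poly_Mapping.lookup m i) \<circ> A) l id x \<in> K" if "set l \<subseteq> {..<d}" for l
    using that by (induction l) (auto intro: pw x)
  from this[of "[0..<d]"] show ?thesis by (simp add: monom_op_def atLeast0LessThan)
qed

lemma monom_op_transfer:
  assumes T: "\<And>i y. i < d \<Longrightarrow> y \<in> K \<Longrightarrow> T i y \<in> K" and x: "x \<in> K"
    and S: "\<And>i y. i < d \<Longrightarrow> y \<in> K \<Longrightarrow> S i (\<phi> y) = \<phi> (T i y)"
  shows "monom_op d S m (\<phi> x) = \<phi> (monom_op d T m x)"
proof -
  have pw: "(T i ^^ n) y \<in> K \<and> (S i ^^ n) (\<phi> y) = \<phi> ((T i ^^ n) y)" if "i < d" "y \<in> K" for i n y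
    using that by (induction n) (auto intro: T S)
  have "foldr (\<lambda>i A. (T i ^^ Poly_Mapping.lookup m i) \<circ> A) l id x \<in> K \<and>
      foldr (\<lambda>i A. (S i ^^ Poly_Mapping.lookup m i) \<circ> A) l id (\<phi> x) =
      \<phi> (foldr (\<lambda>i A. (T i ^^ Poly_Mapping.lookup m i) \<circ> A) l id x)" if "set l \<subseteq> {..<d}" for l
    using that by (induction l) (auto simp: pw x)
  from this[of "[0..<d]"] show ?thesis by (simp add: monom_op_def atLeast0LessThan)
qed

lemma op_norm_le_schur_agler_norm:
  fixes H :: "('h, 'z) cinner_space_scheme"
  assumes "complex_hilbert_space H" and cc: "commuting_contractions d H T"
  shows "op_norm H (poly_op d H T p) \<le> schur_agler_norm d p"
  unfolding op_norm_def
proof (rule SUP_least)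
  fix x assume "x \<in> {x \<in> carrier H. hnorm H x \<le> 1}"
  then have x: "x \<in> carrier H" "hnorm H x \<le> 1" by auto
  interpret complex_hilbert_space H by fact
  have lin: "\<And>i. i < d \<Longrightarrow> linear_op H (T i)"
    and con: "\<And>i y. i < d \<Longrightarrow> y \<in> carrier H \<Longrightarrow> hnorm H (T i y) \<le> hnorm H y"
    and comm: "\<And>i j y. i < d \<Longrightarrow> j < d \<Longrightarrow> y \<in> carrier H \<Longrightarrow> T i (T j y) = T j (T i y)"
    using cc contraction_le by (auto simp: commuting_contractions_def)
  have clo: "\<And>i y. i < d \<Longrightarrow> y \<in> carrier H \<Longrightarrow> T i y \<in> carrier H"
    and addT: "\<And>i y z. i < d \<Longrightarrow> y \<in> carrier H \<Longrightarrow> z \<in> carrier H \<Longrightarrow> T i (y \<oplus>\<^bsub>H\<^esub> z) = T i y \<oplus>\<^bsub>H\<^esub> T i z"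
    and smT: "\<And>i y a. i < d \<Longrightarrow> y \<in> carrier H \<Longrightarrow> T i (a \<odot>\<^bsub>H\<^esub> y) = a \<odot>\<^bsub>H\<^esub> T i y"
    by (auto intro: linear_opD[OF lin])
  have zeroT: "T i \<zero>\<^bsub>H\<^esub> = \<zero>\<^bsub>H\<^esub>" if "i < d" for i
    by (rule linear_op_zero[OF lin[OF that]])

  define W where "W = {w :: nat list. set w \<subseteq> {..<d}}"
  have Wlin: "linear_op H (foldr T w) \<and> (\<forall>y\<in>carrier H. hnorm H (foldr T w y) \<le> hnorm H y)"
    if "w \<in> W" for w
    using that
  proof (induction w)
    case (Cons i w)
    then have i: "i < d" and w: "w \<in> W" by (auto simp: W_def)
    have IH: "linear_op H (foldr T w)" "\<And>y. y \<in> carrier H \<Longrightarrow> hnorm H (foldr T w y) \<le> hnorm H y"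
      using Cons.IH[OF w] by auto
    have "linear_op H (foldr T (i # w))"
      unfolding foldr.simps by (rule linear_op_comp[OF lin[OF i] IH(1)])
    moreover have "hnorm H (foldr T (i # w) y) \<le> hnorm H y" if y: "y \<in> carrier H" for y
      unfolding foldr.simps o_apply
      by (rule order.trans[OF con[OF i linear_opD(1)[OF IH(1) y]] IH(2)[OF y]])
    ultimately show ?case by blast
  qed (auto simp: linear_op_def)
  have Wc: "\<And>w y. w \<in> W \<Longrightarrow> y \<in> carrier H \<Longrightarrow> foldr T w y \<in> carrier H"
    by (rule linear_opD(1)[OF Wlin[THEN conjunct1]])
  note WlinD = linear_opD[OF Wlin[THEN conjunct1]]

  define good where "good K \<longleftrightarrow> closed_subspace K \<and> x \<in> K \<and> (\<forall>i<d. \<forall>y\<in>K. T i y \<in> K)" for K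
  define K where "K = \<Inter> {K. good K}"
  have goodH: "good (carrier H)"
    unfolding good_def by (intro conjI allI impI ballI closed_subspaceI) (simp_all add: x clo)
  have KI: "u \<in> K" if "\<And>L. good L \<Longrightarrow> u \<in> L" for u
    using that by (auto simp: K_def)
  have KD: "u \<in> L" if "u \<in> K" "good L" for u L
    using that by (auto simp: K_def)
  have gD: "closed_subspace L" "x \<in> L" "\<And>i y. i < d \<Longrightarrow> y \<in> L \<Longrightarrow> T i y \<in> L" if "good L" for L
    using that by (auto simp: good_def)
  have KH: "\<And>y. y \<in> K \<Longrightarrow> y \<in> carrier H"
    by (rule KD[OF _ goodH])
  have KT: "\<And>i y. i < d \<Longrightarrow> y \<in> K \<Longrightarrow> T i y \<in> K"
    by (rule KI) (rule gD(3), auto intro: KD)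
  have xK: "x \<in> K"
    by (rule KI) (rule gD(2))
  have Kcs: "closed_subspace K"
  proof (rule closed_subspaceI)
    show "K \<subseteq> carrier H" using KH by blast
    show "\<zero>\<^bsub>H\<^esub> \<in> K" by (rule KI, rule closed_subspaceD(2)[OF gD(1)])
    show "y \<oplus>\<^bsub>H\<^esub> z \<in> K" if "y \<in> K" "z \<in> K" for y z
      by (rule KI, rule closed_subspaceD(3)[OF gD(1)]) (use that in \<open>auto intro: KD\<close>)
    show "a \<odot>\<^bsub>H\<^esub> y \<in> K" if "y \<in> K" for a y
      by (rule KI, rule closed_subspaceD(4)[OF gD(1)]) (use that in \<open>auto intro: KD\<close>)
    show "z \<in> K" if "\<And>n::nat. \<xi> n \<in> K" "z \<in> carrier H" "(\<lambda>n. hnorm H (\<xi> n \<ominus>\<^bsub>H\<^esub> z)) \<longlonglongrightarrow> 0"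
      for \<xi> z
    proof (rule KI)
      fix L assume L: "good L"
      show "z \<in> L"
        by (rule closed_subspaceD(5)[OF gD(1)[OF L] _ that(2,3)]) (rule KD[OF that(1) L])
    qed
  qed
  note Ka = closed_subspaceD(3)[OF Kcs] and Ks = closed_subspaceD(4)[OF Kcs]
    and K0 = closed_subspaceD(2)[OF Kcs]

  define \<phi> :: "'h \<Rightarrow> nat \<Rightarrow> complex" where
    "\<phi> y n = (if from_nat n \<in> W then cinner H y (foldr T (from_nat n) x) else 0)" for y n
  have zero: "y = \<zero>\<^bsub>H\<^esub>" if y: "y \<in> K" and orth: "\<And>w. w \<in> W \<Longrightarrow> cinner H y (foldr T w x) = 0" for y
  proof -
    define F where "F = {z \<in> carrier H. \<forall>w\<in>W. cinner H (foldr T w z) y = 0}"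
    have yH: "y \<in> carrier H" using y KH by auto
    have "closed_subspace F"
    proof (rule closed_subspaceI)
      show "F \<subseteq> carrier H" by (auto simp: F_def)
      show "\<zero>\<^bsub>H\<^esub> \<in> F"
        using yH linear_op_zero[OF Wlin[THEN conjunct1]] by (simp add: F_def)
      show "u \<oplus>\<^bsub>H\<^esub> v \<in> F" if "u \<in> F" "v \<in> F" for u v
        using that yH by (simp add: F_def WlinD cinner_add_left)
      show "a \<odot>\<^bsub>H\<^esub> u \<in> F" if "u \<in> F" for a u
        using that yH by (simp add: F_def WlinD cinner_smult_left)
      fix \<xi> :: "nat \<Rightarrow> 'h" and z
      assume \<xi>: "\<And>n. \<xi> n \<in> F" and z: "z \<in> carrier H"
        and lim: "(\<lambda>n. hnorm H (\<xi> n \<ominus>\<^bsub>H\<^esub> z)) \<longlonglongrightarrow> 0"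
      have \<xi>H: "\<xi> n \<in> carrier H" for n using \<xi>[of n] by (simp add: F_def)
      have "cinner H (foldr T w z) y = 0" if w: "w \<in> W" for w
      proof -
        have diff: "foldr T w (\<xi> n) \<ominus>\<^bsub>H\<^esub> foldr T w z = foldr T w (\<xi> n \<ominus>\<^bsub>H\<^esub> z)" for n
          by (rule linear_op_diff[OF Wlin[OF w, THEN conjunct1] \<xi>H z, symmetric])
        have "(\<lambda>n. hnorm H (foldr T w (\<xi> n) \<ominus>\<^bsub>H\<^esub> foldr T w z)) \<longlonglongrightarrow> 0"
        proof (rule tendsto_sandwich[OF _ _ tendsto_const lim])
          show "\<forall>\<^sub>F n in sequentially. 0 \<le> hnorm H (foldr T w (\<xi> n) \<ominus>\<^bsub>H\<^esub> foldr T w z)"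
            unfolding diff
            by (intro always_eventually allI hnorm_nonneg Wc[OF w] M.minus_closed \<xi>H z)
          show "\<forall>\<^sub>F n in sequentially. hnorm H (foldr T w (\<xi> n) \<ominus>\<^bsub>H\<^esub> foldr T w z)
              \<le> hnorm H (\<xi> n \<ominus>\<^bsub>H\<^esub> z)"
            unfolding diff
            by (intro always_eventually allI Wlin[OF w, THEN conjunct2, rule_format]
                M.minus_closed \<xi>H z)
        qed
        then have "(\<lambda>n. cinner H (foldr T w (\<xi> n)) y) \<longlonglongrightarrow> cinner H (foldr T w z) y"
          by (intro cinner_tendsto Wc[OF w] \<xi>H z yH)
        moreover have "cinner H (foldr T w (\<xi> n)) y = 0" for n
          using \<xi>[of n] w by (simp add: F_def)
        ultimately show ?thesis by (simp add: LIMSEQ_const_iff)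
      qed
      then show "z \<in> F" using z by (simp add: F_def)
    qed
    moreover have "x \<in> F"
    proof -
      have "cinner H (foldr T w x) y = 0" if "w \<in> W" for w
        using orth[OF that] cinner_commute[OF yH Wc[OF that x(1)]] by simp
      then show ?thesis using x by (auto simp: F_def)
    qed
    moreover have "T i z \<in> F" if i: "i < d" and z: "z \<in> F" for i z
    proof -
      have "cinner H (foldr T w (T i z)) y = 0" if w: "w \<in> W" for w
      proof -
        have "w @ [i] \<in> W" using w i by (auto simp: W_def)
        then have "cinner H (foldr T (w @ [i]) z) y = 0" using z by (auto simp: F_def)
        then show ?thesis by simp
      qed
      then show ?thesis using z clo[OF i] by (auto simp: F_def)
    qed
    ultimately have "good F" by (auto simp: good_def)
    then have "y \<in> F" using y by (auto simp: K_def)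
    moreover have "[] \<in> W" by (auto simp: W_def)
    ultimately have "cinner H y y = 0" unfolding F_def by fastforce
    then show ?thesis using cinner_pos[OF yH] by fastforce
  qed
  have inj: "inj_on \<phi> K"
  proof (rule inj_onI)
    fix y z assume yz: "y \<in> K" "z \<in> K" "\<phi> y = \<phi> z"
    have mz: "\<ominus>\<^bsub>H\<^esub> z = (-1) \<odot>\<^bsub>H\<^esub> z" using uminus_eq_smult KH yz by auto
    have "y \<ominus>\<^bsub>H\<^esub> z = \<zero>\<^bsub>H\<^esub>"
    proof (rule zero)
      show "y \<ominus>\<^bsub>H\<^esub> z \<in> K" using yz by (simp add: a_minus_def mz Ka Ks)
      fix w assume w: "w \<in> W"
      have "\<phi> y (to_nat w) = \<phi> z (to_nat w)" using yz by simp
      then show "cinner H (y \<ominus>\<^bsub>H\<^esub> z) (foldr T w x) = 0"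
        unfolding \<phi>_def using w cinner_diff_left[OF KH[OF yz(1)] KH[OF yz(2)] Wc[OF w x(1)]]
        by simp
    qed
    then have "y \<oplus>\<^bsub>H\<^esub> \<ominus>\<^bsub>H\<^esub> z = \<zero>\<^bsub>H\<^esub>" by (simp only: a_minus_def)
    then have "\<ominus>\<^bsub>H\<^esub> (\<ominus>\<^bsub>H\<^esub> z) = y"
      by (rule M.minus_equality) (simp_all add: KH yz)
    then show "y = z" by (simp add: KH yz)
  qed

  let ?C = "copy K \<phi>"
  define S where "S i u = \<phi> (T i (inv_into K \<phi> u))" for i u
  have S: "S i (\<phi> y) = \<phi> (T i y)" if "y \<in> K" for i y
    using inj that by (simp add: S_def)
  have C: "complex_hilbert_space ?C" and Cn: "\<And>y. y \<in> K \<Longrightarrow> hnorm ?C (\<phi> y) = hnorm H y"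
    using copy_hilbert[OF Kcs inj] by auto
  interpret C: complex_hilbert_space ?C by (rule C)
  have Cc: "carrier ?C = \<phi> ` K" "\<zero>\<^bsub>?C\<^esub> = \<phi> \<zero>\<^bsub>H\<^esub>" by (simp_all add: copy_def Let_def)
  have Ca: "\<phi> y \<oplus>\<^bsub>?C\<^esub> \<phi> z = \<phi> (y \<oplus>\<^bsub>H\<^esub> z)" if "y \<in> K" "z \<in> K" for y z
    using that inj by (simp add: copy_def Let_def)
  have Cs: "a \<odot>\<^bsub>?C\<^esub> \<phi> y = \<phi> (a \<odot>\<^bsub>H\<^esub> y)" if "y \<in> K" for a y
    using that inj by (simp add: copy_def Let_def)
  have ccS: "commuting_contractions d ?C S"
    unfolding commuting_contractions_def
  proof (intro conjI allI impI ballI)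
    fix i assume i: "i < d"
    show "linear_op ?C (S i)"
      using i KT KH by (auto simp: linear_op_def Cc Ca Cs S Ka Ks addT smT)
    show "op_norm ?C (S i) \<le> 1"
      unfolding op_norm_def
    proof (rule SUP_least)
      fix u assume "u \<in> {x \<in> carrier ?C. hnorm ?C x \<le> 1}"
      then obtain y where y: "y \<in> K" "u = \<phi> y" "hnorm H y \<le> 1" by (auto simp: Cc Cn)
      then show "ennreal (hnorm ?C (S i u)) \<le> 1"
        using con[OF i, of y] KH KT[OF i] by (simp add: S Cn)
    qed
  next
    fix i j u assume "i < d" "j < d" "u \<in> carrier ?C"
    then show "S i (S j u) = S j (S i u)"
      using comm KT KH by (auto simp: Cc S)
  qed

  have mK: "Poly_Mapping.lookup p m \<odot>\<^bsub>H\<^esub> monom_op d T m x \<in> K" for m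
    by (intro Ks monom_op_in KT xK)
  have fin: "(\<Oplus>\<^bsub>H\<^esub>m\<in>A. Poly_Mapping.lookup p m \<odot>\<^bsub>H\<^esub> monom_op d T m x) \<in> K \<and>
      (\<Oplus>\<^bsub>?C\<^esub>m\<in>A. Poly_Mapping.lookup p m \<odot>\<^bsub>?C\<^esub> monom_op d S m (\<phi> x)) =
      \<phi> (\<Oplus>\<^bsub>H\<^esub>m\<in>A. Poly_Mapping.lookup p m \<odot>\<^bsub>H\<^esub> monom_op d T m x)" if "finite A" for A
    using that
  proof (induction A)
    case empty
    then show ?case by (simp add: K0 Cc)
  next
    case (insert m A)
    have t: "Poly_Mapping.lookup p m \<odot>\<^bsub>?C\<^esub> monom_op d S m (\<phi> x) = \<phi> (Poly_Mapping.lookup p m \<odot>\<^bsub>H\<^esub> monom_op d T m x)" for m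
      using monom_op_transfer[where K = K and T = T and S = S and \<phi> = \<phi> and d = d, OF KT xK S]
      by (simp add: Cs monom_op_in KT xK)
    have 1: "(\<lambda>m. Poly_Mapping.lookup p m \<odot>\<^bsub>H\<^esub> monom_op d T m x) \<in> A \<rightarrow> carrier H"
      "Poly_Mapping.lookup p m \<odot>\<^bsub>H\<^esub> monom_op d T m x \<in> carrier H"
      using mK KH by auto
    have 2: "(\<lambda>m. Poly_Mapping.lookup p m \<odot>\<^bsub>?C\<^esub> monom_op d S m (\<phi> x)) \<in> A \<rightarrow> carrier ?C"
      "Poly_Mapping.lookup p m \<odot>\<^bsub>?C\<^esub> monom_op d S m (\<phi> x) \<in> carrier ?C"
      using mK by (auto simp: t Cc)
    show ?case
      using insert.IH M.finsum_insert[OF insert.hyps 1] C.M.finsum_insert[OF insert.hyps 2] mK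
      by (simp add: t Ca Ka)
  qed
  have "ennreal (hnorm H (poly_op d H T p x)) = ennreal (hnorm ?C (poly_op d ?C S p (\<phi> x)))"
    using fin[OF finite_keys, of p] by (simp add: poly_op_def Cn)
  also have "\<dots> \<le> op_norm ?C (poly_op d ?C S p)"
    unfolding op_norm_def by (intro SUP_upper) (use x xK in \<open>auto simp: Cc Cn\<close>)
  also have "\<dots> \<le> schur_agler_norm d p"
    unfolding schur_agler_norm_def by (rule SUP_upper2[of "(?C, S)"]) (use C ccS in auto)
  finally show "ennreal (hnorm H (poly_op d H T p x)) \<le> schur_agler_norm d p" .
qed

end

theory Submission
  imports Defs "HOL-Library.Function_Algebras" "HOL-Real_Asymp.Real_Asymp"
begin

text \<open>
  For commuting contractions on \<open>H\<close> and \<open>x \<in> H\<close>, the form \<open>(p, q) \<mapsto> \<langle>p(T) x, q(T) x\<rangle>\<close> is a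
  semi-inner product on the polynomial ring for which multiplication by each indeterminate is a
  contraction, and \<open>p(T)\<close> becomes multiplication by \<open>p\<close>.

  Suppose a polynomial satisfies the bound \<open>Q\<close> whenever one variable \<open>z\<^sub>i\<close> is replaced by a unimodular
  scalar. Expanding in \<open>z\<^sub>i\<close>, the operator \<open>\<Sum>\<^sub>k k v\<^sup>k g\<^sub>k z\<^sub>i\<^sup>k\<close> is a Hankel-type sum
  \<open>v z\<^sub>i \<Sum>\<^sub>j\<^sub>,\<^sub>l (v z\<^sub>i)\<^sup>j g\<^sub>j\<^sub>+\<^sub>l\<^sub>+\<^sub>1 (v z\<^sub>i)\<^sup>l\<close>, and Parseval bounds it by \<open>Q v / (1 - v\<^sup>2)\<close>. Summed over \<open>i\<close>,
  this controls the radial derivative \<open>R\<close> at the dilated tuple by bounds in one variable less.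
  Integrating the radial derivative from \<open>0\<close> to \<open>s\<close> costs one factor \<open>log (1 / (1 - s))\<close> per variable;
  starting from Ando's inequality in two variables, \<open>q(s T)\<close> in \<open>m + 2\<close> variables is bounded by
  \<open>\<parallel>q\<parallel>\<^sub>\<infinity> (1 + log (1 / (1 - s)))\<^sup>m\<close> up to a constant. The last variable costs no logarithm, because
  \<open>p - p(0) = d\<^sup>2 \<integral>\<^sub>0\<^sup>1 log (1 / r) (R (R p)\<^sub>r)(r\<^sup>d\<^sup>-\<^sup>1 T) / r dr\<close>, where \<open>log (1 / r)\<close> cancels the
  singularity \<open>1 / (1 - v\<^sup>2)\<close> for \<open>v = r\<^sup>d\<^sup>-\<^sup>1\<close>.
\<close>

section \<open>Semi-inner products\<close>

locale semi_inner = vector_space scale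
  for scale :: "complex \<Rightarrow> 'v::ab_group_add \<Rightarrow> 'v" (infixr "*c" 75) +
  fixes ip :: "'v \<Rightarrow> 'v \<Rightarrow> complex"
  assumes ip_add_left: "ip (x + y) z = ip x z + ip y z"
    and ip_scale_left: "ip (c *c x) y = c * ip x y"
    and ip_commute: "ip y x = cnj (ip x y)"
    and ip_ge_0: "0 \<le> Re (ip x x)"
begin

lemma ip_add_right: "ip x (y + z) = ip x y + ip x z"
  by (metis complex_cnj_add ip_add_left ip_commute)

lemma ip_scale_right: "ip x (c *c y) = cnj c * ip x y"
  by (metis complex_cnj_mult ip_scale_left ip_commute)

lemma ip_zero_left [simp]: "ip 0 x = 0"
  using ip_add_left[of 0 0 x] by simp

lemma ip_zero_right [simp]: "ip x 0 = 0"
  using ip_add_right[of x 0 0] by simp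

lemma ip_minus_left: "ip (- x) y = - ip x y"
  using ip_add_left[of x "- x" y] by (simp add: add_eq_0_iff)

lemma ip_minus_right: "ip x (- y) = - ip x y"
  using ip_add_right[of x y "- y"] by (simp add: add_eq_0_iff)

lemma ip_diff_left: "ip (x - y) z = ip x z - ip y z"
  using ip_add_left[of x "- y" z] by (simp add: ip_minus_left)

lemma ip_diff_right: "ip x (y - z) = ip x y - ip x z"
  using ip_add_right[of x y "- z"] by (simp add: ip_minus_right)

lemma ip_sum_left: "ip (\<Sum>i\<in>A. f i) y = (\<Sum>i\<in>A. ip (f i) y)"
  by (induction A rule: infinite_finite_induct) (simp_all add: ip_add_left)

lemma ip_sum_right: "ip x (\<Sum>i\<in>A. f i) = (\<Sum>i\<in>A. ip x (f i))"
  by (induction A rule: infinite_finite_induct) (simp_all add: ip_add_right)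

definition nrm :: "'v \<Rightarrow> real" where "nrm x = sqrt (Re (ip x x))"

lemma nrm_ge_0 [simp]: "0 \<le> nrm x"
  by (simp add: nrm_def ip_ge_0)

lemma ip_self: "ip x x = of_real ((nrm x)\<^sup>2)"
  using ip_commute[of x x] ip_ge_0[of x] by (simp add: nrm_def complex_eq_iff)

lemma nrm_scale: "nrm (c *c x) = cmod c * nrm x"
proof -
  have "ip (c *c x) (c *c x) = (c * cnj c) * ip x x"
    by (simp add: ip_scale_left ip_scale_right)
  also have "\<dots> = of_real ((cmod c * nrm x)\<^sup>2)"
    unfolding complex_norm_square[symmetric] ip_self by (simp add: power_mult_distrib)
  finally show ?thesis
    unfolding nrm_def[of "c *c x"] by (simp add: abs_mult)
qed

text \<open>Nonnegativity of the form at \<open>x - t * c * y\<close> for real \<open>t\<close>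
  gives a quadratic in \<open>t\<close>. If \<open>y\<close> is a null vector the quadratic becomes
  linear, and being bounded below it must be constant.\<close>

lemma cauchy_schwarz: "cmod (ip x y) \<le> nrm x * nrm y"
proof -
  define c where "c = ip x y"
  define s where "s = (cmod c)\<^sup>2"
  have pos: "0 \<le> (nrm x)\<^sup>2 - 2 * t * s + t\<^sup>2 * s * (nrm y)\<^sup>2" for t :: real
  proof -
    have yx: "ip y x = cnj c" using ip_commute[of y x] by (simp add: c_def)
    have cc: "c * cnj c = of_real s"
      unfolding s_def by (rule complex_norm_square[symmetric])
    let ?z = "x - (of_real t * c) *c y"
    have "ip ?z ?z = of_real ((nrm x)\<^sup>2) - 2 * of_real t * (c * cnj c)
        + (of_real t)\<^sup>2 * (c * cnj c) * of_real ((nrm y)\<^sup>2)"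
      unfolding ip_self[symmetric]
      by (simp add: ip_diff_left ip_diff_right ip_scale_left ip_scale_right yx c_def[symmetric])
        (simp add: power2_eq_square algebra_simps)
    also have "\<dots> = of_real ((nrm x)\<^sup>2 - 2 * t * s + t\<^sup>2 * s * (nrm y)\<^sup>2)"
      by (simp add: cc)
    finally show ?thesis using ip_ge_0[of ?z] by simp
  qed
  have "s \<le> (nrm x)\<^sup>2 * (nrm y)\<^sup>2"
  proof (cases "nrm y = 0")
    case True
    have "s \<le> 0"
    proof (rule ccontr)
      assume s: "\<not> s \<le> 0"
      then have "2 * ((nrm x)\<^sup>2 + 1) \<le> (nrm x)\<^sup>2"
        using pos[of "((nrm x)\<^sup>2 + 1) / s"] True by simp
      moreover have False if "2 * (X + 1) \<le> X" "0 \<le> X" for X :: real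
        using that by (simp add: algebra_simps)
      ultimately show False using zero_le_power2 by blast
    qed
    then show ?thesis using True by simp
  next
    case False
    then have n: "(nrm y)\<^sup>2 > 0" by simp
    have "X - 2 * (1 / Y) * s + (1 / Y)\<^sup>2 * s * Y = X - s / Y" if "Y > 0" for X Y :: real
      using that by (simp add: field_simps power2_eq_square)
    from this[OF n, of "(nrm x)\<^sup>2"] have "0 \<le> (nrm x)\<^sup>2 - s / (nrm y)\<^sup>2"
      using pos[of "1 / (nrm y)\<^sup>2"] by simp
    then show ?thesis using n by (simp add: pos_divide_le_eq)
  qed
  then show ?thesis
    unfolding s_def c_def power_mult_distrib[symmetric] by (rule power2_le_imp_le) simp
qed

lemma nrm_triangle: "nrm (x + y) \<le> nrm x + nrm y"
proof (rule power2_le_imp_le)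
  have "of_real ((nrm (x + y))\<^sup>2) = of_real ((nrm x)\<^sup>2) + ip x y + (ip y x + of_real ((nrm y)\<^sup>2))"
    unfolding ip_self[symmetric] by (simp add: ip_add_left ip_add_right)
  then have "(nrm (x + y))\<^sup>2 = (nrm x)\<^sup>2 + (nrm y)\<^sup>2 + 2 * Re (ip x y)"
    using ip_commute[of x y] by (simp add: complex_eq_iff)
  also have "Re (ip x y) \<le> nrm x * nrm y"
    using cauchy_schwarz[of x y] complex_Re_le_cmod[of "ip x y"] by linarith
  finally show "(nrm (x + y))\<^sup>2 \<le> (nrm x + nrm y)\<^sup>2"
    by (simp add: power2_sum)
qed simp

lemma nrm_zero [simp]: "nrm 0 = 0"
  by (simp add: nrm_def)

lemma nrm_sum: "nrm (\<Sum>i\<in>A. f i) \<le> (\<Sum>i\<in>A. nrm (f i))"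
  by (induction A rule: infinite_finite_induct)
    (auto intro: order.trans[OF nrm_triangle])

lemma nrm_power2_sum:
  "of_real ((nrm (\<Sum>i\<in>A. c i *c x i))\<^sup>2) = (\<Sum>i\<in>A. \<Sum>j\<in>A. c i * cnj (c j) * ip (x i) (x j))"
  unfolding ip_self[symmetric] ip_sum_left
  by (simp add: ip_sum_right ip_scale_left ip_scale_right sum_distrib_left mult_ac)

lemma nrm_uminus: "nrm (- x) = nrm x"
  by (simp add: nrm_def ip_minus_left ip_minus_right)

lemma nrm_eq_0_trans: "nrm (x - y) = 0 \<Longrightarrow> nrm (y - z) = 0 \<Longrightarrow> nrm (x - z) = 0"
  using nrm_triangle[of "x - y" "y - z"] nrm_ge_0[of "x - z"] by simp

text \<open>By Cauchy-Schwarz a null vector pairs to zero with everything, so vectors may be altered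
  by null vectors; this replaces passing to the quotient space.\<close>

lemma ip_cong:
  assumes "nrm (x - x') = 0" "nrm (y - y') = 0"
  shows "ip x y = ip x' y'"
proof -
  have "ip (x - x') y = 0" "ip x' (y - y') = 0"
    using cauchy_schwarz[of "x - x'" y] cauchy_schwarz[of x' "y - y'"] assms by simp_all
  then show ?thesis by (simp add: ip_diff_left ip_diff_right)
qed

text \<open>Plancherel for the Fourier transform on the cyclic group of order \<open>M\<close>, from
  orthogonality of characters. Sampling at roots of unity takes the place of integrals over the
  circle.\<close>

lemma parseval:
  assumes M: "M > 0"
  shows "(\<Sum>a<M. (nrm (\<Sum>m<M. (cis (2 * pi * real a / real M) ^ m) *c y m))\<^sup>2) = real M * (\<Sum>m<M. (nrm (y m))\<^sup>2)"
proof -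
  define w where "w a = cis (2 * pi * real a / real M)" for a :: nat
  have orth: "(\<Sum>a<M. w a ^ m * cnj (w a ^ l)) = (if m = l then of_nat M else 0)"
    if "m < M" "l < M" for m l
  proof -
    define v where "v = cis (2 * pi * (real m - real l) / real M)"
    have 1: "w a ^ m * cnj (w a ^ l) = v ^ a" for a
    proof -
      have "w a ^ m * cnj (w a ^ l) = cis (real m * (2 * pi * real a / real M) - real l * (2 * pi * real a / real M))"
        by (simp add: w_def Complex.DeMoivre cis_cnj cis_mult)
      also have "\<dots> = cis (real a * (2 * pi * (real m - real l) / real M))"
        by (rule arg_cong[where f = cis]) (simp add: field_simps diff_divide_distrib)
      finally show ?thesis by (simp add: v_def Complex.DeMoivre)
    qed
    show ?thesis
    proof (cases "m = l")
      case True
      then show ?thesis unfolding 1 by (simp add: v_def)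
    next
      case False
      have vM: "v ^ M = 1"
      proof -
        have "v ^ M = cis (2 * pi * of_int (int m - int l))"
          using M by (simp add: v_def Complex.DeMoivre mult.commute)
        then show ?thesis by (simp add: cis_multiple_2pi)
      qed
      \<comment> \<open>Equality would make \<open>M\<close> divide \<open>m - l\<close>, impossible
        for distinct indices below \<open>M\<close>.\<close>
      have "v \<noteq> 1"
      proof
        assume "v = 1"
        then have "cos (2 * pi * (real m - real l) / real M) = 1"
          by (simp add: v_def complex_eq_iff)
        then obtain n :: int where n: "2 * pi * (real m - real l) / real M = of_int n * 2 * pi"
          using cos_one_2pi_int by blast
        then have "(2 * pi) * (real m - real l) = (2 * pi) * (of_int n * real M)"
          using M by (simp add: field_simps)
        then have "real m - real l = of_int n * real M"
          by (simp only: mult_cancel_left) simp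
        then have "real_of_int (int m - int l) = real_of_int (n * int M)" by simp
        then have e: "int m - int l = n * int M" by (simp only: of_int_eq_iff)
        have "\<bar>int m - int l\<bar> < int M" using that by auto
        then have "\<bar>n\<bar> * int M < 1 * int M" unfolding e by (simp add: abs_mult)
        then have "n = 0" using M by (simp only: mult_less_cancel_right) auto
        then show False using e False by simp
      qed
      then have "(\<Sum>a<M. v ^ a) = 0"
        using geometric_sum[of v M] vM by simp
      then show ?thesis unfolding 1 using False by simp
    qed
  qed
  have "complex_of_real (\<Sum>a<M. (nrm (\<Sum>m<M. (w a ^ m) *c y m))\<^sup>2)
      = (\<Sum>a<M. \<Sum>m<M. \<Sum>l<M. w a ^ m * cnj (w a ^ l) * ip (y m) (y l))"
    by (simp only: of_real_sum nrm_power2_sum)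
  also have "\<dots> = (\<Sum>m<M. \<Sum>l<M. \<Sum>a<M. w a ^ m * cnj (w a ^ l) * ip (y m) (y l))"
    by (subst sum.swap) (rule sum.cong[OF refl], rule sum.swap)
  also have "\<dots> = (\<Sum>m<M. \<Sum>l<M. (\<Sum>a<M. w a ^ m * cnj (w a ^ l)) * ip (y m) (y l))"
    by (simp only: sum_distrib_right)
  also have "\<dots> = (\<Sum>m<M. \<Sum>l<M. (if m = l then of_nat M else 0) * ip (y m) (y l))"
    by (intro sum.cong refl) (simp only: orth lessThan_iff)
  also have "\<dots> = (\<Sum>m<M. \<Sum>l<M. (if m = l then of_nat M * ip (y m) (y l) else 0))"
    by (intro sum.cong refl) simp
  also have "\<dots> = (\<Sum>m<M. of_nat M * ip (y m) (y m))"
    by (simp add: sum.delta)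
  also have "\<dots> = of_real (real M * (\<Sum>m<M. (nrm (y m))\<^sup>2))"
    by (simp add: ip_self sum_distrib_left)
  finally show ?thesis
    unfolding w_def of_real_eq_iff .
qed

text \<open>The isometric bijection is a composition of reflections, each correcting one further
  vector, so it is defined on the whole space without orthogonal complements. As the form may be
  degenerate, vectors are matched only up to null vectors.\<close>

lemma householder:
  fixes v w :: "nat \<Rightarrow> 'v"
  assumes "\<And>i j. i < n \<Longrightarrow> j < n \<Longrightarrow> ip (v i) (v j) = ip (w i) (w j)"
  obtains U U' where "\<And>x y. U (x + y) = U x + U y" "\<And>c x. U (c *c x) = c *c U x"
    "\<And>x y. ip (U x) (U y) = ip x y" "\<And>x. U' (U x) = x" "\<And>x. U (U' x) = x"
    "\<And>i. i < n \<Longrightarrow> nrm (U (v i) - w i) = 0"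
  using assms
proof (induction n arbitrary: thesis)
  case 0
  show ?case by (rule "0.prems"(1)[of id id]) auto
next
  case (Suc n)
  have gram: "ip (v i) (v j) = ip (w i) (w j)" if "i < n" "j < n" for i j
    using that by (intro Suc.prems(2)) auto
  obtain U U' where add: "\<And>x y. U (x + y) = U x + U y" and sc: "\<And>c x. U (c *c x) = c *c U x"
    and iso: "\<And>x y. ip (U x) (U y) = ip x y" and inv: "\<And>x. U' (U x) = x" "\<And>x. U (U' x) = x"
    and vw: "\<And>i. i < n \<Longrightarrow> nrm (U (v i) - w i) = 0"
    by (rule Suc.IH[OF _ gram]) (rule that)
  define a c where "a = U (v n)" and "c = a - w n"
  have naw: "ip a a = ip (w n) (w n)"
    unfolding a_def iso by (rule Suc.prems) auto
  have wc: "ip (w i) c = 0" if "i < n" for i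
  proof -
    have "ip (w i) a = ip (U (v i)) (U (v n))"
      unfolding a_def using vw[OF that] by (intro ip_cong) (metis minus_diff_eq nrm_uminus, simp)
    also have "\<dots> = ip (w i) (w n)"
      unfolding iso using that by (intro Suc.prems) auto
    finally show ?thesis by (simp add: c_def ip_diff_right)
  qed
  show ?case
  proof (cases "nrm c = 0")
    case True
    show ?thesis
    proof (rule Suc.prems(1)[OF add sc iso inv])
      fix i assume "i < Suc n"
      then show "nrm (U (v i) - w i) = 0"
        using True vw by (cases "i = n") (auto simp: c_def a_def)
    qed
  next
    case False
    define s where "s = ip a c"
    \<comment> \<open>As \<open>a\<close> and \<open>w n\<close> have equal norms,
      \<open>ip c c\<close> is twice the real part of \<open>s\<close>; hence \<open>s\<close> is
      nonzero, \<open>c\<close> not being null.\<close>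
    have cc: "ip c c = s + cnj s"
    proof -
      have "ip c c = ip a a - ip a (w n) - ip (w n) a + ip (w n) (w n)"
        by (simp add: c_def ip_diff_left ip_diff_right)
      also have "\<dots> = s + cnj s"
        using naw ip_commute[of a "w n"] ip_commute[of a a] by (simp add: s_def c_def ip_diff_right)
      finally show ?thesis .
    qed
    have s0: "s \<noteq> 0" "cnj s \<noteq> 0"
      using False cc by (auto simp: ip_self)
    \<comment> \<open>The reflection along \<open>c = a - w\<^sub>n\<close> fixes the \<open>w\<^sub>i\<close> with \<open>i < n\<close>; dividing by \<open>s\<close> rather than by half of
      \<open>\<langle>c, c\<rangle> = 2 Re s\<close> makes it map \<open>a\<close> to \<open>w\<^sub>n\<close> even when \<open>\<langle>a, w\<^sub>n\<rangle>\<close> is not real.\<close>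
    define R where "R x = x - (ip x c / s) *c c" for x
    define R' where "R' x = x - (ip x c / cnj s) *c c" for x
    have Radd: "R (x + y) = R x + R y" for x y
      by (simp add: R_def ip_add_left add_divide_distrib scale_left_distrib)
    have Rsc: "R (k *c x) = k *c R x" for k x
      by (simp add: R_def ip_scale_left scale_right_diff_distrib)
    have Riso: "ip (R x) (R y) = ip x y" for x y
    proof -
      have expand: "ip (x - p *c c) (y - q *c c) = ip x y - p * ip c y - cnj q * ip x c
          + p * cnj q * (s + cnj s)" for p q
        unfolding ip_diff_left ip_diff_right ip_scale_left ip_scale_right cc
        by (simp add: algebra_simps)
      have "ip (R x) (R y) = ip x y - ip x c / s * ip c y - cnj (ip y c / s) * ip x c
          + ip x c / s * cnj (ip y c / s) * (s + cnj s)"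
        unfolding R_def by (rule expand)
      also have "ip c y = cnj (ip y c)" using ip_commute[of y c] by simp
      also have "ip x y - ip x c / s * cnj (ip y c) - cnj (ip y c / s) * ip x c
          + ip x c / s * cnj (ip y c / s) * (s + cnj s) = ip x y"
      proof -
        have "r - p / s * q - q / t * p + p / s * (q / t) * (s + t) = r"
          if "s \<noteq> 0" "t \<noteq> 0" for p q r s t :: complex
          using that by (simp add: field_simps)
        from this[OF s0] show ?thesis by simp
      qed
      finally show ?thesis .
    qed
    \<comment> \<open>\<open>R'\<close> is the same rank-one change with \<open>s\<close>
      conjugated; the relation \<open>ip c c = s + cnj s\<close> makes the two cancel.\<close>
    have RR: "R' (R x) = x" "R (R' x) = x" for x
    proof -
      have k: "a - p *c c - q *c c = a - (p + q) *c c" for a p q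
        by (simp add: scale_left_distrib)
      show "R' (R x) = x"
        unfolding R_def R'_def k ip_diff_left ip_scale_left cc using s0
        by (simp add: field_simps)
      show "R (R' x) = x"
        unfolding R_def R'_def k ip_diff_left ip_scale_left cc using s0
        by (simp add: field_simps)
    qed
    show ?thesis
    proof (rule Suc.prems(1)[of "R \<circ> U" "U' \<circ> R'"])
      fix i assume i: "i < Suc n"
      have Rdiff: "R (x - y) = R x - R y" for x y
        using Radd[of "x - y" y] by (simp add: algebra_simps)
      show "nrm ((R \<circ> U) (v i) - w i) = 0"
      proof (cases "i = n")
        case True
        then have "(R \<circ> U) (v i) = a - c" using s0 by (simp add: R_def flip: a_def s_def)
        then show ?thesis using True by (simp add: c_def)
      next
        case False
        then have "i < n" using i by simp
        then have "R (w i) = w i" by (simp add: R_def wc)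
        then have "(R \<circ> U) (v i) - w i = R (U (v i) - w i)" by (simp add: Rdiff)
        also have "nrm \<dots> = nrm (U (v i) - w i)" by (simp add: nrm_def Riso)
        finally show ?thesis using vw[OF \<open>i < n\<close>] by simp
      qed
    qed (simp_all add: add sc iso inv Radd Rsc Riso RR)
  qed
qed

end

section \<open>Direct sums of semi-inner product spaces\<close>

lemma semi_innerI:
  assumes "vector_space s"
    and "\<And>x y z. ip (x + y) z = ip x z + ip y z" "\<And>c x y. ip (s c x) y = c * ip x y"
    and "\<And>x y. ip y x = cnj (ip x y)" "\<And>x. 0 \<le> Re (ip x x)"
  shows "semi_inner s ip"
  by (intro semi_inner.intro semi_inner_axioms.intro assms)

lemma semi_inner_prod:
  assumes "semi_inner s1 ip1" "semi_inner s2 ip2"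
  shows "semi_inner (\<lambda>c x. (s1 c (fst x), s2 c (snd x))) (\<lambda>x y. ip1 (fst x) (fst y) + ip2 (snd x) (snd y))"
proof -
  interpret a: semi_inner s1 ip1 by fact
  interpret b: semi_inner s2 ip2 by fact
  show ?thesis
  proof (rule semi_innerI)
    show "vector_space (\<lambda>c x. (s1 c (fst x), s2 c (snd x)))"
      by unfold_locales (auto simp: a.scale_right_distrib b.scale_right_distrib
          a.scale_left_distrib b.scale_left_distrib)
    show "ip1 (fst y) (fst x) + ip2 (snd y) (snd x) = cnj (ip1 (fst x) (fst y) + ip2 (snd x) (snd y))"
      for x y using a.ip_commute[of "fst y" "fst x"] b.ip_commute[of "snd y" "snd x"] by simp
  qed (auto simp: a.ip_add_left b.ip_add_left a.ip_scale_left b.ip_scale_left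
      a.ip_ge_0 b.ip_ge_0 algebra_simps)
qed

text \<open>Whole sequences are kept while the form sees only the first \<open>L\<close> terms, so
  no convergence is involved; the form is degenerate in the remaining terms.\<close>

lemma semi_inner_fun:
  assumes "semi_inner s ip"
  shows "semi_inner (\<lambda>c g n. s c (g n)) (\<lambda>g h. \<Sum>n<L. ip (g n) (h n))"
proof -
  interpret a: semi_inner s ip by fact
  show ?thesis
  proof (rule semi_innerI)
    show "vector_space (\<lambda>c g n. s c (g n))"
      by unfold_locales (auto simp: a.scale_right_distrib a.scale_left_distrib fun_eq_iff)
    show "(\<Sum>n<L. ip (y n) (x n)) = cnj (\<Sum>n<L. ip (x n) (y n))" for x y
      unfolding cnj_sum by (intro sum.cong refl a.ip_commute)
  qed (auto simp: a.ip_add_left a.ip_scale_left sum.distrib sum_distrib_left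
      a.ip_ge_0 intro!: sum_nonneg)
qed

section \<open>Commuting operators as multiplications in a commutative algebra\<close>

locale semi_inner_algebra =
  fixes const :: "complex \<Rightarrow> 'a::comm_ring_1" and ip :: "'a \<Rightarrow> 'a \<Rightarrow> complex"
  assumes const_mult: "const (a * b) = const a * const b"
    and semi_inner: "semi_inner (\<lambda>c x. const c * x) ip"
begin

sublocale semi_inner "\<lambda>c x. const c * x" ip
  by (rule semi_inner)

declare scale_scale [simp del]

lemma const_add: "const (a + b) = const a + const b"
  using scale_left_distrib[of a b 1] by simp

lemma const_1 [simp]: "const 1 = 1"
  using scale_one[of 1] by simp

lemma const_0 [simp]: "const 0 = 0"
  using const_add[of 0 0] by simp

lemma const_of_nat: "const (of_nat n) = of_nat n"
  by (induction n) (simp_all add: const_add)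

lemma const_sum: "const (\<Sum>i\<in>A. c i) = (\<Sum>i\<in>A. const (c i))"
  by (induction A rule: infinite_finite_induct) (simp_all add: const_add)

lemma nrm_power_mult:
  assumes "\<And>f. nrm (z * f) \<le> nrm f"
  shows "nrm (z ^ n * f) \<le> nrm f"
  by (induction n) (auto simp: mult.assoc intro: order.trans[OF assms])

text \<open>\<open>b \<alpha>\<close> collects the other variables, and \<open>Q\<close> bounds the
  sum when \<open>z\<close> is replaced by a unimodular scalar. The factor \<open>k\<close> counts
  the ways to write \<open>k = j + l + 1\<close>; the weight \<open>v ^ k\<close> is shared as
  \<open>v * v ^ j * v ^ l\<close>, and the square roots of two geometric sums of ratio
  \<open>v\<^sup>2\<close> produce \<open>1 / (1 - v\<^sup>2)\<close>.\<close>

lemma bernstein: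
  fixes b :: "'i \<Rightarrow> 'a" and k :: "'i \<Rightarrow> nat" and v Q :: real
  assumes fin: "finite A" and z: "\<And>f. nrm (z * f) \<le> nrm f" and "0 \<le> Q" and v: "0 \<le> v" "v < 1"
    and Q: "\<And>\<zeta> f. cmod \<zeta> = 1 \<Longrightarrow> nrm (\<Sum>\<alpha>\<in>A. const (\<zeta> ^ k \<alpha>) * (b \<alpha> * f)) \<le> Q * nrm f"
  shows "nrm (\<Sum>\<alpha>\<in>A. const (of_nat (k \<alpha>) * of_real v ^ k \<alpha>) * (b \<alpha> * (z ^ k \<alpha> * f)))
    \<le> v / (1 - v\<^sup>2) * Q * nrm f"
proof -
  define n where "n = Suc (\<Sum>\<alpha>\<in>A. k \<alpha>)"
  have n: "k \<alpha> < n" if "\<alpha> \<in> A" for \<alpha>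
    unfolding n_def using member_le_sum[OF that, of k] fin by simp
  \<comment> \<open>The indices \<open>k \<alpha> + t\<close> lie below \<open>2 * n\<close>, so the
    Fourier transform of order \<open>M\<close> has no aliasing.\<close>
  define M where "M = 2 * n"
  have M: "M > 0" by (simp add: M_def n_def)
  define y where "y l = const (of_real v ^ l) * (z ^ l * f)" for l
  have y: "nrm (y l) \<le> v ^ l * nrm f" for l
    unfolding y_def nrm_scale using v nrm_power_mult[OF z, of l f]
    by (simp add: norm_power mult_left_mono)
  \<comment> \<open>The \<open>y\<close> are listed in reverse, so \<open>H (n + j)\<close> is row \<open>j\<close> of the Hankel matrix applied to \<open>y\<close>.\<close>
  define H where "H m = (\<Sum>\<alpha>\<in>A. \<Sum>t<n. if k \<alpha> + t = m then b \<alpha> * y (n - Suc t) else 0)" for m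
  define Y where "Y \<zeta> = (\<Sum>t<n. const (\<zeta> ^ t) * y (n - Suc t))" for \<zeta>
  \<comment> \<open>The transform turns the convolution \<open>H\<close> into a product, to which
    the hypothesis on \<open>Q\<close> applies at each root of unity.\<close>
  have HY: "(\<Sum>m<M. const (\<zeta> ^ m) * H m) = (\<Sum>\<alpha>\<in>A. const (\<zeta> ^ k \<alpha>) * (b \<alpha> * Y \<zeta>))" for \<zeta>
  proof -
    have "(\<Sum>m<M. const (\<zeta> ^ m) * H m)
        = (\<Sum>m<M. \<Sum>\<alpha>\<in>A. \<Sum>t<n. if m = k \<alpha> + t then const (\<zeta> ^ m) * (b \<alpha> * y (n - Suc t)) else 0)"
      unfolding H_def sum_distrib_left by (intro sum.cong refl) auto
    also have "\<dots> = (\<Sum>\<alpha>\<in>A. \<Sum>m<M. \<Sum>t<n. if m = k \<alpha> + t then const (\<zeta> ^ m) * (b \<alpha> * y (n - Suc t)) else 0)"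
      by (rule sum.swap)
    also have "\<dots> = (\<Sum>\<alpha>\<in>A. \<Sum>t<n. \<Sum>m<M. if m = k \<alpha> + t then const (\<zeta> ^ m) * (b \<alpha> * y (n - Suc t)) else 0)"
      by (intro sum.cong refl sum.swap)
    also have "\<dots> = (\<Sum>\<alpha>\<in>A. \<Sum>t<n. const (\<zeta> ^ (k \<alpha> + t)) * (b \<alpha> * y (n - Suc t)))"
    proof (intro sum.cong refl)
      fix \<alpha> t assume "\<alpha> \<in> A" "t \<in> {..<n}"
      then have "k \<alpha> + t < M" using n[of \<alpha>] by (simp add: M_def)
      then show "(\<Sum>m<M. if m = k \<alpha> + t then const (\<zeta> ^ m) * (b \<alpha> * y (n - Suc t)) else 0)
          = const (\<zeta> ^ (k \<alpha> + t)) * (b \<alpha> * y (n - Suc t))"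
        by (simp add: sum.delta)
    qed
    also have "\<dots> = (\<Sum>\<alpha>\<in>A. const (\<zeta> ^ k \<alpha>) * (b \<alpha> * Y \<zeta>))"
      unfolding Y_def sum_distrib_left
      by (intro sum.cong refl) (simp add: power_add const_mult mult_ac)
    finally show ?thesis .
  qed
  define w where "w a = cis (2 * pi * real a / real M)" for a
  have w: "cmod (w a) = 1" for a by (simp add: w_def)
  have H: "(\<Sum>m<M. (nrm (H m))\<^sup>2) \<le> Q\<^sup>2 * (\<Sum>l<n. (nrm (y l))\<^sup>2)"
  proof -
    have "real M * (\<Sum>m<M. (nrm (H m))\<^sup>2) = (\<Sum>a<M. (nrm (\<Sum>m<M. const (w a ^ m) * H m))\<^sup>2)"
      unfolding w_def by (rule parseval[OF M, symmetric])
    also have "\<dots> \<le> (\<Sum>a<M. Q\<^sup>2 * (nrm (Y (w a)))\<^sup>2)"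
      unfolding HY power_mult_distrib[symmetric] by (intro sum_mono power_mono Q w) simp
    also have "(\<Sum>a<M. Q\<^sup>2 * (nrm (Y (w a)))\<^sup>2)
        = Q\<^sup>2 * (\<Sum>a<M. (nrm (\<Sum>m<M. const (w a ^ m) * (if m < n then y (n - Suc m) else 0)))\<^sup>2)"
    proof -
      have "Y \<zeta> = (\<Sum>m<M. const (\<zeta> ^ m) * (if m < n then y (n - Suc m) else 0))" for \<zeta>
        unfolding Y_def by (rule sum.mono_neutral_cong_left) (auto simp: M_def)
      then show ?thesis by (simp only: sum_distrib_left)
    qed
    also have "\<dots> = Q\<^sup>2 * (real M * (\<Sum>m<M. (nrm (if m < n then y (n - Suc m) else 0))\<^sup>2))"
      unfolding w_def by (simp only: parseval[OF M])
    also have "(\<Sum>m<M. (nrm (if m < n then y (n - Suc m) else 0))\<^sup>2) = (\<Sum>t<n. (nrm (y (n - Suc t)))\<^sup>2)"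
      by (rule sum.mono_neutral_cong_right) (auto simp: M_def)
    also have "\<dots> = (\<Sum>l<n. (nrm (y l))\<^sup>2)"
      by (rule sum.nat_diff_reindex)
    finally show ?thesis using M by (simp add: mult.left_commute[of "Q\<^sup>2"])
  qed
  define G where "G = (\<Sum>j<n. (v ^ j)\<^sup>2)"
  have v2: "v\<^sup>2 < 1" using v by (simp add: power_less_one_iff)
  have G: "0 \<le> G" "G \<le> 1 / (1 - v\<^sup>2)"
  proof -
    have "G = (\<Sum>j<n. (v\<^sup>2) ^ j)" unfolding G_def by (simp add: power_mult[symmetric] mult.commute)
    also have "\<dots> \<le> suminf (\<lambda>j. (v\<^sup>2) ^ j)"
      using v2 by (intro sum_le_suminf summable_geometric) auto
    also have "\<dots> = 1 / (1 - v\<^sup>2)" using v2 by (intro suminf_geometric) simp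
    finally show "G \<le> 1 / (1 - v\<^sup>2)" .
  qed (simp add: G_def sum_nonneg)
  have Hn: "(\<Sum>j<n. (nrm (H (n + j)))\<^sup>2) \<le> (Q * nrm f)\<^sup>2 * G"
  proof -
    have "(\<Sum>j<n. (nrm (H (n + j)))\<^sup>2) = (\<Sum>m\<in>(+) n ` {..<n}. (nrm (H m))\<^sup>2)"
      by (simp add: sum.reindex)
    also have "\<dots> \<le> (\<Sum>m<M. (nrm (H m))\<^sup>2)"
      by (rule sum_mono2) (auto simp: M_def)
    also note H
    also have "Q\<^sup>2 * (\<Sum>l<n. (nrm (y l))\<^sup>2) \<le> Q\<^sup>2 * (\<Sum>l<n. (v ^ l * nrm f)\<^sup>2)"
      by (intro mult_left_mono sum_mono power_mono y) auto
    also have "\<dots> = (Q * nrm f)\<^sup>2 * G"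
      by (simp add: G_def power_mult_distrib sum_distrib_left sum_distrib_right mult_ac)
    finally show ?thesis .
  qed
  have "(\<Sum>\<alpha>\<in>A. const (of_nat (k \<alpha>) * of_real v ^ k \<alpha>) * (b \<alpha> * (z ^ k \<alpha> * f)))
      = (\<Sum>j<n. const (of_real v ^ Suc j) * (z ^ Suc j * H (n + j)))"
  proof -
    \<comment> \<open>The admissible \<open>t\<close> run from \<open>n - k \<alpha>\<close> to
      \<open>n - 1\<close>, each with exactly one \<open>j\<close>; this count is the factor
      \<open>k \<alpha>\<close> of the derivative.\<close>
    have cnt: "(\<Sum>j<n. \<Sum>t<n. if k \<alpha> + t = n + j then E else 0) = of_nat (k \<alpha>) * E"
      if \<alpha>: "\<alpha> \<in> A" for \<alpha> and E :: 'a
    proof -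
      have "(\<Sum>j<n. \<Sum>t<n. if k \<alpha> + t = n + j then E else 0)
          = (\<Sum>t<n. \<Sum>j<n. if j = k \<alpha> + t - n then (if n \<le> k \<alpha> + t then E else 0) else 0)"
        by (subst sum.swap) (intro sum.cong refl, auto)
      also have "\<dots> = (\<Sum>t<n. if n \<le> k \<alpha> + t then E else 0)"
        using n[OF \<alpha>] by (intro sum.cong refl) auto
      also have "\<dots> = (\<Sum>t\<in>{n - k \<alpha>..<n}. E)"
        using n[OF \<alpha>] by (intro sum.mono_neutral_cong_right) auto
      also have "\<dots> = of_nat (k \<alpha>) * E" using n[OF \<alpha>] by simp
      finally show ?thesis .
    qed
    have "(\<Sum>j<n. const (of_real v ^ Suc j) * (z ^ Suc j * H (n + j)))
        = (\<Sum>j<n. \<Sum>\<alpha>\<in>A. \<Sum>t<n. if k \<alpha> + t = n + j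
            then const (of_real v ^ k \<alpha>) * (b \<alpha> * (z ^ k \<alpha> * f)) else 0)"
      unfolding H_def sum_distrib_left
    proof (intro sum.cong refl)
      fix j \<alpha> t assume t: "t \<in> {..<n}"
      show "const (of_real v ^ Suc j) * (z ^ Suc j * (if k \<alpha> + t = n + j then b \<alpha> * y (n - Suc t) else 0))
          = (if k \<alpha> + t = n + j then const (of_real v ^ k \<alpha>) * (b \<alpha> * (z ^ k \<alpha> * f)) else 0)"
      proof (cases "k \<alpha> + t = n + j")
        case True
        then have "k \<alpha> = Suc j + (n - Suc t)" using t by simp
        then have "const (of_real v ^ k \<alpha>) * (b \<alpha> * (z ^ k \<alpha> * f))
            = const (of_real v ^ Suc j) * (z ^ Suc j * (b \<alpha> * y (n - Suc t)))"
          by (simp only: power_add const_mult y_def mult_ac)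
        then show ?thesis using True by simp
      qed simp
    qed
    also have "\<dots> = (\<Sum>\<alpha>\<in>A. \<Sum>j<n. \<Sum>t<n. if k \<alpha> + t = n + j
            then const (of_real v ^ k \<alpha>) * (b \<alpha> * (z ^ k \<alpha> * f)) else 0)"
      by (rule sum.swap)
    also have "\<dots> = (\<Sum>\<alpha>\<in>A. const (of_nat (k \<alpha>) * of_real v ^ k \<alpha>) * (b \<alpha> * (z ^ k \<alpha> * f)))"
      by (intro sum.cong refl) (simp add: cnt const_mult const_of_nat mult.assoc)
    finally show ?thesis by simp
  qed
  also have "nrm \<dots> \<le> (\<Sum>j<n. nrm (const (of_real v ^ Suc j) * (z ^ Suc j * H (n + j))))"
    by (rule nrm_sum)
  also have "\<dots> \<le> (\<Sum>j<n. v * (\<bar>v ^ j\<bar> * \<bar>nrm (H (n + j))\<bar>))"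
  proof (rule sum_mono)
    fix j
    have "nrm (const (of_real v ^ Suc j) * (z ^ Suc j * H (n + j))) = v ^ Suc j * nrm (z ^ Suc j * H (n + j))"
      using v by (simp only: nrm_scale) (simp add: norm_mult norm_power)
    also have "\<dots> \<le> v ^ Suc j * nrm (H (n + j))"
      using v by (intro mult_left_mono nrm_power_mult z) auto
    finally show "nrm (const (of_real v ^ Suc j) * (z ^ Suc j * H (n + j))) \<le> v * (\<bar>v ^ j\<bar> * \<bar>nrm (H (n + j))\<bar>)"
      using v by (simp add: mult.assoc)
  qed
  \<comment> \<open>Cauchy-Schwarz over \<open>j\<close> separates the outer weights
    \<open>v ^ j\<close> from the rows, whose square sum Parseval has bounded.\<close>
  also have "\<dots> \<le> v * (L2_set (\<lambda>j. v ^ j) {..<n} * L2_set (\<lambda>j. nrm (H (n + j))) {..<n})"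
    unfolding sum_distrib_left[symmetric] using v by (intro mult_left_mono L2_set_mult_ineq)
  also have "\<dots> \<le> v * (sqrt G * sqrt ((Q * nrm f)\<^sup>2 * G))"
    unfolding L2_set_def G_def[symmetric] using v G Hn
    by (intro mult_left_mono real_sqrt_le_mono) auto
  also have "\<dots> = v * (G * (Q * nrm f))"
    using G \<open>0 \<le> Q\<close> by (simp add: real_sqrt_mult)
  also have "\<dots> \<le> v * (1 / (1 - v\<^sup>2) * (Q * nrm f))"
    using v G \<open>0 \<le> Q\<close> by (intro mult_left_mono mult_right_mono) auto
  finally show ?thesis by (simp add: mult.assoc)
qed

end

section \<open>Ando's inequality\<close>

lemma (in semi_inner) parseval2:
  assumes M: "M > 0"
  defines "w \<equiv> \<lambda>a. cis (2 * pi * real a / real M)"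
  shows "(\<Sum>a<M. \<Sum>b<M. (nrm (\<Sum>m<M. \<Sum>l<M. (w a ^ m * w b ^ l) *c y m l))\<^sup>2)
    = (real M)\<^sup>2 * (\<Sum>m<M. \<Sum>l<M. (nrm (y m l))\<^sup>2)"
proof -
  have "(\<Sum>m<M. \<Sum>l<M. (w a ^ m * w b ^ l) *c y m l) = (\<Sum>l<M. (w b ^ l) *c (\<Sum>m<M. (w a ^ m) *c y m l))" for a b
    by (subst sum.swap) (simp add: scale_sum_right mult.commute)
  then have "(\<Sum>a<M. \<Sum>b<M. (nrm (\<Sum>m<M. \<Sum>l<M. (w a ^ m * w b ^ l) *c y m l))\<^sup>2)
      = (\<Sum>a<M. real M * (\<Sum>l<M. (nrm (\<Sum>m<M. (w a ^ m) *c y m l))\<^sup>2))"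
    unfolding w_def by (simp only: parseval[OF M])
  also have "\<dots> = real M * (\<Sum>l<M. \<Sum>a<M. (nrm (\<Sum>m<M. (w a ^ m) *c y m l))\<^sup>2)"
    unfolding sum_distrib_left[symmetric] by (subst sum.swap) simp
  also have "\<dots> = (real M)\<^sup>2 * (\<Sum>l<M. \<Sum>m<M. (nrm (y m l))\<^sup>2)"
    unfolding w_def by (simp only: parseval[OF M] sum_distrib_left[symmetric]) (simp add: power2_eq_square)
  finally show ?thesis by (subst (asm) (2) sum.swap)
qed

section \<open>Commuting isometric dilation of two contractions\<close>

context semi_inner_algebra
begin

text \<open>The form belonging to one minus the adjoint of \<open>z\<close> times \<open>z\<close>,
  nonnegative because \<open>z\<close> contracts. Using the form in place of the defect operator
  avoids square roots.\<close>

lemma defect: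
  assumes "\<And>f. nrm (z * f) \<le> nrm f"
  shows "semi_inner (\<lambda>c x. const c * x) (\<lambda>x y. ip x y - ip (z * x) (z * y))"
proof (rule semi_innerI)
  show "vector_space (\<lambda>c x. const c * x)" by (rule vector_space_axioms)
  show "ip (const c * x) y - ip (z * (const c * x)) (z * y) = c * (ip x y - ip (z * x) (z * y))" for c x y
    unfolding mult.left_commute[of z] ip_scale_left by (simp add: algebra_simps)
  show "ip y x - ip (z * y) (z * x) = cnj (ip x y - ip (z * x) (z * y))" for x y
    by (simp add: ip_commute[of y x] ip_commute[of "z * y" "z * x"])
  show "0 \<le> Re (ip x x - ip (z * x) (z * x))" for x
    using power_mono[OF assms[of x], of 2] by (simp add: ip_self)
qed (simp add: ip_add_left distrib_left)

text \<open>
  Ando's dilation. \<open>W\<^sub>i\<close> dilates \<open>z\<^sub>i\<close> isometrically by shifting the \<open>i\<close>th coordinate of every block in a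
  sequence of pairs, normed by the defect forms of \<open>z\<^sub>1\<close> and \<open>z\<^sub>2\<close>. The products \<open>W\<^sub>1 W\<^sub>2\<close> and \<open>W\<^sub>2 W\<^sub>1\<close>
  differ only in the newest block, which is \<open>(z\<^sub>2 h, h)\<close> or \<open>(h, z\<^sub>1 h)\<close>. A unitary \<open>U\<close> exchanging
  these makes \<open>V\<^sub>1 = U W\<^sub>1\<close> and \<open>V\<^sub>2 = W\<^sub>2 U\<^sup>-\<^sup>1\<close> commute. Only the finitely many
  \<open>h = z\<^sub>1\<^sup>a z\<^sub>2\<^sup>b f\<close> with \<open>a, b \<le> N\<close> are matched, up to null vectors, which avoids completeness
  and functional calculus.
\<close>

lemma isometric_dilation:
  fixes z1 z2 f :: 'a and N :: nat
  assumes z1: "\<And>f. nrm (z1 * f) \<le> nrm f" and z2: "\<And>f. nrm (z2 * f) \<le> nrm f"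
  obtains s :: "complex \<Rightarrow> 'a \<times> (nat \<Rightarrow> 'a \<times> 'a) \<Rightarrow> 'a \<times> (nat \<Rightarrow> 'a \<times> 'a)" and ipK e
  where "semi_inner s ipK" "\<And>x. (nrm (fst x))\<^sup>2 \<le> Re (ipK x x)"
    "\<And>c x. fst (s c x) = const c * fst x"
    "\<And>a b. fst (e a b) = z1 ^ a * (z2 ^ b * f)" "ipK (e 0 0) (e 0 0) = ip f f"
    "\<And>a b a' b' s t. a + s \<le> N \<Longrightarrow> b + t \<le> N \<Longrightarrow> a' + s \<le> N \<Longrightarrow> b' + t \<le> N \<Longrightarrow>
      ipK (e (a + s) (b + t)) (e (a' + s) (b' + t)) = ipK (e a b) (e a' b')"
proof -
  define sG :: "complex \<Rightarrow> 'a \<times> 'a \<Rightarrow> 'a \<times> 'a"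
    where "sG = (\<lambda>c x. (const c * fst x, const c * snd x))"
  define d1 where "d1 x y = ip x y - ip (z1 * x) (z1 * y)" for x y
  define d2 where "d2 x y = ip x y - ip (z2 * x) (z2 * y)" for x y
  define ipG where "ipG = (\<lambda>x y. d1 (fst x) (fst y) + d2 (snd x) (snd y))"
  have "semi_inner sG ipG"
    unfolding sG_def ipG_def d1_def d2_def by (rule semi_inner_prod[OF defect[OF z1] defect[OF z2]])
  then interpret G: semi_inner sG ipG .
  \<comment> \<open>The vectors shifted below occupy fewer than \<open>L\<close> blocks, so a shift
    never pushes a nonzero block out of the range that the form sees.\<close>
  define L where "L = 2 * N + 4"
  define sK :: "complex \<Rightarrow> 'a \<times> (nat \<Rightarrow> 'a \<times> 'a) \<Rightarrow> 'a \<times> (nat \<Rightarrow> 'a \<times> 'a)"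
    where "sK = (\<lambda>c x. (const c * fst x, \<lambda>n. sG c (snd x n)))"
  define ipK where "ipK = (\<lambda>x y. ip (fst x) (fst y) + (\<Sum>n<L. ipG (snd x n) (snd y n)))"
  have "semi_inner sK ipK"
    unfolding sK_def ipK_def by (rule semi_inner_prod[OF semi_inner semi_inner_fun[OF G.semi_inner_axioms]])
  then interpret K: semi_inner sK ipK .

  define h where "h a b = z1 ^ a * (z2 ^ b * f)" for a b
  \<comment> \<open>A pair of exponents up to \<open>N\<close> is coded in base
    \<open>Suc N\<close>, as \<open>householder\<close> takes a singly indexed family.\<close>
  define fam where "fam i = h (i div Suc N) (i mod Suc N)" for i
  define v where "v i = (z2 * fam i, fam i)" for i
  define w where "w i = (fam i, z1 * fam i)" for i
  \<comment> \<open>Both sides equal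
    \<open>ip (fam i) (fam j) - ip (z1 * z2 * fam i) (z1 * z2 * fam j)\<close>; the terms with a
    single factor cancel.\<close>
  have gram: "ipG (v i) (v j) = ipG (w i) (w j)" for i j
    by (simp add: v_def w_def ipG_def d1_def d2_def mult.left_commute[of z1 z2])
  obtain U U' where Uadd: "\<And>x y. U (x + y) = U x + U y" and Usc: "\<And>c x. U (sG c x) = sG c (U x)"
    and Uiso: "\<And>x y. ipG (U x) (U y) = ipG x y" and UU: "\<And>x. U' (U x) = x" "\<And>x. U (U' x) = x"
    and Ufam: "\<And>i. i < Suc N * Suc N \<Longrightarrow> G.nrm (U (v i) - w i) = 0"
    by (rule G.householder[of "Suc N * Suc N" v w, OF gram]) (rule that)
  have Uh: "G.nrm (U (z2 * h a b, h a b) - (h a b, z1 * h a b)) = 0" if "a \<le> N" "b \<le> N" for a b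
  proof -
    have "a * Suc N + b < Suc N * Suc N"
    proof -
      have "a * Suc N + b < a * Suc N + Suc N" using that by simp
      also have "\<dots> = Suc a * Suc N" by simp
      also have "\<dots> \<le> Suc N * Suc N" using that by (intro mult_le_mono1) simp
      finally show ?thesis .
    qed
    moreover have "fam (a * Suc N + b) = h a b"
      unfolding fam_def using that by (simp del: mult_Suc_right)
    ultimately show ?thesis using Ufam[of "a * Suc N + b"] by (simp add: v_def w_def)
  qed
  have U'add: "U' (x + y) = U' x + U' y" for x y
    by (metis UU Uadd)
  have Udiff: "U (x - y) = U x - U y" for x y
    using Uadd[of "x - y" y] by (simp add: algebra_simps)
  have U'diff: "U' (x - y) = U' x - U' y" for x y
    using U'add[of "x - y" y] by (simp add: algebra_simps)
  have U0: "U 0 = 0" "U' 0 = 0"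
    using Udiff[of 0 0] U'diff[of 0 0] by simp_all
  have U'iso: "ipG (U' x) (U' y) = ipG x y" for x y
    by (metis UU(2) Uiso)

  \<comment> \<open>\<open>fst x\<close> enters block 0, where the defect form restores exactly the
    norm that multiplication by \<open>z1\<close> loses.\<close>
  define V1 :: "'a \<times> (nat \<Rightarrow> 'a \<times> 'a) \<Rightarrow> 'a \<times> (nat \<Rightarrow> 'a \<times> 'a)" where
    "V1 x = (z1 * fst x, \<lambda>n. U (case n of 0 \<Rightarrow> fst x | Suc m \<Rightarrow> fst (snd x m), snd (snd x n)))" for x
  define V2 :: "'a \<times> (nat \<Rightarrow> 'a \<times> 'a) \<Rightarrow> 'a \<times> (nat \<Rightarrow> 'a \<times> 'a)" where
    "V2 x = (z2 * fst x, \<lambda>n. (fst (U' (snd x n)), case n of 0 \<Rightarrow> fst x | Suc m \<Rightarrow> snd (U' (snd x m))))" for x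
  have V1diff: "V1 (x - y) = V1 x - V1 y" for x y
  proof -
    have "snd (V1 (x - y)) n = snd (V1 x - V1 y) n" for n
      by (cases n) (simp_all add: V1_def Udiff[symmetric])
    moreover have "fst (V1 (x - y)) = fst (V1 x - V1 y)"
      by (simp add: V1_def right_diff_distrib)
    ultimately show ?thesis by (simp add: prod_eq_iff fun_eq_iff)
  qed
  have V2diff: "V2 (x - y) = V2 x - V2 y" for x y
    by (auto simp: V2_def fun_eq_iff U'diff algebra_simps split: nat.split)
  \<comment> \<open>Bounds the occupied blocks; each application of \<open>V1\<close> or
    \<open>V2\<close> raises the bound by one.\<close>
  define sup where "sup x m \<longleftrightarrow> (\<forall>n\<ge>m. snd x n = (0 :: 'a \<times> 'a))" for x :: "'a \<times> (nat \<Rightarrow> 'a \<times> 'a)" and m :: nat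
  have sup_V: "sup (V1 x) (Suc m)" "sup (V2 x) (Suc m)" if "sup x m" for x m
    using that by (auto simp: sup_def V1_def V2_def U0 zero_prod_def[symmetric] split: nat.split)
  have sup_diff: "sup (x - y) m" if "sup x m" "sup y m" for x y m
    using that by (simp add: sup_def)
  have sup_mono: "sup x m" if "sup x n" "n \<le> m" for x m n
    using that by (simp add: sup_def)
  have iso: "ipK (V1 x) (V1 y) = ipK x y" "ipK (V2 x) (V2 y) = ipK x y"
    if x: "sup x m" "sup y m" "m < L" for x y m
  proof -
    obtain L' where L': "L = Suc L'" using L_def by (cases L) auto
    have 0: "snd x L' = 0" "snd y L' = 0" using x L' by (auto simp: sup_def)
    define dx where "dx n = (case n of 0 \<Rightarrow> fst x | Suc m \<Rightarrow> fst (snd x m))" for n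
    define dy where "dy n = (case n of 0 \<Rightarrow> fst y | Suc m \<Rightarrow> fst (snd y m))" for n
    have "ipK (V1 x) (V1 y) = ip (z1 * fst x) (z1 * fst y)
        + ((\<Sum>n<L. d1 (dx n) (dy n)) + (\<Sum>n<L. d2 (snd (snd x n)) (snd (snd y n))))"
      unfolding ipK_def V1_def fst_conv snd_conv Uiso dx_def[symmetric] dy_def[symmetric]
      by (simp add: ipG_def sum.distrib)
    also have "(\<Sum>n<L. d1 (dx n) (dy n)) = d1 (fst x) (fst y) + (\<Sum>n<L. d1 (fst (snd x n)) (fst (snd y n)))"
      using 0 by (subst (1) L', subst sum.lessThan_Suc_shift) (simp add: L' dx_def dy_def d1_def)
    also have "ip (z1 * fst x) (z1 * fst y) + (\<dots> + (\<Sum>n<L. d2 (snd (snd x n)) (snd (snd y n)))) = ipK x y"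
      by (simp add: ipK_def ipG_def sum.distrib d1_def)
    finally show "ipK (V1 x) (V1 y) = ipK x y" .
    define dx where "dx n = (case n of 0 \<Rightarrow> fst x | Suc m \<Rightarrow> snd (U' (snd x m)))" for n
    define dy where "dy n = (case n of 0 \<Rightarrow> fst y | Suc m \<Rightarrow> snd (U' (snd y m)))" for n
    have "ipK (V2 x) (V2 y) = ip (z2 * fst x) (z2 * fst y)
        + ((\<Sum>n<L. d1 (fst (U' (snd x n))) (fst (U' (snd y n)))) + (\<Sum>n<L. d2 (dx n) (dy n)))"
      unfolding ipK_def V2_def fst_conv snd_conv dx_def[symmetric] dy_def[symmetric]
      by (simp add: ipG_def sum.distrib)
    also have "(\<Sum>n<L. d2 (dx n) (dy n)) = d2 (fst x) (fst y) + (\<Sum>n<L. d2 (snd (U' (snd x n))) (snd (U' (snd y n))))"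
      using 0 by (subst (1) L', subst sum.lessThan_Suc_shift) (simp add: L' dx_def dy_def d2_def U0)
    also have "ip (z2 * fst x) (z2 * fst y) + ((\<Sum>n<L. d1 (fst (U' (snd x n))) (fst (U' (snd y n)))) + \<dots>)
        = ip (fst x) (fst y) + (\<Sum>n<L. ipG (U' (snd x n)) (U' (snd y n)))"
      by (simp add: ipG_def sum.distrib d2_def)
    also have "\<dots> = ipK x y" by (simp add: ipK_def U'iso)
    finally show "ipK (V2 x) (V2 y) = ipK x y" .
  qed
  have nrm_iso: "K.nrm (V1 x - V1 y) = K.nrm (x - y)" if "sup x m" "sup y m" "m < L" for x y m
    unfolding V1diff[symmetric] K.nrm_def iso(1)[OF sup_diff[OF that(1,2)] sup_diff[OF that(1,2)] that(3)] ..
  \<comment> \<open>After cancelling \<open>U\<close> against \<open>U'\<close>, both products move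
    block \<open>n\<close> of \<open>x\<close> to block \<open>n + 1\<close>; they differ only in
    block 0, by a vector assumed null.\<close>
  have comm: "K.nrm (V2 (V1 x) - V1 (V2 x)) = 0"
    if "G.nrm (U (z2 * fst x, fst x) - (fst x, z1 * fst x)) = 0" for x
  proof -
    define D where "D = (fst x, z1 * fst x) - U (z2 * fst x, fst x)"
    have "snd (V2 (V1 x)) n - snd (V1 (V2 x)) n = (if n = 0 then D else 0)" for n
      by (cases n) (simp_all add: V1_def V2_def UU D_def)
    moreover have "fst (V2 (V1 x)) - fst (V1 (V2 x)) = 0"
      by (simp add: V1_def V2_def mult.left_commute)
    ultimately have "ipK (V2 (V1 x) - V1 (V2 x)) (V2 (V1 x) - V1 (V2 x))
        = (\<Sum>n<L. ipG (if n = 0 then D else 0) (if n = 0 then D else 0))"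
      by (simp add: ipK_def cong: if_cong del: sum.delta sum.delta')
    also have "\<dots> = (\<Sum>n<L. if n = 0 then ipG D D else 0)"
      by (intro sum.cong) auto
    also have "\<dots> = ipG D D" by (simp add: L_def)
    also have "\<dots> = 0"
    proof -
      have "G.nrm D = 0"
        unfolding D_def using that by (metis G.nrm_uminus minus_diff_eq)
      then show ?thesis by (simp add: G.ip_self)
    qed
    finally show ?thesis by (simp add: K.nrm_def)
  qed

  define e where "e a b = (V1 ^^ a) ((V2 ^^ b) (f, \<lambda>_. 0))" for a b
  have e_Suc: "e (Suc a) b = V1 (e a b)" for a b by (simp add: e_def)
  have fst_V2: "fst ((V2 ^^ b) (f, \<lambda>_. 0)) = z2 ^ b * f" for b
    by (induction b) (simp_all add: V2_def mult.assoc)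
  have fst_e: "fst (e a b) = h a b" for a b
    by (induction a) (simp_all add: e_def fst_V2 V1_def h_def mult.assoc)
  have sup_V2: "sup ((V2 ^^ b) (f, \<lambda>_. 0)) b" for b
    by (induction b) (simp_all add: sup_V sup_def[of "(f, \<lambda>_. 0)"])
  have sup_e: "sup (e a b) (a + b)" for a b
    by (induction a) (simp_all add: e_def sup_V2 sup_V)
  \<comment> \<open>\<open>V2\<close> is moved past one factor \<open>V1\<close> at a time. Each
    move costs a null vector, because the first component \<open>h a b\<close> of
    \<open>e a b\<close> belongs to the matched family.\<close>
  have V2e: "K.nrm (V2 (e a b) - e a (Suc b)) = 0" if "a \<le> N" "b \<le> N" for a b
    using that(1)
  proof (induction a)
    case 0
    then show ?case by (simp add: e_def)
  next
    case (Suc a)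
    have "K.nrm (V2 (V1 (e a b)) - V1 (V2 (e a b))) = 0"
      using Uh[of a b] Suc that by (intro comm) (simp add: fst_e)
    moreover have "K.nrm (V1 (V2 (e a b)) - V1 (e a (Suc b))) = K.nrm (V2 (e a b) - e a (Suc b))"
      using Suc that sup_V(2)[OF sup_e[of a b]] sup_e[of a "Suc b"]
      by (intro nrm_iso[where m = "Suc (a + b)"]) (auto simp: L_def)
    ultimately show ?case
      unfolding e_Suc using Suc by (metis K.nrm_eq_0_trans Suc_leD)
  qed
  have step1: "ipK (e (Suc a) b) (e (Suc a') b') = ipK (e a b) (e a' b')"
    if "a \<le> N" "b \<le> N" "a' \<le> N" "b' \<le> N" for a b a' b'
    unfolding e_Suc using that
    by (intro iso(1)[where m = "2 * N + 1"] sup_mono[OF sup_e]) (auto simp: L_def)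
  have step2: "ipK (e a (Suc b)) (e a' (Suc b')) = ipK (e a b) (e a' b')"
    if "a \<le> N" "b \<le> N" "a' \<le> N" "b' \<le> N" for a b a' b'
  proof -
    have "ipK (e a (Suc b)) (e a' (Suc b')) = ipK (V2 (e a b)) (V2 (e a' b'))"
      using V2e that by (intro K.ip_cong[symmetric]) auto
    also have "\<dots> = ipK (e a b) (e a' b')"
      using that by (intro iso(2)[where m = "2 * N + 1"] sup_mono[OF sup_e]) (auto simp: L_def)
    finally show ?thesis .
  qed
  have toep1: "ipK (e (a + s) b) (e (a' + s) b') = ipK (e a b) (e a' b')"
    if "a + s \<le> N" "b \<le> N" "a' + s \<le> N" "b' \<le> N" for a b a' b' s
    using that by (induction s) (simp_all add: step1)
  have toep2: "ipK (e a (b + t)) (e a' (b' + t)) = ipK (e a b) (e a' b')"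
    if "a \<le> N" "b + t \<le> N" "a' \<le> N" "b' + t \<le> N" for a b a' b' t
    using that by (induction t) (simp_all add: step2)
  show ?thesis
  proof (rule that[of sK ipK e])
    show "semi_inner sK ipK" by (rule K.semi_inner_axioms)
    show "(nrm (fst x))\<^sup>2 \<le> Re (ipK x x)" for x
    proof -
      have "0 \<le> Re (\<Sum>n<L. ipG (snd x n) (snd x n))"
        unfolding Re_sum by (intro sum_nonneg G.ip_ge_0)
      then show ?thesis by (simp add: ipK_def ip_self)
    qed
    show "fst (sK c x) = const c * fst x" for c x by (simp add: sK_def)
    show "fst (e a b) = z1 ^ a * (z2 ^ b * f)" for a b by (simp add: fst_e h_def)
    show "ipK (e 0 0) (e 0 0) = ip f f" by (simp add: e_def ipK_def)
    show "ipK (e (a + s) (b + t)) (e (a' + s) (b' + t)) = ipK (e a b) (e a' b')"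
      if "a + s \<le> N" "b + t \<le> N" "a' + s \<le> N" "b' + t \<le> N" for a b a' b' s t
      using that by (simp add: toep1 toep2)
  qed
qed

text \<open>The dilation commutes only along finitely many powers and up to null vectors, so the
  spectral theorem is replaced by averaging: Parseval compares a box of side \<open>R + 1\<close>
  with one of side \<open>R + D + 1\<close>, and the ratio of the sides tends to 1.\<close>

lemma ando:
  fixes al be :: "'i \<Rightarrow> nat" and c :: "'i \<Rightarrow> complex"
  assumes fin: "finite A" and z1: "\<And>f. nrm (z1 * f) \<le> nrm f" and z2: "\<And>f. nrm (z2 * f) \<le> nrm f"
    and "0 \<le> B" and B: "\<And>u w. cmod u = 1 \<Longrightarrow> cmod w = 1 \<Longrightarrow> cmod (\<Sum>i\<in>A. c i * (u ^ al i * w ^ be i)) \<le> B"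
  shows "nrm (\<Sum>i\<in>A. const (c i) * (z1 ^ al i * (z2 ^ be i * f))) \<le> B * nrm f"
proof -
  define D where "D = (\<Sum>i\<in>A. al i) + (\<Sum>i\<in>A. be i)"
  have D: "al i \<le> D" "be i \<le> D" if "i \<in> A" for i
    using member_le_sum[OF that, of al] member_le_sum[OF that, of be] fin by (auto simp: D_def)
  define X where "X = nrm (\<Sum>i\<in>A. const (c i) * (z1 ^ al i * (z2 ^ be i * f)))"
  \<comment> \<open>Convolve \<open>q\<close> with the orbit of \<open>f\<close> over a box of side \<open>R + D + 1\<close>: by the Toeplitz property all
    coefficients of the convolution in an inner box of side \<open>R + 1\<close> have the norm of \<open>q(V) f\<close>.\<close>
  have key: "real (Suc R) * X \<le> real (Suc (R + D)) * (B * nrm f)" for R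
  proof -
    define N where "N = R + D"
    \<comment> \<open>Exponents up to \<open>N\<close> convolved with exponents up to
      \<open>D\<close> stay below \<open>M\<close>, so there is no aliasing.\<close>
    define M where "M = Suc (N + D)"
    have M: "M > 0" by (simp add: M_def)
    show ?thesis
    proof (rule isometric_dilation[OF z1 z2, where N = "N + D" and f = f])
      fix s :: "complex \<Rightarrow> 'a \<times> (nat \<Rightarrow> 'a \<times> 'a) \<Rightarrow> 'a \<times> (nat \<Rightarrow> 'a \<times> 'a)" and ipK e
      assume K: "semi_inner s ipK" and le: "\<And>x. (nrm (fst x))\<^sup>2 \<le> Re (ipK x x)"
        and fst_s: "\<And>c x. fst (s c x) = const c * fst x"
        and fst_e: "\<And>a b. fst (e a b) = z1 ^ a * (z2 ^ b * f)" and e00: "ipK (e 0 0) (e 0 0) = ip f f"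
        and toep: "\<And>a b a' b' s t. a + s \<le> N + D \<Longrightarrow> b + t \<le> N + D \<Longrightarrow> a' + s \<le> N + D \<Longrightarrow> b' + t \<le> N + D \<Longrightarrow>
          ipK (e (a + s) (b + t)) (e (a' + s) (b' + t)) = ipK (e a b) (e a' b')"
      interpret K: semi_inner s ipK by (rule K)
      define q where "q = (\<Sum>i\<in>A. s (c i) (e (al i) (be i)))"
      have Xq: "X \<le> K.nrm q"
      proof (rule power2_le_imp_le)
        have "fst q = (\<Sum>i\<in>A. const (c i) * (z1 ^ al i * (z2 ^ be i * f)))"
          by (simp add: q_def fst_sum fst_s fst_e)
        then show "X\<^sup>2 \<le> (K.nrm q)\<^sup>2"
          using le[of q] by (simp add: X_def K.ip_self)
      qed simp
      \<comment> \<open>The orbit is listed in reverse, so that for \<open>m\<close> and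
        \<open>l\<close> in \<open>{D..N}\<close> the coefficient \<open>y m l\<close> contains all
        terms of \<open>q\<close>, shifted by the common exponents \<open>N - m\<close> and
        \<open>N - l\<close>.\<close>
      define x where "x m l = (if m \<le> N \<and> l \<le> N then e (N - m) (N - l) else 0)" for m l
      define y where "y m l = (\<Sum>i\<in>A. if al i \<le> m \<and> m \<le> N + al i then
          if be i \<le> l \<and> l \<le> N + be i then s (c i) (e (N + al i - m) (N + be i - l)) else 0 else 0)" for m l
      have shift: "(\<Sum>m<M. if k \<le> m \<and> m \<le> N + k then F m else 0) = (\<Sum>m\<le>N. F (k + m))"
        if "k \<le> D" for k and F :: "nat \<Rightarrow> 'a \<times> (nat \<Rightarrow> 'a \<times> 'a)"
      proof -
        have "(\<Sum>m<M. if k \<le> m \<and> m \<le> N + k then F m else 0) = (\<Sum>m\<in>{0+k..N+k}. F m)"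
          using that by (intro sum.mono_neutral_cong_right) (auto simp: M_def)
        also have "\<dots> = (\<Sum>m\<le>N. F (k + m))"
          unfolding sum.shift_bounds_cl_nat_ivl by (simp add: atLeast0AtMost add.commute)
        finally show ?thesis .
      qed
      \<comment> \<open>The transform of the convolution is the scalar value of the polynomial times
        the transform of \<open>x\<close>; through this value \<open>B\<close> enters.\<close>
      have conv: "(\<Sum>m<M. \<Sum>l<M. s (u ^ m * w ^ l) (y m l))
          = s (\<Sum>i\<in>A. c i * (u ^ al i * w ^ be i)) (\<Sum>m<M. \<Sum>l<M. s (u ^ m * w ^ l) (x m l))" for u w
      proof -
        have "(\<Sum>m<M. \<Sum>l<M. s (u ^ m * w ^ l) (y m l)) =
            (\<Sum>m<M. \<Sum>l<M. \<Sum>i\<in>A. if al i \<le> m \<and> m \<le> N + al i then if be i \<le> l \<and> l \<le> N + be i then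
              s (u ^ m * w ^ l * c i) (e (N + al i - m) (N + be i - l)) else 0 else 0)"
          unfolding y_def K.scale_sum_right by (intro sum.cong refl) simp
        also have "\<dots> = (\<Sum>m<M. \<Sum>i\<in>A. \<Sum>l<M. if al i \<le> m \<and> m \<le> N + al i then if be i \<le> l \<and> l \<le> N + be i then
              s (u ^ m * w ^ l * c i) (e (N + al i - m) (N + be i - l)) else 0 else 0)"
          by (intro sum.cong refl sum.swap)
        also have "\<dots> = (\<Sum>i\<in>A. \<Sum>m<M. \<Sum>l<M. if al i \<le> m \<and> m \<le> N + al i then if be i \<le> l \<and> l \<le> N + be i then
              s (u ^ m * w ^ l * c i) (e (N + al i - m) (N + be i - l)) else 0 else 0)"
          by (rule sum.swap)
        also have "\<dots> = (\<Sum>i\<in>A. \<Sum>m<M. if al i \<le> m \<and> m \<le> N + al i then \<Sum>l<M. if be i \<le> l \<and> l \<le> N + be i then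
              s (u ^ m * w ^ l * c i) (e (N + al i - m) (N + be i - l)) else 0 else 0)"
        proof (intro sum.cong refl, goal_cases)
          case (1 i m)
          then show ?case
            by (cases "al i \<le> m \<and> m \<le> N + al i") (simp_all only: simp_thms if_True if_False sum.neutral_const)
        qed
        also have "\<dots> = (\<Sum>i\<in>A. \<Sum>m\<le>N. \<Sum>l\<le>N. s (u ^ (al i + m) * w ^ (be i + l) * c i) (e (N - m) (N - l)))"
        proof (rule sum.cong[OF refl], goal_cases)
        case (1 i)
        show ?case
          by (rule trans[OF shift[OF D(1)[OF 1]] sum.cong[OF refl]], rule trans[OF shift[OF D(2)[OF 1]]]) simp
      qed
        also have "\<dots> = (\<Sum>i\<in>A. s (c i * (u ^ al i * w ^ be i)) (\<Sum>m\<le>N. \<Sum>l\<le>N. s (u ^ m * w ^ l) (e (N - m) (N - l))))"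
          unfolding K.scale_sum_right by (intro sum.cong refl) (simp add: power_add mult_ac)
        also have "(\<Sum>m\<le>N. \<Sum>l\<le>N. s (u ^ m * w ^ l) (e (N - m) (N - l))) = (\<Sum>m<M. \<Sum>l<M. s (u ^ m * w ^ l) (x m l))"
        proof -
          have 1: "(\<Sum>l\<le>N. s (u ^ m * w ^ l) (e (N - m) (N - l))) = (\<Sum>l<M. s (u ^ m * w ^ l) (x m l))" if "m \<le> N" for m
            using that by (intro sum.mono_neutral_cong_left) (auto simp: M_def x_def)
          have 2: "(\<Sum>l<M. s (u ^ m * w ^ l) (x m l)) = 0" if "\<not> m \<le> N" for m
            using that by (simp add: x_def)
          show ?thesis
            by (rule sum.mono_neutral_cong_left) (auto simp: 1 2, simp add: M_def)
        qed
        finally show ?thesis by (simp add: K.scale_sum_left)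
      qed
      define w where "w a = cis (2 * pi * real a / real M)" for a
      have w: "cmod (w a) = 1" for a by (simp add: w_def)
      have nq: "K.nrm (y m l) = K.nrm q" if "m \<in> {D..N}" "l \<in> {D..N}" for m l
      proof -
        have "al i \<le> m \<and> m \<le> N + al i" "be i \<le> l \<and> l \<le> N + be i"
          "N + al i - m = al i + (N - m)" "N + be i - l = be i + (N - l)" if "i \<in> A" for i
          using D[OF that] \<open>m \<in> {D..N}\<close> \<open>l \<in> {D..N}\<close> by auto
        then have "y m l = (\<Sum>i\<in>A. s (c i) (e (al i + (N - m)) (be i + (N - l))))"
          unfolding y_def by (intro sum.cong refl) simp
        then have "complex_of_real ((K.nrm (y m l))\<^sup>2) = (\<Sum>i\<in>A. \<Sum>j\<in>A. c i * cnj (c j)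
            * ipK (e (al i + (N - m)) (be i + (N - l))) (e (al j + (N - m)) (be j + (N - l))))"
          by (simp only: K.nrm_power2_sum)
        also have "\<dots> = (\<Sum>i\<in>A. \<Sum>j\<in>A. c i * cnj (c j) * ipK (e (al i) (be i)) (e (al j) (be j)))"
        proof (intro sum.cong refl, goal_cases)
          case (1 i j)
          then show ?case
            using D[of i] D[of j] that by (intro arg_cong2[where f = "(*)"] refl toep) auto
        qed
        also have "\<dots> = complex_of_real ((K.nrm q)\<^sup>2)"
          unfolding q_def by (simp only: K.nrm_power2_sum)
        finally show ?thesis
          using K.nrm_ge_0 by (simp only: of_real_eq_iff) simp
      qed
      have nx: "K.nrm (x m l) = (if m \<le> N \<and> l \<le> N then nrm f else 0)" for m l
      proof (cases "m \<le> N \<and> l \<le> N")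
        case True
        then have "ipK (x m l) (x m l) = ip f f"
          using toep[of 0 "N - m" 0 "N - l" 0 0] e00 by (simp add: x_def)
        then show ?thesis using True by (simp add: K.nrm_def nrm_def)
      next
        case False
        then have "x m l = 0" by (simp only: x_def if_False)
        then show ?thesis using False by auto
      qed
      have "(real M)\<^sup>2 * (real (Suc R) * K.nrm q)\<^sup>2 = (real M)\<^sup>2 * (\<Sum>m\<in>{D..N}. \<Sum>l\<in>{D..N}. (K.nrm (y m l))\<^sup>2)"
        by (simp add: nq N_def power_mult_distrib) (simp add: power2_eq_square)
      also have "\<dots> \<le> (real M)\<^sup>2 * (\<Sum>m<M. \<Sum>l<M. (K.nrm (y m l))\<^sup>2)"
        unfolding sum.cartesian_product by (intro mult_left_mono sum_mono2) (auto simp: M_def)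
      also have "\<dots> = (\<Sum>a<M. \<Sum>b<M. (K.nrm (\<Sum>m<M. \<Sum>l<M. s (w a ^ m * w b ^ l) (y m l)))\<^sup>2)"
        unfolding w_def by (rule K.parseval2[OF M, symmetric])
      also have "\<dots> \<le> (\<Sum>a<M. \<Sum>b<M. B\<^sup>2 * (K.nrm (\<Sum>m<M. \<Sum>l<M. s (w a ^ m * w b ^ l) (x m l)))\<^sup>2)"
        unfolding conv K.nrm_scale power_mult_distrib
        by (intro sum_mono mult_right_mono power_mono B w) auto
      also have "\<dots> = B\<^sup>2 * ((real M)\<^sup>2 * (\<Sum>m<M. \<Sum>l<M. (K.nrm (x m l))\<^sup>2))"
        unfolding sum_distrib_left[symmetric] w_def by (simp only: K.parseval2[OF M])
      also have "(\<Sum>m<M. \<Sum>l<M. (K.nrm (x m l))\<^sup>2) = (\<Sum>m\<le>N. \<Sum>l\<le>N. (nrm f)\<^sup>2)"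
      proof -
        have 1: "(\<Sum>l<M. (K.nrm (x m l))\<^sup>2) = (\<Sum>l\<le>N. (nrm f)\<^sup>2)" if "m \<le> N" for m
          using that by (intro sum.mono_neutral_cong_right) (auto simp: M_def nx)
        have 2: "(\<Sum>l<M. (K.nrm (x m l))\<^sup>2) = 0" if "\<not> m \<le> N" for m
          using that by (simp add: nx)
        show ?thesis
          by (rule sum.mono_neutral_cong_right) (auto simp: 1 2, simp add: M_def)
      qed
      also have "B\<^sup>2 * ((real M)\<^sup>2 * \<dots>) = (real M)\<^sup>2 * (real (Suc N) * (B * nrm f))\<^sup>2"
        by (simp add: power_mult_distrib power2_eq_square)
      finally have "(real (Suc R) * K.nrm q)\<^sup>2 \<le> (real (Suc N) * (B * nrm f))\<^sup>2"
        using M by (simp only: mult_le_cancel_left_pos zero_less_power of_nat_0_less_iff)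
      then have "real (Suc R) * K.nrm q \<le> real (Suc N) * (B * nrm f)"
        by (rule power2_le_imp_le) (use \<open>0 \<le> B\<close> in simp)
      moreover have "real (Suc R) * X \<le> real (Suc R) * K.nrm q"
        using Xq by (intro mult_left_mono) auto
      ultimately show ?thesis unfolding N_def by linarith
    qed
  qed
  have lim: "(\<lambda>R. B * nrm f + real D * (B * nrm f) / real (Suc R)) \<longlonglongrightarrow> B * nrm f + 0"
    by (intro tendsto_add tendsto_const LIMSEQ_Suc lim_const_over_n)
  have le: "X \<le> B * nrm f + real D * (B * nrm f) / real (Suc R)" for R
  proof -
    have "X \<le> real (Suc (R + D)) * (B * nrm f) / real (Suc R)"
      using key[of R] by (simp only: pos_le_divide_eq of_nat_0_less_iff zero_less_Suc mult.commute)
    also have "\<dots> = B * nrm f + real D * (B * nrm f) / real (Suc R)"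
      by (simp add: field_simps)
    finally show ?thesis .
  qed
  have "X \<le> B * nrm f + 0"
    using LIMSEQ_le_const[OF lim] le by blast
  then show ?thesis by (simp add: X_def)
qed

end

section \<open>Logarithmic bounds for tuples of contractions\<close>

text \<open>In the induction on the number of variables, the summand 1 comes from the value at the
  origin, and \<open>m + 3\<close> is the number of variables over which the radial derivative is
  summed.\<close>

primrec dilation_const :: "nat \<Rightarrow> real" where
  "dilation_const 0 = 1"
| "dilation_const (Suc m) = 1 + real (m + 3) * dilation_const m"

lemma dilation_const_ge_1: "1 \<le> dilation_const m"
  by (induction m) auto

text \<open>The added 1 keeps the value at least 1, so that its powers absorb terms free of
  logarithms.\<close>

definition log_gap :: "real \<Rightarrow> real" where "log_gap s = 1 - ln (1 - s)"

lemma log_gap_ge_1: "0 \<le> s \<Longrightarrow> s < 1 \<Longrightarrow> 1 \<le> log_gap s"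
  by (simp add: log_gap_def)

lemma log_gap_mono: "0 \<le> s \<Longrightarrow> s \<le> t \<Longrightarrow> t < 1 \<Longrightarrow> log_gap s \<le> log_gap t"
  by (simp add: log_gap_def)

text \<open>
  A polynomial in the variables of index in \<open>S\<close> is a family of coefficients over an index set \<open>A\<close>, the
  exponents being given by \<open>ex\<close>. Exponents need not be distinct on \<open>S\<close>: fixing the value of one
  variable removes it from \<open>S\<close> and changes the coefficients, but not \<open>A\<close> and \<open>ex\<close>.
\<close>

definition mdeg :: "('i \<Rightarrow> nat \<Rightarrow> nat) \<Rightarrow> nat set \<Rightarrow> 'i \<Rightarrow> nat" where
  "mdeg ex S \<alpha> = (\<Sum>j\<in>S. ex \<alpha> j)"

definition mval :: "('i \<Rightarrow> nat \<Rightarrow> nat) \<Rightarrow> nat set \<Rightarrow> (nat \<Rightarrow> complex) \<Rightarrow> 'i \<Rightarrow> complex" where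
  "mval ex S w \<alpha> = (\<Prod>j\<in>S. w j ^ ex \<alpha> j)"

text \<open>The closed polydisc is taken so that a unimodular scalar may be put in place of a
  variable.\<close>

definition bounded_by ::
    "'i set \<Rightarrow> ('i \<Rightarrow> nat \<Rightarrow> nat) \<Rightarrow> nat set \<Rightarrow> ('i \<Rightarrow> complex) \<Rightarrow> real \<Rightarrow> bool" where
  "bounded_by A ex S c B \<longleftrightarrow>
    (\<forall>w. (\<forall>j. cmod (w j) \<le> 1) \<longrightarrow> cmod (\<Sum>\<alpha>\<in>A. c \<alpha> * mval ex S w \<alpha>) \<le> B)"

lemma bounded_byD:
  "bounded_by A ex S c B \<Longrightarrow> (\<And>j. cmod (w j) \<le> 1) \<Longrightarrow> cmod (\<Sum>\<alpha>\<in>A. c \<alpha> * mval ex S w \<alpha>) \<le> B"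
  by (simp add: bounded_by_def)

lemma bounded_by_nonneg: "bounded_by A ex S c B \<Longrightarrow> 0 \<le> B"
  by (rule order.trans[OF norm_ge_zero bounded_byD[of A ex S c B "\<lambda>_. 0"]]) simp_all

lemma mval_scale: "mval ex S (\<lambda>j. s * w j) \<alpha> = s ^ mdeg ex S \<alpha> * mval ex S w \<alpha>"
  by (simp add: mval_def mdeg_def power_mult_distrib prod.distrib power_sum)

section \<open>Estimates for polynomials in a tuple of contractive multiplications\<close>

locale contractive_tuple = semi_inner_algebra +
  fixes Z :: "nat \<Rightarrow> 'a" and d :: nat
  assumes contractive: "i < d \<Longrightarrow> nrm (Z i * f) \<le> nrm f"
begin

definition mpow :: "('i \<Rightarrow> nat \<Rightarrow> nat) \<Rightarrow> nat set \<Rightarrow> 'i \<Rightarrow> 'a" where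
  "mpow ex S \<alpha> = (\<Prod>j\<in>S. Z j ^ ex \<alpha> j)"

context
  fixes A :: "'i set" and ex :: "'i \<Rightarrow> nat \<Rightarrow> nat"
  assumes fin: "finite A"
begin

text \<open>The degree is the sum of the exponents, so the radial derivative splits into one term
  for each variable, handled by \<open>bernstein\<close>. The power of \<open>v\<close> splits too:
  the part from variable \<open>i\<close> serves \<open>bernstein\<close>, the rest dilates the
  other variables as \<open>IH\<close> demands.\<close>

lemma radial_bound:
  assumes S: "finite S" "S \<subseteq> {..<d}" and v: "0 \<le> v" "v < 1" and Q: "0 \<le> Q"
    and IH: "\<And>i c f. i \<in> S \<Longrightarrow> bounded_by A ex (S - {i}) c B \<Longrightarrow>
      nrm (\<Sum>\<alpha>\<in>A. const (c \<alpha> * of_real v ^ mdeg ex (S - {i}) \<alpha>) * (mpow ex (S - {i}) \<alpha> * f)) \<le> Q * B * nrm f"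
    and B: "bounded_by A ex S c B"
  shows "nrm (\<Sum>\<alpha>\<in>A. const (c \<alpha> * (of_nat (mdeg ex S \<alpha>) * of_real v ^ mdeg ex S \<alpha>)) * (mpow ex S \<alpha> * f))
    \<le> real (card S) * (v / (1 - v\<^sup>2) * (Q * B) * nrm f)"
proof -
  have one: "nrm (\<Sum>\<alpha>\<in>A. const (c \<alpha> * (of_nat (ex \<alpha> i) * of_real v ^ mdeg ex S \<alpha>)) * (mpow ex S \<alpha> * f))
      \<le> v / (1 - v\<^sup>2) * (Q * B) * nrm f" if i: "i \<in> S" for i
  proof -
    let ?b = "\<lambda>\<alpha>. const (c \<alpha> * of_real v ^ mdeg ex (S - {i}) \<alpha>) * mpow ex (S - {i}) \<alpha>"
    have "nrm (\<Sum>\<alpha>\<in>A. const (of_nat (ex \<alpha> i) * of_real v ^ ex \<alpha> i) * (?b \<alpha> * (Z i ^ ex \<alpha> i * f)))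
        \<le> v / (1 - v\<^sup>2) * (Q * B) * nrm f"
    proof (rule bernstein[OF fin _ _ v])
      show "nrm (Z i * f) \<le> nrm f" for f using i S by (intro contractive) auto
      show "0 \<le> Q * B" using Q bounded_by_nonneg[OF B] by simp
      fix \<zeta> :: complex and f assume \<zeta>: "cmod \<zeta> = 1"
      have "bounded_by A ex (S - {i}) (\<lambda>\<alpha>. c \<alpha> * \<zeta> ^ ex \<alpha> i) B"
        unfolding bounded_by_def
      proof (intro allI impI)
        fix w :: "nat \<Rightarrow> complex" assume w: "\<forall>j. cmod (w j) \<le> 1"
        have "mval ex S (w(i := \<zeta>)) \<alpha> = \<zeta> ^ ex \<alpha> i * mval ex (S - {i}) w \<alpha>" for \<alpha>
          unfolding mval_def by (subst prod.remove[OF S(1) i]) (auto intro: prod.cong)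
        then have "(\<Sum>\<alpha>\<in>A. c \<alpha> * \<zeta> ^ ex \<alpha> i * mval ex (S - {i}) w \<alpha>) = (\<Sum>\<alpha>\<in>A. c \<alpha> * mval ex S (w(i := \<zeta>)) \<alpha>)"
          by (simp add: mult.assoc)
        also have "cmod \<dots> \<le> B"
          using B w \<zeta> unfolding bounded_by_def by simp
        finally show "cmod (\<Sum>\<alpha>\<in>A. c \<alpha> * \<zeta> ^ ex \<alpha> i * mval ex (S - {i}) w \<alpha>) \<le> B" .
      qed
      from IH[OF i this, of f]
      show "nrm (\<Sum>\<alpha>\<in>A. const (\<zeta> ^ ex \<alpha> i) * (?b \<alpha> * f)) \<le> Q * B * nrm f"
        by (simp only: const_mult mult_ac)
    qed
    moreover have "const (of_nat (ex \<alpha> i) * of_real v ^ ex \<alpha> i) * (?b \<alpha> * (Z i ^ ex \<alpha> i * f))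
        = const (c \<alpha> * (of_nat (ex \<alpha> i) * of_real v ^ mdeg ex S \<alpha>)) * (mpow ex S \<alpha> * f)" for \<alpha>
    proof -
      have "mdeg ex S \<alpha> = ex \<alpha> i + mdeg ex (S - {i}) \<alpha>" "mpow ex S \<alpha> = Z i ^ ex \<alpha> i * mpow ex (S - {i}) \<alpha>"
        unfolding mdeg_def mpow_def using S(1) i by (simp_all add: sum.remove prod.remove)
      then show ?thesis by (simp only: const_mult power_add mult_ac)
    qed
    ultimately show ?thesis by simp
  qed
  have "const (c \<alpha> * (of_nat (mdeg ex S \<alpha>) * of_real v ^ mdeg ex S \<alpha>)) * (mpow ex S \<alpha> * f)
      = (\<Sum>i\<in>S. const (c \<alpha> * (of_nat (ex \<alpha> i) * of_real v ^ mdeg ex S \<alpha>)) * (mpow ex S \<alpha> * f))" for \<alpha>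
    unfolding sum_distrib_right[symmetric] const_sum[symmetric] sum_distrib_left[symmetric]
    by (simp add: mdeg_def)
  then have "nrm (\<Sum>\<alpha>\<in>A. const (c \<alpha> * (of_nat (mdeg ex S \<alpha>) * of_real v ^ mdeg ex S \<alpha>)) * (mpow ex S \<alpha> * f))
      = nrm (\<Sum>i\<in>S. \<Sum>\<alpha>\<in>A. const (c \<alpha> * (of_nat (ex \<alpha> i) * of_real v ^ mdeg ex S \<alpha>)) * (mpow ex S \<alpha> * f))"
    by (subst sum.swap) simp
  also have "\<dots> \<le> (\<Sum>i\<in>S. v / (1 - v\<^sup>2) * (Q * B) * nrm f)"
    by (intro order.trans[OF nrm_sum] sum_mono one)
  finally show ?thesis by simp
qed

text \<open>Since \<open>0 ^ 0 = 1\<close>, dilation by zero keeps exactly the terms of degree zero,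
  and so does evaluation at the origin.\<close>

lemma sum_const_zero_power:
  "(\<Sum>\<alpha>\<in>A. const (c \<alpha> * 0 ^ mdeg ex S \<alpha>) * (mpow ex S \<alpha> * f)) = const (\<Sum>\<alpha>\<in>A. c \<alpha> * mval ex S (\<lambda>_. 0) \<alpha>) * f"
  if "finite S"
proof -
  have "const (c \<alpha> * 0 ^ mdeg ex S \<alpha>) * (mpow ex S \<alpha> * f) = const (c \<alpha> * mval ex S (\<lambda>_. 0) \<alpha>) * f" for \<alpha>
  proof (cases "mdeg ex S \<alpha> = 0")
    case True
    then have "\<forall>j\<in>S. ex \<alpha> j = 0" using that by (simp add: mdeg_def)
    then show ?thesis using True by (simp add: mpow_def mval_def)
  next
    case False
    then have "mval ex S (\<lambda>_. 0) \<alpha> = 0" using mval_scale[of ex S 0 "\<lambda>_. 0" \<alpha>] by (simp add: power_0_left)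
    then show ?thesis using False by (simp add: power_0_left)
  qed
  then show ?thesis by (simp add: const_sum sum_distrib_right)
qed

text \<open>Two variables are Ando's inequality. For one more, the derivative in the dilation
  parameter \<open>u\<close> is bounded by a constant over \<open>1 - u\<close>, and integrating it
  costs one logarithm.\<close>

lemma dilation_bound:
  assumes "finite S" "S \<subseteq> {..<d}" "card S = m + 2" "0 \<le> s" "s < 1" "bounded_by A ex S c B"
  shows "nrm (\<Sum>\<alpha>\<in>A. const (c \<alpha> * of_real s ^ mdeg ex S \<alpha>) * (mpow ex S \<alpha> * f))
    \<le> dilation_const m * log_gap s ^ m * B * nrm f"
  using assms
proof (induction m arbitrary: S c B s f)
  case (0 S c B s f)
  then obtain i j where ij: "S = {i, j}" "i \<noteq> j"
    by (metis add_0 card_2_iff)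
  have "nrm (\<Sum>\<alpha>\<in>A. const (c \<alpha> * of_real s ^ mdeg ex S \<alpha>) * (Z i ^ ex \<alpha> i * (Z j ^ ex \<alpha> j * f))) \<le> B * nrm f"
  proof (rule ando[OF fin])
    show "nrm (Z i * f) \<le> nrm f" "nrm (Z j * f) \<le> nrm f" for f
      using ij 0 by (auto intro: contractive)
    show "0 \<le> B" using 0 bounded_by_nonneg by blast
    fix u w :: complex assume uw: "cmod u = 1" "cmod w = 1"
    define x where "x = (\<lambda>_. 0)(i := of_real s * u, j := of_real s * w)"
    have "\<forall>j. cmod (x j) \<le> 1"
      using uw \<open>0 \<le> s\<close> \<open>s < 1\<close> by (simp add: x_def norm_mult)
    then have "cmod (\<Sum>\<alpha>\<in>A. c \<alpha> * mval ex S x \<alpha>) \<le> B"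
      using \<open>bounded_by A ex S c B\<close> unfolding bounded_by_def by blast
    moreover have "mval ex S x \<alpha> = of_real s ^ mdeg ex S \<alpha> * (u ^ ex \<alpha> i * w ^ ex \<alpha> j)" for \<alpha>
      using ij by (simp add: mval_def mdeg_def x_def power_mult_distrib power_add)
    ultimately show "cmod (\<Sum>\<alpha>\<in>A. c \<alpha> * of_real s ^ mdeg ex S \<alpha> * (u ^ ex \<alpha> i * w ^ ex \<alpha> j)) \<le> B"
      by (simp add: mult.assoc)
  qed
  moreover have "mpow ex S \<alpha> * f = Z i ^ ex \<alpha> i * (Z j ^ ex \<alpha> j * f)" for \<alpha>
    using ij by (simp add: mpow_def mult.assoc)
  ultimately show ?case by simp
next
  case (Suc m S c B s f)
  note s = \<open>0 \<le> s\<close> \<open>s < 1\<close> and S = \<open>finite S\<close> \<open>S \<subseteq> {..<d}\<close>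
  have B0: "0 \<le> B" using Suc.prems bounded_by_nonneg by blast
  define x where "x u = (\<Sum>\<alpha>\<in>A. const (c \<alpha> * of_real u ^ mdeg ex S \<alpha>) * (mpow ex S \<alpha> * f))" for u :: real
  \<comment> \<open>Pairing with the increment itself reduces to the scalar function
    \<open>E\<close>: its increment is the square of \<open>nrm h\<close>, and one factor
    \<open>nrm h\<close> cancels at the end.\<close>
  define h where "h = x s - x 0"
  define E where "E u = (\<Sum>\<alpha>\<in>A. c \<alpha> * ip (mpow ex S \<alpha> * f) h * of_real u ^ mdeg ex S \<alpha>)" for u :: real
  have E: "ip (x u) h = E u" for u
    unfolding x_def E_def ip_sum_left ip_scale_left by (simp only: mult_ac)
  define K where "K = real (m + 3) * dilation_const m * log_gap s ^ m * B * nrm f"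
  have K0: "0 \<le> K"
    using dilation_const_ge_1[of m] log_gap_ge_1[OF s] B0 by (simp add: K_def)
  have hK: "nrm h \<le> K * (log_gap s - 1)"
  proof (cases "s = 0")
    case True
    then show ?thesis by (simp add: h_def log_gap_def)
  next
    case False
    have "norm (E s - E 0) \<le> - (K * nrm h * ln (1 - s)) - - (K * nrm h * ln (1 - 0))"
    proof (rule differentiable_bound_general)
      show "0 < s" using s False by simp
      show "continuous_on {0..s} E" unfolding E_def by (intro continuous_intros)
      show "continuous_on {0..s} (\<lambda>u. - (K * nrm h * ln (1 - u)))"
        using s by (intro continuous_intros) auto
      fix u assume u: "0 < u" "u < s"
      show "((\<lambda>u. - (K * nrm h * ln (1 - u))) has_vector_derivative K * nrm h / (1 - u)) (at u)"
        unfolding has_real_derivative_iff_has_vector_derivative[symmetric]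
        using u s by (auto intro!: derivative_eq_intros simp: field_simps)
      let ?y = "\<Sum>\<alpha>\<in>A. const (c \<alpha> * (of_nat (mdeg ex S \<alpha>) * of_real u ^ mdeg ex S \<alpha>)) * (mpow ex S \<alpha> * f)"
      show "(E has_vector_derivative ip ?y h / of_real u) (at u)"
      proof -
        have 1: "((\<lambda>u. of_real u ^ k :: complex) has_vector_derivative of_nat k * of_real u ^ k / of_real u) (at u)" for k
        proof (cases k)
          case (Suc n)
          have "((\<lambda>u. of_real (u ^ k) :: complex) has_vector_derivative of_real (real k * u ^ (k - 1))) (at u)"
            by (intro has_vector_derivative_of_real) (auto intro!: derivative_eq_intros)
          then show ?thesis using u Suc by simp
        qed simp
        have "(E has_vector_derivative (\<Sum>\<alpha>\<in>A. c \<alpha> * ip (mpow ex S \<alpha> * f) h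
            * (of_nat (mdeg ex S \<alpha>) * of_real u ^ mdeg ex S \<alpha> / of_real u))) (at u)"
          unfolding E_def by (intro has_vector_derivative_sum has_vector_derivative_mult_right 1)
        also have "(\<Sum>\<alpha>\<in>A. c \<alpha> * ip (mpow ex S \<alpha> * f) h * (of_nat (mdeg ex S \<alpha>) * of_real u ^ mdeg ex S \<alpha> / of_real u))
            = ip ?y h / of_real u"
          unfolding ip_sum_left ip_scale_left sum_divide_distrib by (simp add: mult.assoc mult.left_commute mult.commute[of "ip _ _"])
        finally show ?thesis .
      qed
      have "nrm ?y \<le> real (card S) * (u / (1 - u\<^sup>2) * (dilation_const m * log_gap u ^ m * B) * nrm f)"
      proof (rule radial_bound[OF S])
        show "0 \<le> dilation_const m * log_gap u ^ m"
          using dilation_const_ge_1[of m] log_gap_ge_1[of u] u s by simp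
        fix i c f assume "i \<in> S" "bounded_by A ex (S - {i}) c B"
        then show "nrm (\<Sum>\<alpha>\<in>A. const (c \<alpha> * of_real u ^ mdeg ex (S - {i}) \<alpha>) * (mpow ex (S - {i}) \<alpha> * f))
            \<le> dilation_const m * log_gap u ^ m * B * nrm f"
          using Suc.prems u by (intro Suc.IH) auto
      qed (use u s Suc.prems in auto)
      also have "\<dots> = u / (1 - u\<^sup>2) * (real (m + 3) * dilation_const m * log_gap u ^ m * B * nrm f)"
        using Suc.prems by (simp add: mult_ac)
      \<comment> \<open>The factor \<open>u\<close> is kept because the derivative of
        \<open>E\<close> is \<open>ip ?y h\<close> divided by \<open>u\<close>.\<close>
      also have "\<dots> \<le> u / (1 - u) * K"
      proof (rule mult_mono)
        have "u\<^sup>2 \<le> u" using u s by (simp add: power2_eq_square mult_left_le)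
        then show "u / (1 - u\<^sup>2) \<le> u / (1 - u)"
          using u s by (intro divide_left_mono mult_pos_pos) auto
        show "real (m + 3) * dilation_const m * log_gap u ^ m * B * nrm f \<le> K"
          unfolding K_def using u s B0 dilation_const_ge_1[of m] log_gap_ge_1[of u] log_gap_mono[of u s]
          by (intro mult_right_mono mult_left_mono power_mono) auto
        show "0 \<le> real (m + 3) * dilation_const m * log_gap u ^ m * B * nrm f"
          using B0 dilation_const_ge_1[of m] log_gap_ge_1[of u] u s by simp
      qed (use u s in auto)
      finally have y: "nrm ?y \<le> u / (1 - u) * K" .
      have "norm (ip ?y h / of_real u) \<le> nrm ?y * nrm h / u"
        using cauchy_schwarz[of ?y h] u by (simp add: norm_divide divide_right_mono)
      also have "\<dots> \<le> (u / (1 - u) * K) * nrm h / u"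
        using y u by (intro divide_right_mono mult_right_mono) auto
      also have "\<dots> = K * nrm h / (1 - u)" using u by simp
      finally show "norm (ip ?y h / of_real u) \<le> K * nrm h / (1 - u)" .
    qed
    moreover have "E s - E 0 = of_real ((nrm h)\<^sup>2)"
      unfolding E[symmetric] ip_diff_left[symmetric] h_def[symmetric] by (rule ip_self)
    ultimately have h2: "(nrm h)\<^sup>2 \<le> K * nrm h * (log_gap s - 1)"
      by (simp add: log_gap_def norm_power del: of_real_power)
    show ?thesis
    proof (cases "nrm h = 0")
      case True
      then show ?thesis using K0 log_gap_ge_1[OF s] by simp
    next
      case False
      then have "0 < nrm h" using nrm_ge_0[of h] by linarith
      moreover from h2 have "nrm h * nrm h \<le> K * (log_gap s - 1) * nrm h"
        by (simp add: power2_eq_square mult.assoc mult.commute[of "nrm h" "log_gap s - 1"])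
      ultimately show ?thesis by (rule mult_right_le_imp_le[rotated])
    qed
  qed
  have x0: "nrm (x 0) \<le> B * nrm f"
  proof -
    have "x 0 = const (\<Sum>\<alpha>\<in>A. c \<alpha> * mval ex S (\<lambda>_. 0) \<alpha>) * f"
      unfolding x_def using sum_const_zero_power[OF S(1), of c f] by simp
    moreover have "cmod (\<Sum>\<alpha>\<in>A. c \<alpha> * mval ex S (\<lambda>_. 0) \<alpha>) \<le> B"
      using \<open>bounded_by A ex S c B\<close> unfolding bounded_by_def by simp
    ultimately show ?thesis by (simp add: nrm_scale mult_right_mono)
  qed
  let ?l = "log_gap s"
  have l: "1 \<le> ?l" by (rule log_gap_ge_1[OF s])
  have "nrm (x s) \<le> nrm (x 0) + nrm h"
    using nrm_triangle[of "x 0" h] by (simp add: h_def)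
  also have "\<dots> \<le> B * nrm f + K * (?l - 1)" using x0 hK by simp
  also have "\<dots> \<le> ?l ^ Suc m * (B * nrm f) + K * ?l"
  proof (rule add_mono)
    show "B * nrm f \<le> ?l ^ Suc m * (B * nrm f)"
      using mult_right_mono[OF one_le_power[OF l, of "Suc m"], of "B * nrm f"] B0 by simp
    show "K * (?l - 1) \<le> K * ?l" using K0 by (intro mult_left_mono) auto
  qed
  also have "\<dots> = dilation_const (Suc m) * ?l ^ Suc m * B * nrm f"
    by (simp add: K_def algebra_simps)
  finally show ?case by (simp add: x_def)
qed

text \<open>In \<open>C\<close>, a factor \<open>d\<^sup>2\<close> comes from the integral
  representation, one more \<open>d\<close> from the sum over the variables,
  \<open>dilation_const (d - 3)\<close> from the \<open>d - 1\<close> variables left after fixing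
  one, and \<open>2 ^ (d - 3)\<close> from replacing \<open>log_gap\<close> by the plain
  logarithm.\<close>

lemma besov_bound:
  fixes c :: "'i \<Rightarrow> complex" and M :: "real \<Rightarrow> real" and g :: "real \<Rightarrow> ennreal"
  defines "S \<equiv> {..<d}" and "C \<equiv> real d ^ 3 * dilation_const (d - 3) * 2 ^ (d - 3)"
  assumes d: "3 \<le> d" and f: "nrm f \<le> 1"
    and M: "\<And>r. 0 < r \<Longrightarrow> r < 1 \<Longrightarrow>
      bounded_by A ex S (\<lambda>\<alpha>. c \<alpha> * (of_nat (mdeg ex S \<alpha>) * of_real r ^ mdeg ex S \<alpha>)) (M r)"
    and g: "\<And>r. 0 < r \<Longrightarrow> r < 1 \<Longrightarrow> ennreal (M r * ln (1 / (1 - r)) ^ (d - 3)) \<le> g r"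
  shows "ennreal (nrm (\<Sum>\<alpha>\<in>A. const (c \<alpha>) * (mpow ex S \<alpha> * f)))
    \<le> ennreal (1 + C) * (ennreal (cmod (\<Sum>\<alpha>\<in>A. c \<alpha> * mval ex S (\<lambda>_. 0) \<alpha>)) + (\<integral>\<^sup>+r\<in>{0..1}. g r \<partial>lborel))"
proof -
  \<comment> \<open>Constant terms are removed because dilation leaves them unchanged and they would
    keep \<open>E\<close> from vanishing at 0.\<close>
  define c' where "c' \<alpha> = (if mdeg ex S \<alpha> = 0 then 0 else c \<alpha>)" for \<alpha>
  define y where "y = (\<Sum>\<alpha>\<in>A. const (c' \<alpha>) * (mpow ex S \<alpha> * f))"
  define P0 where "P0 = (\<Sum>\<alpha>\<in>A. c \<alpha> * mval ex S (\<lambda>_. 0) \<alpha>)"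
  define I where "I = (\<integral>\<^sup>+r\<in>{0..1}. g r \<partial>lborel)"
  have S: "finite S" "S \<subseteq> {..<d}" by (simp_all add: S_def)
  have C0: "0 \<le> C" using dilation_const_ge_1[of "d - 3"] by (simp add: C_def)
  have "(\<Sum>\<alpha>\<in>A. const (c \<alpha>) * (mpow ex S \<alpha> * f)) = (\<Sum>\<alpha>\<in>A. const (c \<alpha> * 0 ^ mdeg ex S \<alpha>) * (mpow ex S \<alpha> * f)) + y"
    unfolding y_def sum.distrib[symmetric] by (intro sum.cong refl) (simp add: c'_def power_0_left)
  then have split: "(\<Sum>\<alpha>\<in>A. const (c \<alpha>) * (mpow ex S \<alpha> * f)) = const P0 * f + y"
    unfolding sum_const_zero_power[OF S(1)] P0_def .
  have sum_le: "nrm (\<Sum>\<alpha>\<in>A. const (c \<alpha>) * (mpow ex S \<alpha> * f)) \<le> cmod P0 + nrm y"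
    unfolding split using nrm_triangle[of "const P0 * f" y] mult_left_mono[OF f, of "cmod P0"]
    by (simp add: nrm_scale)
  have y_le: "ennreal (nrm y) \<le> ennreal C * I"
  proof (cases "nrm y = 0 \<or> I = \<infinity>")
    case True
    have "0 < C" using dilation_const_ge_1[of "d - 3"] d by (simp add: C_def)
    then show ?thesis using True by (auto simp: ennreal_mult_top infinity_ennreal_def)
  next
    case False
    then have y0: "0 < nrm y" using nrm_ge_0[of y] by linarith
    obtain J where J: "I = ennreal J" "0 \<le> J" using False by (cases I) auto
    \<comment> \<open>\<open>t\<^sup>k (1 - k log t)\<close>, whose derivative in \<open>t\<close> is \<open>k\<^sup>2 t\<^sup>k\<^sup>-\<^sup>1 log (1 / t)\<close>, at \<open>t = r\<^sup>d\<close>\<close>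
    define G where "G k r = r ^ (d * k) * (1 - real (d * k) * ln r)" for k and r :: real
    define G' where "G' k r = (real (d * k))\<^sup>2 * r ^ (d * k) * (- ln r) / r" for k and r :: real
    \<comment> \<open>Pairing with \<open>y\<close> itself gives a scalar function that tends to 0
      at 0 and equals the square of \<open>nrm y\<close> at 1.\<close>
    define E where "E r = (\<Sum>\<alpha>\<in>A. c' \<alpha> * ip (mpow ex S \<alpha> * f) y * of_real (G (mdeg ex S \<alpha>) r))" for r
    define E' where "E' r = (\<Sum>\<alpha>\<in>A. c' \<alpha> * ip (mpow ex S \<alpha> * f) y * of_real (G' (mdeg ex S \<alpha>) r))" for r
    have G: "(G k has_real_derivative G' k r) (at r)" if "0 < r" for k r
    proof (cases "d * k")
      case 0
      then have "G k = (\<lambda>_. 1)" "G' k r = 0" unfolding G_def[abs_def] G'_def 0 by simp_all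
      then show ?thesis by simp
    next
      case (Suc n)
      have "((\<lambda>r. r ^ Suc n * (1 - real (Suc n) * ln r)) has_real_derivative
          (real (Suc n))\<^sup>2 * r ^ Suc n * (- ln r) / r) (at r)"
      proof (rule DERIV_cong[OF DERIV_mult])
        show "((\<lambda>r. r ^ Suc n) has_real_derivative real (Suc n) * r ^ n) (at r)"
          using DERIV_pow[of "Suc n" r] by simp
        show "((\<lambda>r. 1 - real (Suc n) * ln r) has_real_derivative - (real (Suc n) / r)) (at r)"
          using that by (auto intro!: derivative_eq_intros simp del: of_nat_Suc)
        show "real (Suc n) * r ^ n * (1 - real (Suc n) * ln r) + - (real (Suc n) / r) * r ^ Suc n
            = (real (Suc n))\<^sup>2 * r ^ Suc n * (- ln r) / r"
          using that by (simp add: field_simps power2_eq_square del: of_nat_Suc)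
      qed
      then show ?thesis unfolding G_def[abs_def] G'_def Suc .
    qed
    have E: "(E has_vector_derivative E' r) (at r)" if "0 < r" for r
      unfolding E_def[abs_def] E'_def
      by (intro has_vector_derivative_sum has_vector_derivative_mult_right has_vector_derivative_of_real
          G[OF that])
    have E'_bound: "cmod (E' r) \<le> C * nrm y * (M r * ln (1 / (1 - r)) ^ (d - 3))" if r: "0 < r" "r < 1" for r
    proof -
      \<comment> \<open>Splits \<open>r ^ d\<close> as \<open>r * s\<close>: the factor
        \<open>r\<close> dilates the radial derivative of the polynomial, \<open>s\<close> dilates
        the tuple. The exponent \<open>d - 1\<close> leaves two factors \<open>r\<close> against the
        singularity at 0 and one for each of the \<open>d - 3\<close> logarithms.\<close>
      define s where "s = r ^ (d - 1)"
      have s: "0 < s" "s < 1" "s \<le> r"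
        using r d power_decreasing[of 1 "d - 1" r] by (auto simp: s_def power_less_one_iff)
      let ?c = "\<lambda>\<alpha>. c \<alpha> * (of_nat (mdeg ex S \<alpha>) * of_real r ^ mdeg ex S \<alpha>)"
      let ?z = "\<Sum>\<alpha>\<in>A. const (?c \<alpha> * (of_nat (mdeg ex S \<alpha>) * of_real s ^ mdeg ex S \<alpha>)) * (mpow ex S \<alpha> * f)"
      have M0: "0 \<le> M r" using bounded_by_nonneg[OF M[OF r]] .
      have "nrm ?z \<le> real (card S) * (s / (1 - s\<^sup>2) * (dilation_const (d - 3) * log_gap s ^ (d - 3) * M r) * nrm f)"
      proof (rule radial_bound[OF S _ _ _ _ M[OF r]])
        show "0 \<le> dilation_const (d - 3) * log_gap s ^ (d - 3)"
          using dilation_const_ge_1[of "d - 3"] log_gap_ge_1[of s] s by simp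
        fix i c f assume i: "i \<in> S" and B: "bounded_by A ex (S - {i}) c (M r)"
        have "card (S - {i}) = d - 3 + 2" using i d by (simp add: S_def)
        then show "nrm (\<Sum>\<alpha>\<in>A. const (c \<alpha> * of_real s ^ mdeg ex (S - {i}) \<alpha>) * (mpow ex (S - {i}) \<alpha> * f))
            \<le> dilation_const (d - 3) * log_gap s ^ (d - 3) * M r * nrm f"
          using s S B by (intro dilation_bound) auto
      qed (use s in auto)
      also have "\<dots> \<le> real d * (s / (1 - r) * (dilation_const (d - 3) * log_gap r ^ (d - 3) * M r) * 1)"
      proof -
        have "s\<^sup>2 \<le> r" using s r by (simp add: power2_eq_square) (metis less_eq_real_def mult_left_le order_trans)
        then have "s / (1 - s\<^sup>2) \<le> s / (1 - r)"
          using s r by (intro divide_left_mono mult_pos_pos) auto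
        moreover have "0 \<le> s / (1 - s\<^sup>2)"
          using \<open>s\<^sup>2 \<le> r\<close> s r by simp
        moreover have "log_gap s ^ (d - 3) \<le> log_gap r ^ (d - 3)"
          using s r log_gap_mono[of s r] log_gap_ge_1[of s] by (intro power_mono) auto
        ultimately show ?thesis
          using f s r M0 dilation_const_ge_1[of "d - 3"] log_gap_ge_1[of s] log_gap_ge_1[of r]
          by (intro mult_mono mult_nonneg_nonneg) (auto simp: S_def)
      qed
      finally have z: "nrm ?z \<le> real d * (s / (1 - r) * (dilation_const (d - 3) * log_gap r ^ (d - 3) * M r))"
        by simp
      have E'_eq: "E' r = of_real ((real d)\<^sup>2 * (- ln r) / r) * ip ?z y"
      proof -
        have "c' \<alpha> * ip (mpow ex S \<alpha> * f) y * of_real (G' (mdeg ex S \<alpha>) r)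
            = of_real ((real d)\<^sup>2 * (- ln r) / r)
              * (?c \<alpha> * (of_nat (mdeg ex S \<alpha>) * of_real s ^ mdeg ex S \<alpha>) * ip (mpow ex S \<alpha> * f) y)" for \<alpha>
        proof -
          have "d * mdeg ex S \<alpha> = mdeg ex S \<alpha> + (d - 1) * mdeg ex S \<alpha>" using d by (cases d) auto
          then have "r ^ (d * mdeg ex S \<alpha>) = r ^ mdeg ex S \<alpha> * s ^ mdeg ex S \<alpha>"
            by (simp add: s_def power_add power_mult)
          then have "G' (mdeg ex S \<alpha>) r = (real d)\<^sup>2 * (- ln r) / r * ((real (mdeg ex S \<alpha>) * r ^ mdeg ex S \<alpha>) * (real (mdeg ex S \<alpha>) * s ^ mdeg ex S \<alpha>))"
            by (simp add: G'_def power2_eq_square)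
          then have G'c: "of_real (G' (mdeg ex S \<alpha>) r) = of_real ((real d)\<^sup>2 * (- ln r) / r) * ((of_nat (mdeg ex S \<alpha>) * of_real r ^ mdeg ex S \<alpha>)
              * (of_nat (mdeg ex S \<alpha>) * of_real s ^ mdeg ex S \<alpha>) :: complex)"
            by (simp only: of_real_mult of_real_power of_real_of_nat_eq)
          show ?thesis
            unfolding G'c by (cases "mdeg ex S \<alpha> = 0") (simp_all add: c'_def mult_ac)
        qed
        then show ?thesis
          unfolding E'_def ip_sum_left ip_scale_left sum_distrib_left by simp
      qed
      have "cmod (E' r) = (real d)\<^sup>2 * (- ln r) / r * cmod (ip ?z y)"
      proof -
        have "0 \<le> - ln r" using r by simp
        then have "0 \<le> (real d)\<^sup>2 * (- ln r) / r" using r by (intro divide_nonneg_nonneg mult_nonneg_nonneg) auto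
        then show ?thesis
          unfolding E'_eq by (simp only: norm_mult norm_of_real abs_of_nonneg)
      qed
      also have "\<dots> \<le> (real d)\<^sup>2 * ((1 - r) / r) / r * (nrm ?z * nrm y)"
      proof -
        \<comment> \<open>The zero of \<open>ln r\<close> at 1 cancels the pole
          \<open>1 / (1 - r)\<close> left by \<open>radial_bound\<close>.\<close>
        have "- ln r \<le> (1 - r) / r"
          using ln_le_minus_one[of "1 / r"] r by (simp add: ln_div diff_divide_distrib)
        then show ?thesis using r
          by (intro mult_mono cauchy_schwarz divide_right_mono mult_left_mono) auto
      qed
      also have "\<dots> \<le> (real d)\<^sup>2 * ((1 - r) / r) / r
          * (real d * (s / (1 - r) * (dilation_const (d - 3) * log_gap r ^ (d - 3) * M r)) * nrm y)"
        using z r by (intro mult_left_mono mult_right_mono) auto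
      also have "\<dots> = real d ^ 3 * dilation_const (d - 3) * (r * log_gap r) ^ (d - 3) * M r * nrm y"
      proof -
        have "d - 1 = (d - 3) + 2" using d by simp
        then have "s = r ^ (d - 3) * r * r" by (simp add: s_def power_add power2_eq_square)
        then show ?thesis using r by (simp add: power_mult_distrib power2_eq_square power3_eq_cube)
      qed
      also have "\<dots> \<le> real d ^ 3 * dilation_const (d - 3) * (2 * ln (1 / (1 - r))) ^ (d - 3) * M r * nrm y"
      proof -
        define l where "l = ln (1 / (1 - r))"
        have l: "log_gap r = 1 + l" using r by (simp add: l_def log_gap_def ln_div)
        have "r \<le> l" using ln_le_minus_one[of "1 - r"] r by (simp add: l_def ln_div)
        moreover from this have "r * l \<le> 1 * l" using r by (intro mult_right_mono) auto
        \<comment> \<open>Near 0 the logarithm \<open>l\<close> vanishes while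
          \<open>log_gap r\<close> tends to 1; the factor \<open>r\<close> makes the comparison
          possible.\<close>
        ultimately have "r * log_gap r \<le> 2 * l" by (simp add: l distrib_left)
        then show ?thesis
          unfolding l_def using r M0 dilation_const_ge_1[of "d - 3"] log_gap_ge_1[of r]
          by (intro mult_right_mono mult_left_mono power_mono) auto
      qed
      also have "\<dots> = C * nrm y * (M r * ln (1 / (1 - r)) ^ (d - 3))"
        by (simp add: C_def power_mult_distrib)
      finally show ?thesis .
    qed
    \<comment> \<open>The bound for \<open>E'\<close> holds for \<open>0 < r < 1\<close>, so compact
      subintervals come first and both ends are reached by limits.\<close>
    have ab: "cmod (E b - E a) \<le> C * nrm y * J" if ab: "0 < a" "a \<le> b" "b < 1" for a b
    proof -
      have cont: "continuous_on {a..b} E'"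
        unfolding E'_def G'_def using ab by (intro continuous_intros) auto
      have der: "(E has_vector_derivative E' x) (at x within {a..b})" if "a \<le> x" "x \<le> b" for x
        by (rule has_vector_derivative_at_within[OF E]) (use that ab in simp)
      have int: "integrable lborel (\<lambda>x. indicator {a..b} x *\<^sub>R E' x)"
        using has_bochner_integral_FTC_Icc[OF ab(2) der cont] by (rule integrable.intros)
      have eq: "integral\<^sup>L lborel (\<lambda>x. indicator {a..b} x *\<^sub>R E' x) = E b - E a"
        using integral_FTC_Icc[OF ab(2) der cont] .
      have "ennreal (cmod (E b - E a)) \<le> (\<integral>\<^sup>+x. ennreal (norm (indicator {a..b} x *\<^sub>R E' x)) \<partial>lborel)"
        unfolding eq[symmetric] by (rule integral_norm_bound_ennreal[OF int])
      \<comment> \<open>The constant is extracted on this side because \<open>g\<close> need not be measurable.\<close>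
      also have "\<dots> = (\<integral>\<^sup>+x. ennreal (C * nrm y) * ennreal (norm (indicator {a..b} x *\<^sub>R E' x) / (C * nrm y)) \<partial>lborel)"
      proof -
        have "0 < C * nrm y" using y0 dilation_const_ge_1[of "d - 3"] d by (simp add: C_def)
        moreover have "ennreal t = ennreal K * ennreal (t / K)" if "0 < K" for t K
          using ennreal_mult'[of K "t / K"] that by simp
        ultimately show ?thesis by (intro nn_integral_cong) blast
      qed
      also have "\<dots> = ennreal (C * nrm y) * (\<integral>\<^sup>+x. ennreal (norm (indicator {a..b} x *\<^sub>R E' x) / (C * nrm y)) \<partial>lborel)"
        by (intro nn_integral_cmult measurable_compose[OF _ measurable_ennreal] borel_measurable_divide
            measurable_compose[OF borel_measurable_integrable[OF int] borel_measurable_norm]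
            borel_measurable_const)
      also have "\<dots> \<le> ennreal (C * nrm y) * I"
        unfolding I_def
      proof (intro mult_left_mono nn_integral_mono)
        fix x
        show "ennreal (norm (indicator {a..b} x *\<^sub>R E' x) / (C * nrm y)) \<le> g x * indicator {0..1} x"
        proof (cases "x \<in> {a..b}")
          case True
          then have x: "0 < x" "x < 1" using ab by auto
          have "0 < C * nrm y" using y0 dilation_const_ge_1[of "d - 3"] d by (simp add: C_def)
          then have "cmod (E' x) / (C * nrm y) \<le> M x * ln (1 / (1 - x)) ^ (d - 3)"
            using E'_bound[OF x] by (simp add: pos_divide_le_eq mult.commute)
          then show ?thesis using True x g[OF x] by (auto intro: order.trans[OF ennreal_leI])
        qed simp
      qed simp
      also have "\<dots> = ennreal (C * nrm y * J)"
        using C0 J by (simp add: ennreal_mult)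
      finally show ?thesis using C0 J by (simp add: ennreal_le_iff)
    qed
    have lim0: "(E \<longlongrightarrow> 0) (at_right 0)"
    proof -
      have "((\<lambda>r. c' \<alpha> * ip (mpow ex S \<alpha> * f) y * of_real (G (mdeg ex S \<alpha>) r)) \<longlongrightarrow> 0) (at_right 0)" for \<alpha>
      proof (cases "mdeg ex S \<alpha> = 0")
        case True
        then show ?thesis by (simp add: c'_def)
      next
        case False
        then obtain n where n: "d * mdeg ex S \<alpha> = Suc n" using d by (cases "d * mdeg ex S \<alpha>") auto
        have "((\<lambda>r::real. r * ln r) \<longlongrightarrow> 0) (at_right 0)" by real_asymp
        then have "((\<lambda>r::real. r ^ Suc n - real (Suc n) * (r ^ n * (r * ln r))) \<longlongrightarrow> 0 ^ Suc n - real (Suc n) * (0 ^ n * 0)) (at_right 0)"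
          by (intro tendsto_intros)
        then have "(G (mdeg ex S \<alpha>) \<longlongrightarrow> 0) (at_right 0)"
          unfolding G_def[abs_def] n by (simp add: algebra_simps)
        then show ?thesis
          by (intro tendsto_mult_right_zero) (metis of_real_0 tendsto_of_real)
      qed
      then show ?thesis unfolding E_def[abs_def] by (intro tendsto_null_sum)
    qed
    have E1: "E 1 = of_real ((nrm y)\<^sup>2)"
    proof -
      have "E 1 = (\<Sum>\<alpha>\<in>A. c' \<alpha> * ip (mpow ex S \<alpha> * f) y)" by (simp add: E_def G_def)
      also have "\<dots> = ip (\<Sum>\<alpha>\<in>A. const (c' \<alpha>) * (mpow ex S \<alpha> * f)) y"
        by (simp only: ip_sum_left ip_scale_left)
      also have "\<dots> = ip y y" by (simp only: y_def)
      finally show ?thesis by (simp only: ip_self)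
    qed
    have b: "cmod (E b) \<le> C * nrm y * J" if "0 < b" "b < 1" for b
    proof (rule tendsto_upperbound)
      show "((\<lambda>a. cmod (E b - E a)) \<longlongrightarrow> cmod (E b)) (at_right 0)"
        using tendsto_norm[OF tendsto_diff[OF tendsto_const lim0]] by simp
      show "\<forall>\<^sub>F a in at_right 0. cmod (E b - E a) \<le> C * nrm y * J"
        unfolding eventually_at_right_field using ab that by (intro exI[of _ b]) auto
    qed simp
    have "cmod (E 1) \<le> C * nrm y * J"
    proof (rule tendsto_upperbound)
      have "isCont E 1" using E[of 1] has_vector_derivative_continuous by fastforce
      then have "(E \<longlongrightarrow> E 1) (at_left 1)"
        unfolding isCont_def by (rule tendsto_mono[rotated]) (simp add: at_le)
      then show "((\<lambda>b. cmod (E b)) \<longlongrightarrow> cmod (E 1)) (at_left 1)" by (rule tendsto_norm)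
      show "\<forall>\<^sub>F r in at_left 1. cmod (E r) \<le> C * nrm y * J"
        unfolding eventually_at_left_field using b by (intro exI[of _ "0 :: real"]) auto
    qed simp
    then have "nrm y * nrm y \<le> C * J * nrm y"
      unfolding E1 by (simp add: power2_eq_square norm_mult mult_ac del: of_real_power)
    then have "nrm y \<le> C * J" using y0 by simp
    then show ?thesis using J C0 by (simp flip: ennreal_mult)
  qed
  have "ennreal (nrm (\<Sum>\<alpha>\<in>A. const (c \<alpha>) * (mpow ex S \<alpha> * f))) \<le> ennreal (cmod P0 + nrm y)"
    by (rule ennreal_leI[OF sum_le])
  also have "\<dots> = ennreal (cmod P0) + ennreal (nrm y)"
    by (rule ennreal_plus) simp_all
  also have "\<dots> \<le> ennreal (cmod P0) + ennreal C * I"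
    using y_le by (rule add_left_mono)
  also have "\<dots> \<le> (1 + ennreal C) * ennreal (cmod P0) + (1 + ennreal C) * I"
    by (intro add_mono) (auto simp: distrib_right)
  also have "\<dots> = ennreal (1 + C) * (ennreal (cmod P0) + I)"
    using C0 by (simp add: distrib_left ennreal_plus)
  finally show ?thesis unfolding P0_def I_def .
qed

end

end

section \<open>Polynomials in commuting contractions\<close>

definition indet :: "nat \<Rightarrow> mpoly" where
  "indet i = Poly_Mapping.single (Poly_Mapping.single i 1) 1"

lemma single_eq_prod_indet:
  assumes "Poly_Mapping.keys m \<subseteq> {..<d}"
  shows "Poly_Mapping.single m c
    = Poly_Mapping.single 0 c * (\<Prod>j<d. indet j ^ Poly_Mapping.lookup m j)"
proof -
  have pw: "indet j ^ n = Poly_Mapping.single (Poly_Mapping.single j n) 1" for j n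
    by (induction n) (simp_all add: indet_def mult_single single_add[symmetric])
  have "(\<Prod>j\<in>S. indet j ^ Poly_Mapping.lookup m j)
      = Poly_Mapping.single (\<Sum>j\<in>S. Poly_Mapping.single j (Poly_Mapping.lookup m j)) 1" if "finite S" for S
    using that by (induction S) (simp_all add: pw mult_single)
  moreover have "(\<Sum>j<d. Poly_Mapping.single j (Poly_Mapping.lookup m j)) = m"
  proof (rule poly_mapping_eqI)
    fix k
    have "Poly_Mapping.lookup (\<Sum>j<d. Poly_Mapping.single j (Poly_Mapping.lookup m j)) k
        = (\<Sum>j<d. if k = j then Poly_Mapping.lookup m j else 0)"
      by (auto simp: lookup_sum lookup_single when_def intro: sum.cong)
    also have "\<dots> = Poly_Mapping.lookup m k"
      using assms by (auto simp: in_keys_iff)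
    finally show "Poly_Mapping.lookup (\<Sum>j<d. Poly_Mapping.single j (Poly_Mapping.lookup m j)) k
        = Poly_Mapping.lookup m k" .
  qed
  ultimately show ?thesis by (simp add: mult_single)
qed

lemma mpoly_eq_sum_single:
  fixes p :: mpoly
  shows "p = (\<Sum>m\<in>Poly_Mapping.keys p. Poly_Mapping.single m (Poly_Mapping.lookup p m))"
proof (rule poly_mapping_eqI)
  fix k
  have "Poly_Mapping.lookup (\<Sum>m\<in>Poly_Mapping.keys p. Poly_Mapping.single m (Poly_Mapping.lookup p m)) k
      = (\<Sum>m\<in>Poly_Mapping.keys p. if k = m then Poly_Mapping.lookup p m else 0)"
    by (auto simp: lookup_sum lookup_single when_def intro: sum.cong)
  also have "\<dots> = Poly_Mapping.lookup p k"
    by (auto simp: in_keys_iff)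
  finally show "Poly_Mapping.lookup p k = Poly_Mapping.lookup (\<Sum>m\<in>Poly_Mapping.keys p. Poly_Mapping.single m (Poly_Mapping.lookup p m)) k"
    by simp
qed

section \<open>The calculus sending a polynomial \<open>p\<close> to \<open>p(T) x\<close>\<close>

context complex_hilbert_space
begin

lemma smult_distrib:
  assumes "y \<in> carrier H"
  shows "(a + b) \<odot>\<^bsub>H\<^esub> y = a \<odot>\<^bsub>H\<^esub> y \<oplus>\<^bsub>H\<^esub> b \<odot>\<^bsub>H\<^esub> y" "(a * b) \<odot>\<^bsub>H\<^esub> y = a \<odot>\<^bsub>H\<^esub> (b \<odot>\<^bsub>H\<^esub> y)"
    "1 \<odot>\<^bsub>H\<^esub> y = y"
  using smult_algebra[OF assms assms] by blast+

context
  fixes d :: nat and T x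
  assumes cc: "commuting_contractions d H T" and x: "x \<in> carrier H"
begin

lemma T_linear: "i < d \<Longrightarrow> linear_op H (T i)"
  using cc by (simp add: commuting_contractions_def)

lemma monom_op_closed: "monom_op d T m x \<in> carrier H"
  by (intro monom_op_in linear_opD(1)[OF T_linear] x)

lemma poly_op_superset:
  assumes "finite B" "Poly_Mapping.keys p \<subseteq> B"
  shows "poly_op d H T p x = (\<Oplus>\<^bsub>H\<^esub>m\<in>B. Poly_Mapping.lookup p m \<odot>\<^bsub>H\<^esub> monom_op d T m x)"
  unfolding poly_op_def
  using assms by (intro M.add.finprod_mono_neutral_cong_left)
    (auto simp: in_keys_iff monom_op_closed)

lemma poly_op_closed: "poly_op d H T p x \<in> carrier H"
  unfolding poly_op_def by (rule M.finsum_closed) (auto simp: monom_op_closed)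

lemma poly_op_add: "poly_op d H T (p + q) x = poly_op d H T p x \<oplus>\<^bsub>H\<^esub> poly_op d H T q x"
proof -
  let ?B = "Poly_Mapping.keys p \<union> Poly_Mapping.keys q"
  have "poly_op d H T (p + q) x
      = (\<Oplus>\<^bsub>H\<^esub>m\<in>?B. Poly_Mapping.lookup p m \<odot>\<^bsub>H\<^esub> monom_op d T m x \<oplus>\<^bsub>H\<^esub> Poly_Mapping.lookup q m \<odot>\<^bsub>H\<^esub> monom_op d T m x)"
    using keys_add[of p q]
    by (subst poly_op_superset[of ?B]) (simp_all add: lookup_add smult_distrib monom_op_closed)
  also have "\<dots> = poly_op d H T p x \<oplus>\<^bsub>H\<^esub> poly_op d H T q x"
    by (subst M.finsum_addf) (simp_all add: poly_op_superset[of ?B] monom_op_closed)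
  finally show ?thesis .
qed

lemma poly_op_single: "poly_op d H T (Poly_Mapping.single m c) x = c \<odot>\<^bsub>H\<^esub> monom_op d T m x"
  by (subst poly_op_superset[of "{m}"]) (simp_all add: monom_op_closed)

lemma poly_op_zero: "poly_op d H T 0 x = \<zero>\<^bsub>H\<^esub>"
  by (simp add: poly_op_def)

lemma mpoly_additive_induct:
  assumes "P 0" "\<And>m c. P (Poly_Mapping.single m c)" "\<And>p q. P p \<Longrightarrow> P q \<Longrightarrow> P (p + q)"
  shows "P (p :: mpoly)"
proof -
  have "P (\<Sum>m\<in>S. Poly_Mapping.single m (Poly_Mapping.lookup p m))" for S
    by (induction S rule: infinite_finite_induct) (auto intro: assms)
  then show ?thesis using mpoly_eq_sum_single[of p] by metis
qed

lemma poly_op_smult: "poly_op d H T (Poly_Mapping.single 0 a * p) x = a \<odot>\<^bsub>H\<^esub> poly_op d H T p x"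
proof (induction p rule: mpoly_additive_induct)
  case 1
  then show ?case by (simp add: poly_op_zero)
next
  case (2 m c)
  then show ?case by (simp add: mult_single poly_op_single smult_distrib monom_op_closed)
next
  case (3 p q)
  then show ?case by (simp add: distrib_left poly_op_add smult_algebra poly_op_closed)
qed

text \<open>The new factor \<open>T i\<close> arises at its place in the ordered product and is
  moved to the front by commutativity.\<close>

lemma monom_op_indet:
  assumes i: "i < d"
  shows "monom_op d T (Poly_Mapping.single i 1 + m) x = T i (monom_op d T m x)"
proof -
  define F where "F m l = foldr (\<lambda>i A. (T i ^^ Poly_Mapping.lookup m i) \<circ> A) l id x" for m l
  have F: "F m [] = x" "F m (j # l) = (T j ^^ Poly_Mapping.lookup m j) (F m l)" for m j l
    by (simp_all add: F_def)
  have clo: "T j y \<in> carrier H" if "j < d" "y \<in> carrier H" for j y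
    using linear_opD(1)[OF T_linear] that by blast
  have pw: "(T j ^^ n) y \<in> carrier H \<and> (T j ^^ n) (T i y) = T i ((T j ^^ n) y)"
    if "j < d" "y \<in> carrier H" for j n y
    using that cc i by (induction n) (auto simp: clo commuting_contractions_def)
  \<comment> \<open>In a distinct list the extra factor occurs once if \<open>i\<close> is present;
    a tail without \<open>i\<close> is unchanged.\<close>
  have "F m l \<in> carrier H \<and> F (Poly_Mapping.single i 1 + m) l = (if i \<in> set l then T i (F m l) else F m l)"
    if "set l \<subseteq> {..<d}" "distinct l" for l
    using that
  proof (induction l)
    case Nil
    then show ?case by (simp add: x F)
  next
    case (Cons j l)
    then have IH: "F m l \<in> carrier H"
      "F (Poly_Mapping.single i 1 + m) l = (if i \<in> set l then T i (F m l) else F m l)" and j: "j < d"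
      by auto
    show ?case
    proof (cases "j = i")
      case True
      then show ?thesis using Cons.prems IH j pw[OF j IH(1)]
        by (simp add: F lookup_add)
    next
      case False
      then show ?thesis using Cons.prems IH j pw[OF j IH(1)]
        by (auto simp: F lookup_add lookup_single when_def)
    qed
  qed
  from this[of "[0..<d]"] i show ?thesis by (simp add: F_def monom_op_def atLeast0LessThan)
qed

lemma poly_op_indet:
  assumes i: "i < d"
  shows "poly_op d H T (indet i * p) x = T i (poly_op d H T p x)"
proof (induction p rule: mpoly_additive_induct)
  case 1
  then show ?case using linear_op_zero[OF T_linear[OF i]] by (simp add: poly_op_zero)
next
  case (2 m c)
  then show ?case
    using linear_opD(3)[OF T_linear[OF i] monom_op_closed[of m], of c] monom_op_indet[OF i, of m]
    by (simp add: indet_def mult_single poly_op_single)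
next
  case (3 p q)
  then show ?case
    using linear_opD(2)[OF T_linear[OF i] poly_op_closed[of p] poly_op_closed[of q]]
    by (simp add: distrib_left poly_op_add)
qed

lemma poly_op_one: "poly_op d H T 1 x = x"
proof -
  have "monom_op d T 0 x = x"
  proof -
    have "foldr (\<lambda>i A. (T i ^^ Poly_Mapping.lookup 0 i) \<circ> A) l id = id" for l
      by (induction l) simp_all
    then show ?thesis by (simp only: monom_op_def id_apply)
  qed
  then show ?thesis using poly_op_single[of 0 1] by (simp add: smult_distrib x)
qed

end

end

section \<open>Evaluation of polynomials and of their radial derivatives\<close>

lemma mpoly_eval_eq:
  assumes "mpoly_vars p \<subseteq> {..<d}"
  shows "mpoly_eval p z = (\<Sum>m\<in>Poly_Mapping.keys p. Poly_Mapping.lookup p m * (\<Prod>j<d. z j ^ Poly_Mapping.lookup m j))"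
  unfolding mpoly_eval_def
proof (intro sum.cong refl arg_cong2[where f = "(*)"] prod.mono_neutral_left)
  fix m assume "m \<in> Poly_Mapping.keys p"
  then show "Poly_Mapping.keys m \<subseteq> {..<d}" using assms by (auto simp: mpoly_vars_def)
qed (auto simp: in_keys_iff)

text \<open>Euler's identity: monomials are eigenvectors of the radial derivative, with their
  degrees as eigenvalues.\<close>

lemma radial_deriv_mpoly_eval:
  assumes p: "mpoly_vars p \<subseteq> {..<d}"
  shows "radial_deriv d (mpoly_eval p) z = (\<Sum>m\<in>Poly_Mapping.keys p. Poly_Mapping.lookup p m
    * (of_nat (\<Sum>j<d. Poly_Mapping.lookup m j) * (\<Prod>j<d. z j ^ Poly_Mapping.lookup m j)))"
proof -
  have "z j * deriv (\<lambda>w. mpoly_eval p (z(j := w))) (z j) = (\<Sum>m\<in>Poly_Mapping.keys p. Poly_Mapping.lookup p m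
    * (of_nat (Poly_Mapping.lookup m j) * (\<Prod>j<d. z j ^ Poly_Mapping.lookup m j)))" if j: "j < d" for j
  proof -
    let ?R = "\<lambda>m. \<Prod>i\<in>{..<d} - {j}. z i ^ Poly_Mapping.lookup m i"
    have "(\<lambda>w. mpoly_eval p (z(j := w)))
        = (\<lambda>w. \<Sum>m\<in>Poly_Mapping.keys p. Poly_Mapping.lookup p m * (w ^ Poly_Mapping.lookup m j * ?R m))"
    proof
      fix w
      have "(\<Prod>i<d. (z(j := w)) i ^ Poly_Mapping.lookup m i) = w ^ Poly_Mapping.lookup m j * ?R m" for m
        using j by (subst prod.remove[of _ j]) (auto intro: prod.cong)
      then show "mpoly_eval p (z(j := w))
          = (\<Sum>m\<in>Poly_Mapping.keys p. Poly_Mapping.lookup p m * (w ^ Poly_Mapping.lookup m j * ?R m))"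
        by (simp only: mpoly_eval_eq[OF p])
    qed
    moreover have "((\<lambda>w. \<Sum>m\<in>Poly_Mapping.keys p. Poly_Mapping.lookup p m * (w ^ Poly_Mapping.lookup m j * ?R m))
        has_field_derivative (\<Sum>m\<in>Poly_Mapping.keys p. Poly_Mapping.lookup p m
          * (of_nat (Poly_Mapping.lookup m j) * z j ^ (Poly_Mapping.lookup m j - 1) * ?R m))) (at (z j))"
      by (intro DERIV_sum DERIV_cmult DERIV_cmult_right) (auto intro!: derivative_eq_intros)
    ultimately have "deriv (\<lambda>w. mpoly_eval p (z(j := w))) (z j) = (\<Sum>m\<in>Poly_Mapping.keys p. Poly_Mapping.lookup p m
          * (of_nat (Poly_Mapping.lookup m j) * z j ^ (Poly_Mapping.lookup m j - 1) * ?R m))"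
      by (simp only: DERIV_imp_deriv)
    moreover have "z j * (Poly_Mapping.lookup p m * (of_nat (Poly_Mapping.lookup m j) * z j ^ (Poly_Mapping.lookup m j - 1) * ?R m))
        = Poly_Mapping.lookup p m * (of_nat (Poly_Mapping.lookup m j) * (\<Prod>j<d. z j ^ Poly_Mapping.lookup m j))" for m
    proof (cases "Poly_Mapping.lookup m j")
      case (Suc n)
      have "(\<Prod>j<d. z j ^ Poly_Mapping.lookup m j) = z j ^ Poly_Mapping.lookup m j * ?R m"
        using j by (subst prod.remove[of _ j]) auto
      then show ?thesis using Suc by simp
    qed simp
    ultimately show ?thesis by (simp only: sum_distrib_left)
  qed
  then show ?thesis
    unfolding radial_deriv_def by (simp add: sum.swap[of _ "{..<d}"] sum_distrib_left sum_distrib_right)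
qed

text \<open>In the pulled back form \<open>T i\<close> becomes multiplication by
  \<open>indet i\<close> and stays contractive; polynomials whose value at \<open>T\<close>
  annihilates \<open>x\<close> become null vectors.\<close>

lemma (in complex_hilbert_space) contractive_tuple_poly_op:
  assumes cc: "commuting_contractions d H T" and x: "x \<in> carrier H"
  shows "contractive_tuple (Poly_Mapping.single 0)
    (\<lambda>p q. cinner H (poly_op d H T p x) (poly_op d H T q x)) indet d"
proof -
  let ?ip = "\<lambda>p q. cinner H (poly_op d H T p x) (poly_op d H T q x)"
  note closed = poly_op_closed[OF cc x]
  have semi: "semi_inner (\<lambda>c p. Poly_Mapping.single 0 c * p) ?ip"
  proof (rule semi_innerI)
    show "vector_space (\<lambda>c p. Poly_Mapping.single 0 c * (p :: mpoly))"
      by unfold_locales (simp_all add: distrib_left distrib_right single_add mult_single mult.assoc[symmetric])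
    show "?ip (p + q) r = ?ip p r + ?ip q r" for p q r
      unfolding poly_op_add[OF cc x] by (intro cinner_add_left closed)
    show "?ip (Poly_Mapping.single 0 c * p) q = c * ?ip p q" for c p q
      unfolding poly_op_smult[OF cc x] by (intro cinner_smult_left closed)
    show "?ip q p = cnj (?ip p q)" for p q
      by (intro cinner_commute closed)
    show "0 \<le> Re (?ip p p)" for p
      by (intro cinner_nonneg closed)
  qed
  interpret semi_inner_algebra "Poly_Mapping.single 0" ?ip
    by (intro semi_inner_algebra.intro semi) (simp add: mult_single)
  show ?thesis
  proof
    show "nrm (indet i * p) \<le> nrm p" if i: "i < d" for i p
    proof -
      have "nrm q = hnorm H (poly_op d H T q x)" for q
        by (simp add: nrm_def hnorm_def)
      moreover have "op_norm H (T i) \<le> 1"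
        using cc i by (simp add: commuting_contractions_def)
      ultimately show ?thesis
        using contraction_le[OF T_linear[OF cc x i] _ closed[of p]] by (simp add: poly_op_indet[OF cc x i])
    qed
  qed
qed

text \<open>Applies \<open>besov_bound\<close> to the pulled back form at the polynomial 1, which
  stands for the vector \<open>x\<close>.\<close>

lemma (in complex_hilbert_space) poly_op_bound:
  assumes cc: "commuting_contractions d H T" and x: "x \<in> carrier H" "hnorm H x \<le> 1"
    and d: "3 \<le> d" and p: "mpoly_vars p \<subseteq> {..<d}"
  shows "ennreal (hnorm H (poly_op d H T p x))
    \<le> ennreal (1 + real d ^ 3 * dilation_const (d - 3) * 2 ^ (d - 3)) *
      (ennreal (cmod (mpoly_eval p (\<lambda>_. 0))) +
       (\<integral>\<^sup>+ r \<in> {0..1}. (polydisc_norm d (dilate (radial_deriv d (mpoly_eval p)) r)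
          * ennreal (ln (1 / (1 - r)) ^ (d - 3))) \<partial>lborel))"
proof -
  interpret contractive_tuple "Poly_Mapping.single 0"
    "\<lambda>p q. cinner H (poly_op d H T p x) (poly_op d H T q x)" indet d
    by (rule contractive_tuple_poly_op[OF cc x(1)])
  have nrm: "nrm q = hnorm H (poly_op d H T q x)" for q
    by (simp add: nrm_def hnorm_def)
  let ?A = "Poly_Mapping.keys p" and ?ex = "Poly_Mapping.lookup :: (nat \<Rightarrow>\<^sub>0 nat) \<Rightarrow> nat \<Rightarrow> nat"
    and ?c = "Poly_Mapping.lookup p"
  let ?F = "\<lambda>r. dilate (radial_deriv d (mpoly_eval p)) r"
  have F: "?F r w = (\<Sum>m\<in>?A. ?c m * (of_nat (mdeg ?ex {..<d} m) * of_real r ^ mdeg ?ex {..<d} m) * mval ?ex {..<d} w m)" for r w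
    unfolding dilate_def radial_deriv_mpoly_eval[OF p]
    by (simp add: mdeg_def mval_def power_mult_distrib prod.distrib power_sum mult.assoc)
  have "p = (\<Sum>m\<in>?A. Poly_Mapping.single 0 (?c m) * (mpow ?ex {..<d} m * 1))"
  proof -
    have "Poly_Mapping.single m (?c m) = Poly_Mapping.single 0 (?c m) * (mpow ?ex {..<d} m * 1)" if "m \<in> ?A" for m
      using single_eq_prod_indet[of m d] p that by (force simp: mpow_def mpoly_vars_def)
    then show ?thesis using mpoly_eq_sum_single[of p] by simp
  qed
  then have "ennreal (hnorm H (poly_op d H T p x))
      = ennreal (nrm (\<Sum>m\<in>?A. Poly_Mapping.single 0 (?c m) * (mpow ?ex {..<d} m * 1)))"
    by (simp only: nrm)
  also have "\<dots> \<le> ennreal (1 + real d ^ 3 * dilation_const (d - 3) * 2 ^ (d - 3)) *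
      (ennreal (cmod (\<Sum>m\<in>?A. ?c m * mval ?ex {..<d} (\<lambda>_. 0) m)) +
       (\<integral>\<^sup>+ r \<in> {0..1}. (polydisc_norm d (?F r) * ennreal (ln (1 / (1 - r)) ^ (d - 3))) \<partial>lborel))"
  proof (rule besov_bound[OF _ d, where M = "\<lambda>r. enn2real (polydisc_norm d (?F r))"])
    show "finite ?A" by simp
    show "nrm 1 \<le> 1" using x by (simp add: nrm poly_op_one[OF cc])
    fix r :: real assume r: "0 < r" "r < 1"
    let ?N = "polydisc_norm d (?F r)"
    \<comment> \<open>The coefficient sum bounds the polynomial on the polydisc; finiteness lets
      \<open>enn2real\<close> keep the value of the norm.\<close>
    have "?N \<le> ennreal (\<Sum>m\<in>?A. cmod (?c m * (of_nat (mdeg ?ex {..<d} m) * of_real r ^ mdeg ?ex {..<d} m)))"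
      unfolding polydisc_norm_def F
    proof (intro SUP_least ennreal_leI order.trans[OF norm_sum] sum_mono)
      fix w m assume w: "w \<in> polydisc d"
      have "cmod (mval ?ex {..<d} w m) \<le> 1"
        unfolding mval_def prod_norm[symmetric] norm_power using w
        by (intro prod_le_1 conjI power_le_one) (auto simp: polydisc_def Pi_iff less_imp_le)
      then show "cmod (?c m * (of_nat (mdeg ?ex {..<d} m) * of_real r ^ mdeg ?ex {..<d} m) * mval ?ex {..<d} w m)
          \<le> cmod (?c m * (of_nat (mdeg ?ex {..<d} m) * of_real r ^ mdeg ?ex {..<d} m))"
        unfolding norm_mult[of _ "mval ?ex {..<d} w m"] by (intro mult_left_le) auto
    qed
    then have fin: "?N < \<infinity>"
      by (rule order.strict_trans1) simp
    show "bounded_by ?A ?ex {..<d} (\<lambda>m. ?c m * (of_nat (mdeg ?ex {..<d} m) * of_real r ^ mdeg ?ex {..<d} m)) (enn2real ?N)"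
      unfolding bounded_by_def
    proof (intro allI impI)
      fix w :: "nat \<Rightarrow> complex" assume w: "\<forall>j. cmod (w j) \<le> 1"
      \<comment> \<open>The norm sees only the open polydisc; a point \<open>w\<close> of the closed
        one is the limit of \<open>t * w\<close> for \<open>t\<close> tending to 1.\<close>
      let ?G = "\<lambda>t::real. \<Sum>m\<in>?A. ?c m * (of_nat (mdeg ?ex {..<d} m) * of_real r ^ mdeg ?ex {..<d} m)
          * (of_real t ^ mdeg ?ex {..<d} m * mval ?ex {..<d} w m)"
      have "cmod (?G 1) \<le> enn2real ?N"
      proof (rule tendsto_upperbound)
        have "isCont ?G 1" by (intro continuous_intros)
        then have "(?G \<longlongrightarrow> ?G 1) (at_left 1)"
          unfolding isCont_def by (rule tendsto_mono[rotated]) (simp add: at_le)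
        then show "((\<lambda>t. cmod (?G t)) \<longlongrightarrow> cmod (?G 1)) (at_left 1)" by (rule tendsto_norm)
        have "cmod (?G t) \<le> enn2real ?N" if t: "0 < t" "t < 1" for t
        proof -
          have "(\<lambda>j. of_real t * w j) \<in> polydisc d"
          proof -
            have "t * cmod (w j) < 1" for j
              using w t mult_left_mono[of "cmod (w j)" 1 t] by (metis less_le_trans mult.right_neutral not_le order_le_less_trans less_imp_le)
            then show ?thesis using t by (simp add: polydisc_def norm_mult)
          qed
          then have "ennreal (cmod (?F r (\<lambda>j. of_real t * w j))) \<le> ?N"
            unfolding polydisc_norm_def by (rule SUP_upper)
          also have "?N = ennreal (enn2real ?N)" using fin by simp
          also have "?F r (\<lambda>j. of_real t * w j) = ?G t"
            unfolding F mval_scale ..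
          finally show ?thesis by (simp add: ennreal_le_iff)
        qed
        then show "\<forall>\<^sub>F t in at_left 1. cmod (?G t) \<le> enn2real ?N"
          unfolding eventually_at_left_field by (intro exI[of _ "0 :: real"]) auto
      qed simp
      then show "cmod (\<Sum>m\<in>?A. ?c m * (of_nat (mdeg ?ex {..<d} m) * of_real r ^ mdeg ?ex {..<d} m) * mval ?ex {..<d} w m)
          \<le> enn2real ?N" by simp
    qed
    show "ennreal (enn2real ?N * ln (1 / (1 - r)) ^ (d - 3)) \<le> ?N * ennreal (ln (1 / (1 - r)) ^ (d - 3))"
      using fin r by (simp add: ennreal_mult)
  qed
  also have "(\<Sum>m\<in>?A. ?c m * mval ?ex {..<d} (\<lambda>_. 0) m) = mpoly_eval p (\<lambda>_. 0)"
    by (simp add: mpoly_eval_eq[OF p] mval_def)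
  finally show ?thesis .
qed

theorem theorem1p2:
  fixes d :: nat
  assumes "d \<ge> 3"
  shows "\<exists>c :: real. c > 0 \<and>
    (\<forall>p :: mpoly. mpoly_vars p \<subseteq> {..<d} \<longrightarrow>
      schur_agler_norm d p \<le> ennreal c *
        (ennreal (cmod (mpoly_eval p (\<lambda>_. 0))) +
         (\<integral>\<^sup>+ r \<in> {0..1}.
            (polydisc_norm d (dilate (radial_deriv d (mpoly_eval p)) r)
              * ennreal (ln (1 / (1 - r)) ^ (d - 3))) \<partial>lborel)))"
proof (intro exI conjI allI impI)
  show "0 < 1 + real d ^ 3 * dilation_const (d - 3) * 2 ^ (d - 3)"
    using dilation_const_ge_1[of "d - 3"] by (intro add_pos_nonneg mult_nonneg_nonneg) auto
  fix p :: mpoly assume p: "mpoly_vars p \<subseteq> {..<d}"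
  show "schur_agler_norm d p \<le> ennreal (1 + real d ^ 3 * dilation_const (d - 3) * 2 ^ (d - 3)) *
        (ennreal (cmod (mpoly_eval p (\<lambda>_. 0))) +
         (\<integral>\<^sup>+ r \<in> {0..1}.
            (polydisc_norm d (dilate (radial_deriv d (mpoly_eval p)) r)
              * ennreal (ln (1 / (1 - r)) ^ (d - 3))) \<partial>lborel))"
    unfolding schur_agler_norm_def op_norm_def
    using complex_hilbert_space.poly_op_bound[OF _ _ _ _ assms p]
    by (auto intro!: SUP_least)
qed

end
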